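(* Let $N\ge2$, $\theta,l\in\mathbb{R}$, $N'=N+\theta$, $\tau=l-\theta$, and assume $N'>2$ and $\tau>-2$. Consider the equation $$-\mathrm{div}(|x|^\theta\nabla v)=|x|^l|v|^{p-1}v\quad\text{in }\mathbb{R}^N.\qquad( * )$$ If either $2<N'\le10+4\tau$ and $p>1$, or $N'>10+4\tau$ and $1<p<p_c(N',\tau)$, and if $v\in H^{1,\theta}_{loc}(\mathbb{R}^N)\cap L^\infty_{loc}(\mathbb{R}^N)$ is a stable solution of $( * )$ (nonnegative or not), then $v\equiv0$. On the other hand, if $p\ge p_c(N',\tau)$ (so that in particular $p_c(N',\tau)<\infty$), then $( * )$ admits a family of stable positive radial solutions in $\mathbb{R}^N$.
   Context: $H^{1,\theta}(\Omega)$ is the space of functions $\varphi$ with $|x|^{\theta/2}\varphi,\ |x|^{\theta/2}|\nabla\varphi|\in L^2(\Omega)$; $H^{1,\theta}_{loc}(\Omega)$ is the corresponding local space, and $H^{1,\theta}_c(\Omega)$ the subspace of functions in $H^{1,\theta}(\Omega)$ with compact support in $\Omega$. $v$ is a solution of $-\mathrm{div}(|x|^\theta\nabla v)=|x|^l|v|^{p-1}v$ in $\Omega$ if $v\in H^{1,\theta}_{loc}(\Omega)\cap L^\infty_{loc}(\Omega)$ and $\int_\Omega\big(|x|^\theta\nabla v\cdot\nabla\phi-|x|^l|v|^{p-1}v\phi\big)dx=0$ for all $\phi\in H^{1,\theta}_c(\Omega)\cap L^\infty_{loc}(\Omega)$. It is stable if $\int_\Omega\big(|x|^\theta|\nabla\psi|^2-p|x|^l|v|^{p-1}\psi^2\big)dx\ge0$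 for all $\psi\in H^{1,\theta}_c(\Omega)\cap L^\infty_{loc}(\Omega)$. Critical power: for $N'>2$, $\tau>-2$, $p_c(N',\tau)=\infty$ if $2<N'\le10+4\tau$, and if $N'>10+4\tau$, $$p_c(N',\tau)=\frac{(N'-2)^2-2(2+\tau)(N'+\tau)+2(2+\tau)\sqrt{(2+\tau)(2N'+\tau-2)}}{(N'-2)(N'-4\tau-10)}.$$ *)

theory Defs
  imports "HOL-Analysis.Analysis"
begin

section \<open>Weak gradients\<close>

text \<open>The predicate says that \<open>\<zeta> \<in> C\<^sup>1\<^sub>c(U)\<close> and that \<open>D\<zeta>\<close> is its gradient.\<close>

definition C1_test_function ::
  "'a::euclidean_space set \<Rightarrow> ('a \<Rightarrow> real) \<Rightarrow> ('a \<Rightarrow> 'a) \<Rightarrow> bool" where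
  "C1_test_function U \<zeta> D\<zeta> \<longleftrightarrow>
     (\<forall>x. GDERIV \<zeta> x :> D\<zeta> x) \<and> continuous_on UNIV D\<zeta> \<and>
     (\<exists>K. compact K \<and> K \<subseteq> U \<and> (\<forall>x. x \<notin> K \<longrightarrow> \<zeta> x = 0))"

definition loc_integrable ::
  "'a::euclidean_space set \<Rightarrow> ('a \<Rightarrow> 'b::euclidean_space) \<Rightarrow> bool" where
  "loc_integrable U f \<longleftrightarrow> (\<forall>K. compact K \<longrightarrow> K \<subseteq> U \<longrightarrow> set_integrable lebesgue K f)"

definition weak_gradient ::
  "'a::euclidean_space set \<Rightarrow> ('a \<Rightarrow> real) \<Rightarrow> ('a \<Rightarrow> 'a) \<Rightarrow> bool" where
  "weak_gradient U u Du \<longleftrightarrow> loc_integrable U u \<and> loc_integrable U Du \<and>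
     (\<forall>\<zeta> D\<zeta>. C1_test_function U \<zeta> D\<zeta> \<longrightarrow>
        (LINT x:U|lebesgue. u x *\<^sub>R D\<zeta> x) = - (LINT x:U|lebesgue. \<zeta> x *\<^sub>R Du x))"

section \<open>Function spaces\<close>

definition L2_on :: "'a::euclidean_space set \<Rightarrow> ('a \<Rightarrow> real) \<Rightarrow> bool" where
  "L2_on S f \<longleftrightarrow> set_borel_measurable lebesgue S f \<and> set_integrable lebesgue S (\<lambda>x. (f x)\<^sup>2)"

definition Linf_loc :: "'a::euclidean_space set \<Rightarrow> ('a \<Rightarrow> real) \<Rightarrow> bool" where
  "Linf_loc \<Omega> u \<longleftrightarrow> set_borel_measurable lebesgue \<Omega> u \<and>
     (\<forall>K. compact K \<longrightarrow> K \<subseteq> \<Omega> \<longrightarrow> (\<exists>C. AE x in lebesgue. x \<in> K \<longrightarrow> \<bar>u x\<bar> \<le> C))"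

text \<open>
  The weighted spaces are predicates on a function together with its weak gradient (which is
  unique almost everywhere), so \<open>u \<in> H\<^sup>1\<^sup>,\<^sup>\<theta>(\<Omega>)\<close> means \<open>\<exists>Du. H1w \<theta> \<Omega> u Du\<close>.

  The weak gradient is taken in \<open>\<Omega> - {0}\<close>, where the weight is bounded above and away from zero
  on compact sets. For \<open>\<theta> \<ge> N\<close>, membership of \<open>|x|\<^bsup>\<theta>/2\<^esup>u\<close> and \<open>|x|\<^bsup>\<theta>/2\<^esup>|Du|\<close> in
  \<open>L\<^sup>2\<close> does not imply that \<open>u\<close> and \<open>Du\<close> are locally integrable at the origin, so they need not
  be distributions there. For \<open>\<theta> < N\<close> they are locally integrable, and since a point is
  removable for weak differentiability in dimension \<open>N \<ge> 2\<close>, the result is the same as for the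
  weak gradient in \<open>\<Omega>\<close>. The value of the weight at the origin is immaterial.
\<close>

definition H1w :: "real \<Rightarrow> 'a::euclidean_space set \<Rightarrow> ('a \<Rightarrow> real) \<Rightarrow> ('a \<Rightarrow> 'a) \<Rightarrow> bool" where
  "H1w \<theta> \<Omega> u Du \<longleftrightarrow> weak_gradient (\<Omega> - {0}) u Du \<and>
     L2_on \<Omega> (\<lambda>x. norm x powr (\<theta>/2) * u x) \<and>
     L2_on \<Omega> (\<lambda>x. norm x powr (\<theta>/2) * norm (Du x))"

definition H1w_loc :: "real \<Rightarrow> 'a::euclidean_space set \<Rightarrow> ('a \<Rightarrow> real) \<Rightarrow> ('a \<Rightarrow> 'a) \<Rightarrow> bool" where
  "H1w_loc \<theta> \<Omega> u Du \<longleftrightarrow> weak_gradient (\<Omega> - {0}) u Du \<and>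
     (\<forall>K. compact K \<longrightarrow> K \<subseteq> \<Omega> \<longrightarrow>
        L2_on K (\<lambda>x. norm x powr (\<theta>/2) * u x) \<and>
        L2_on K (\<lambda>x. norm x powr (\<theta>/2) * norm (Du x)))"

definition H1w_c :: "real \<Rightarrow> 'a::euclidean_space set \<Rightarrow> ('a \<Rightarrow> real) \<Rightarrow> ('a \<Rightarrow> 'a) \<Rightarrow> bool" where
  "H1w_c \<theta> \<Omega> u Du \<longleftrightarrow> H1w \<theta> \<Omega> u Du \<and>
     (\<exists>K. compact K \<and> K \<subseteq> \<Omega> \<and> (AE x in lebesgue. x \<in> \<Omega> - K \<longrightarrow> u x = 0))"

section \<open>Solutions and stability\<close>

text \<open>
  When \<open>l > -N\<close>, which follows from \<open>N + \<theta> > 2\<close> and \<open>l - \<theta> > -2\<close>, both integrands below are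
  Lebesgue integrable, so the convention that a divergent integral is \<open>0\<close> plays no role.
\<close>

definition solution :: "real \<Rightarrow> real \<Rightarrow> real \<Rightarrow> 'a::euclidean_space set \<Rightarrow> ('a \<Rightarrow> real) \<Rightarrow> bool" where
  "solution \<theta> l p \<Omega> v \<longleftrightarrow> Linf_loc \<Omega> v \<and>
     (\<exists>Dv. H1w_loc \<theta> \<Omega> v Dv \<and>
       (\<forall>\<phi> D\<phi>. H1w_c \<theta> \<Omega> \<phi> D\<phi> \<and> Linf_loc \<Omega> \<phi> \<longrightarrow>
         (LINT x:\<Omega>|lebesgue. norm x powr \<theta> * (Dv x \<bullet> D\<phi> x)
            - norm x powr l * \<bar>v x\<bar> powr (p - 1) * v x * \<phi> x) = 0))"

definition is_stable :: "real \<Rightarrow> real \<Rightarrow> real \<Rightarrow> 'a::euclidean_space set \<Rightarrow> ('a \<Rightarrow> real) \<Rightarrow> bool" where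
  "is_stable \<theta> l p \<Omega> v \<longleftrightarrow>
     (\<forall>\<psi> D\<psi>. H1w_c \<theta> \<Omega> \<psi> D\<psi> \<and> Linf_loc \<Omega> \<psi> \<longrightarrow>
       (LINT x:\<Omega>|lebesgue. norm x powr \<theta> * (norm (D\<psi> x))\<^sup>2
          - p * norm x powr l * \<bar>v x\<bar> powr (p - 1) * (\<psi> x)\<^sup>2) \<ge> 0)"

definition radial :: "('a::euclidean_space \<Rightarrow> real) \<Rightarrow> bool" where
  "radial v \<longleftrightarrow> (\<exists>f. \<forall>x. v x = f (norm x))"

section \<open>The critical power\<close>

text \<open>Only meaningful for \<open>N' > 2\<close> and \<open>\<tau> > -2\<close>.\<close>

definition p_crit :: "real \<Rightarrow> real \<Rightarrow> ereal" where
  "p_crit N' \<tau> =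
     (if N' \<le> 10 + 4 * \<tau> then \<infinity>
      else ereal (((N' - 2)\<^sup>2 - 2 * (2 + \<tau>) * (N' + \<tau>)
                     + 2 * (2 + \<tau>) * sqrt ((2 + \<tau>) * (2 * N' + \<tau> - 2)))
                  / ((N' - 2) * (N' - 4 * \<tau> - 10))))"

end

theory Submission
  imports Defs
begin

text \<open>
  Nonexistence follows Farina: testing the equation with \<open>\<bar>v\<bar>\<^sup>a v \<eta>\<^sup>2\<close> and stability with
  \<open>\<bar>v\<bar>\<^sup>a\<^sup>/\<^sup>2 v \<eta>\<close> bounds \<open>\<integral> |x|\<^sup>l |v|\<^sup>p\<^sup>+\<^sup>1\<^sup>+\<^sup>a \<eta>\<^sup>2\<close> by \<open>\<integral> |x|\<^sup>\<theta> |v|\<^sup>a\<^sup>+\<^sup>2 |\<nabla>\<eta>|\<^sup>2\<close> as long as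
  \<open>(a/2 + 1)\<^sup>2 < p (a + 1)\<close>. With \<open>\<eta>\<close> a power of a cutoff between radii \<open>R\<close> and \<open>2R\<close>, Young's inequality
  turns this into decay of order \<open>R\<close> to the power \<open>N' - 2 - (2 + \<tau>)(a + 2)/(p - 1)\<close>, and an admissible
  \<open>a\<close> making this exponent negative exists exactly below the critical power.

  For \<open>p\<close> at least the critical power, the regular radial solution stays below the singular solution
  \<open>L |x|\<close> to the power \<open>-(2 + \<tau>)/(p - 1)\<close>. Hence \<open>p |x|\<^sup>l v\<^sup>p\<^sup>-\<^sup>1\<close> is at most the Hardy potential
  \<open>(N' - 2)\<^sup>2/4\<close> times \<open>|x|\<close> to the power \<open>\<theta> - 2\<close>, which is stability. The initial values \<open>v(0)\<close>
  parametrize the family.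
\<close>

section \<open>Test functions and smooth cutoffs\<close>

text \<open>The power \<open>|x|^(2 + \<tau>)\<close> is the right radial variable: it absorbs both
  weights, so that \<open>N'\<close> and \<tau> enter only through
  \<open>y = (N' - 2) / (2 + \<tau>)\<close>, which is the constant \<kappa> of the radial profile.
  Both halves meet at the same threshold. With \<open>A = a + 2\<close> the admissible range ends at
  \<open>A = 2 * (p + sqrt (p^2 - p))\<close>, and decay requires \<open>y * (p - 1) < A\<close>.
  For existence, the Hardy constant and the linearization at the singular solution lead to one and
  the same inequality \<open>4 * p * \<alpha> * (y - \<alpha>) \<le> y^2\<close> with
  \<open>\<alpha> = 1 / (p - 1)\<close>. The obstacle is the origin. Weak gradients live in the
  punctured space, the weight may be singular or degenerate at 0, and a solution is only a locally
  bounded weighted Sobolev function. Powers of it become test functions through a chain rule proved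
  by mollification away from 0, and integration by parts against a radial field needs a cutoff near
  0 and near infinity whose error is controlled by scaling. Since test functions need only be C^1,
  cutoffs and mollifiers are built from squares of positive parts.\<close>

lemma DERIV_max_0_square: "((\<lambda>t::real. (max 0 t)\<^sup>2) has_real_derivative 2 * max 0 t) (at t)"
proof -
  consider "t > 0" | "t < 0" | "t = 0" by linarith
  then show ?thesis
  proof cases
    case 1
    have "((\<lambda>t::real. t\<^sup>2) has_real_derivative 2 * max 0 t) (at t)"
      using 1 by (auto intro!: derivative_eq_intros)
    then show ?thesis
      by (rule has_field_derivative_transform_within_open[where S="{0<..}"]) (use 1 in auto)
  next
    case 2
    have "((\<lambda>t::real. 0) has_real_derivative 2 * max 0 t) (at t)"
      using 2 by (auto intro!: derivative_eq_intros)
    then show ?thesis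
      by (rule has_field_derivative_transform_within_open[where S="{..<0}"]) (use 2 in auto)
  next
    case 3
    have "(\<lambda>y::real. max 0 y) \<midarrow>0\<rightarrow> max 0 0"
      by (intro tendsto_intros)
    moreover have "\<forall>\<^sub>F y::real in at 0. max 0 y = (max 0 y)\<^sup>2 / y"
      by (auto simp: eventually_at_filter max_def power2_eq_square intro!: always_eventually)
    ultimately have "(\<lambda>y::real. (max 0 y)\<^sup>2 / y) \<midarrow>0\<rightarrow> 0"
      by (simp add: Lim_transform_eventually)
    then show ?thesis using 3 by (simp add: has_field_derivative_iff)
  qed
qed

text \<open>The usual quotient \<open>f t / (f t + f (1 - t))\<close>, with the square of the
  positive part as \<open>f\<close>. The denominator never vanishes because \<open>t\<close> and
  \<open>1 - t\<close> are not both \<le> 0.\<close>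

definition smooth_step :: "real \<Rightarrow> real" where
  "smooth_step t = (max 0 t)\<^sup>2 / ((max 0 t)\<^sup>2 + (max 0 (1 - t))\<^sup>2)"

definition smooth_step_deriv :: "real \<Rightarrow> real" where
  "smooth_step_deriv t = (2 * max 0 t * ((max 0 t)\<^sup>2 + (max 0 (1 - t))\<^sup>2)
     - (max 0 t)\<^sup>2 * (2 * max 0 t - 2 * max 0 (1 - t))) / ((max 0 t)\<^sup>2 + (max 0 (1 - t))\<^sup>2)\<^sup>2"

lemma step_denom_pos: "(max 0 t)\<^sup>2 + (max 0 (1 - t))\<^sup>2 > (0::real)"
  by (cases "t > 0") (auto simp: add_pos_nonneg add_nonneg_pos)

lemma DERIV_step: "(smooth_step has_real_derivative smooth_step_deriv t) (at t)"
proof -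
  have 1: "((\<lambda>t::real. (max 0 (1 - t))\<^sup>2) has_real_derivative 2 * max 0 (1 - t) * (-1)) (at t)"
    by (rule DERIV_chain2[OF DERIV_max_0_square]) (auto intro!: derivative_eq_intros)
  show ?thesis
    unfolding smooth_step_def[abs_def] smooth_step_deriv_def
    by (rule DERIV_cong[OF DERIV_divide[OF DERIV_max_0_square DERIV_add[OF DERIV_max_0_square 1]]])
       (use step_denom_pos[of t] in \<open>auto simp: power2_eq_square\<close>)
qed

lemma continuous_on_dstep: "continuous_on S smooth_step_deriv"
  unfolding smooth_step_deriv_def using step_denom_pos by (intro continuous_intros) (metis less_irrefl power_not_zero)

lemma step_bounds: "0 \<le> smooth_step t" "smooth_step t \<le> 1"
  using step_denom_pos[of t] by (auto simp: smooth_step_def)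

lemma step_eq: "t \<le> 0 \<Longrightarrow> smooth_step t = 0" "1 \<le> t \<Longrightarrow> smooth_step t = 1"
  and dstep_eq: "t \<le> 0 \<Longrightarrow> smooth_step_deriv t = 0" "1 \<le> t \<Longrightarrow> smooth_step_deriv t = 0"
  by (auto simp: smooth_step_def smooth_step_deriv_def power2_eq_square)

lemma dstep_bounded: obtains M where "M > 0" "\<And>t. \<bar>smooth_step_deriv t\<bar> \<le> M"
proof -
  have "compact (smooth_step_deriv ` {0..1})"
    by (intro compact_continuous_image continuous_on_dstep) auto
  then obtain M where M: "\<And>t. t \<in> {0..1} \<Longrightarrow> \<bar>smooth_step_deriv t\<bar> \<le> M"
    by (metis (no_types) bounded_iff compact_imp_bounded imageI real_norm_def)
  have "\<bar>smooth_step_deriv t\<bar> \<le> \<bar>M\<bar> + 1" for t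
    using M[of t] dstep_eq[of t] by (cases "t \<in> {0..1}") auto
  then show ?thesis by (intro that[of "\<bar>M\<bar> + 1"]) auto
qed

text \<open>Radial functions are written in the variable \<open>|x|^2\<close>, which is smooth at
  the origin too; the factor 2 is that of its gradient \<open>2 x\<close>.\<close>

lemma GDERIV_radial:
  fixes x :: "'a::real_inner"
  assumes "(k has_real_derivative k') (at ((norm x)\<^sup>2))"
  shows "GDERIV (\<lambda>x. k ((norm x)\<^sup>2)) x :> (2 * k') *\<^sub>R x"
proof -
  have "GDERIV (\<lambda>x::'a. (norm x)\<^sup>2) x :> 2 *\<^sub>R x"
    unfolding gderiv_def power2_norm_eq_inner
    by (auto intro!: derivative_eq_intros simp: inner_commute)
  from GDERIV_DERIV_compose[OF this assms] show ?thesis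
    by (simp add: mult.commute)
qed

text \<open>Off a compact support the function vanishes on an open set, so one compact set serves
  for both the function and its gradient.\<close>

lemma C1_test_support:
  assumes "C1_test_function U \<zeta> D\<zeta>"
  obtains K where "compact K" "K \<subseteq> U" "\<And>x. x \<notin> K \<Longrightarrow> \<zeta> x = 0" "\<And>x. x \<notin> K \<Longrightarrow> D\<zeta> x = 0"
proof -
  obtain K where K: "compact K" "K \<subseteq> U" "\<And>x. x \<notin> K \<Longrightarrow> \<zeta> x = 0"
    using assms unfolding C1_test_function_def by auto
  have "D\<zeta> x = 0" if "x \<notin> K" for x
  proof -
    have "GDERIV \<zeta> x :> D\<zeta> x" using assms by (auto simp: C1_test_function_def)
    then have 1: "(\<zeta> has_derivative (\<lambda>h. h \<bullet> D\<zeta> x)) (at x)" by (simp add: gderiv_def)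
    have "((\<lambda>x. 0) has_derivative (\<lambda>h. h \<bullet> D\<zeta> x)) (at x)"
      by (rule has_derivative_transform_within_open[OF 1, where s="-K"])
         (use K that in \<open>auto intro: compact_imp_closed\<close>)
    then have "(\<lambda>h. h \<bullet> D\<zeta> x) = (\<lambda>h. 0)"
      by (metis has_derivative_const has_derivative_unique)
    then have "D\<zeta> x \<bullet> D\<zeta> x = 0" by metis
    then show ?thesis by simp
  qed
  with K that show ?thesis by blast
qed

lemma C1_test_mono: "C1_test_function U \<zeta> D\<zeta> \<Longrightarrow> U \<subseteq> V \<Longrightarrow> C1_test_function V \<zeta> D\<zeta>"
  unfolding C1_test_function_def by blast

lemma C1_test_continuous: "C1_test_function U \<zeta> D\<zeta> \<Longrightarrow> continuous_on S \<zeta>"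
  unfolding C1_test_function_def gderiv_def
  by (meson continuous_at_imp_continuous_on has_derivative_continuous)

lemma continuous_on_zero_outside:
  assumes "open U" "closed K" "K \<subseteq> U" "continuous_on U f" "\<And>x. x \<notin> K \<Longrightarrow> f x = 0"
  shows "continuous_on UNIV f"
proof -
  have "continuous_on (U \<union> -K) f"
    using assms by (intro continuous_on_open_Un) (auto intro: continuous_on_eq[OF continuous_on_const[of _ 0]])
  moreover have "U \<union> -K = UNIV" using assms by auto
  ultimately show ?thesis by simp
qed

text \<open>The multiplier is required to be C^1 in \<open>U\<close> only. This admits radial fields
  that are singular at 0 when \<open>U\<close> is the punctured space.\<close>

lemma C1_test_mult:
  assumes "open U" "\<And>x. x \<in> U \<Longrightarrow> GDERIV \<eta> x :> D\<eta> x" "continuous_on U D\<eta>" "C1_test_function U \<zeta> D\<zeta>"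
  shows "C1_test_function U (\<lambda>x. \<eta> x * \<zeta> x) (\<lambda>x. \<eta> x *\<^sub>R D\<zeta> x + \<zeta> x *\<^sub>R D\<eta> x)"
proof -
  obtain K where K: "compact K" "K \<subseteq> U" "\<And>x. x \<notin> K \<Longrightarrow> \<zeta> x = 0" "\<And>x. x \<notin> K \<Longrightarrow> D\<zeta> x = 0"
    using C1_test_support[OF assms(4)] by metis
  have c: "continuous_on U \<eta>"
    using assms(2) unfolding gderiv_def
    by (meson continuous_at_imp_continuous_on has_derivative_continuous)
  have c2: "continuous_on U D\<zeta>" using assms(4) unfolding C1_test_function_def
    using continuous_on_subset by blast
  have "GDERIV (\<lambda>x. \<eta> x * \<zeta> x) x :> \<eta> x *\<^sub>R D\<zeta> x + \<zeta> x *\<^sub>R D\<eta> x" for x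
  proof (cases "x \<in> U")
    case True then show ?thesis
      using assms(4) by (intro GDERIV_mult assms) (auto simp: C1_test_function_def)
  next
    case False
    then have x: "x \<in> -K" using K by auto
    have "GDERIV (\<lambda>x. 0) x :> 0" by (rule GDERIV_const)
    then have "GDERIV (\<lambda>x. \<eta> x * \<zeta> x) x :> 0"
      unfolding gderiv_def
      by (rule has_derivative_transform_within_open[where s="-K"])
         (use K x in \<open>auto intro: compact_imp_closed\<close>)
    then show ?thesis using x K by simp
  qed
  moreover have "continuous_on UNIV (\<lambda>x. \<eta> x *\<^sub>R D\<zeta> x + \<zeta> x *\<^sub>R D\<eta> x)"
    by (rule continuous_on_zero_outside[OF \<open>open U\<close> compact_imp_closed[OF K(1)] K(2)])
       (use K in \<open>auto intro!: continuous_intros c c2 assms C1_test_continuous[OF assms(4)]\<close>)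
  ultimately show ?thesis
    unfolding C1_test_function_def using K by (metis mult_zero_right)
qed

lemma integrable_continuous_compact_support:
  fixes f :: "'a::euclidean_space \<Rightarrow> 'b::euclidean_space"
  assumes "continuous_on UNIV f" "compact K" "\<And>x. x \<notin> K \<Longrightarrow> f x = 0"
  shows "integrable lborel f" "integrable lebesgue f" "integral\<^sup>L lebesgue f = integral\<^sup>L lborel f"
proof -
  have "integrable lborel (\<lambda>x. indicator K x *\<^sub>R f x)"
    using assms by (intro borel_integrable_compact) (auto intro: continuous_on_subset)
  moreover have "(\<lambda>x. indicator K x *\<^sub>R f x) = f" using assms by (auto simp: indicator_def)
  ultimately show *: "integrable lborel f" by simp
  have [measurable]: "f \<in> borel_measurable borel" using assms by (simp add: borel_measurable_continuous_onI)
  show "integrable lebesgue f" using * by (subst integrable_completion) auto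
  show "integral\<^sup>L lebesgue f = integral\<^sup>L lborel f" by (subst integral_completion) auto
qed

lemma uniformly_continuous_compact_support:
  fixes f :: "'a::euclidean_space \<Rightarrow> 'b::real_normed_vector"
  assumes cont: "continuous_on UNIV f" and K: "compact K" "\<And>x. x \<notin> K \<Longrightarrow> f x = 0" and "e > 0"
  obtains d where "d > 0" "\<And>x y. norm (y - x) < d \<Longrightarrow> norm (f y - f x) < e"
proof -
  obtain B where B: "K \<subseteq> cball 0 B" "B > 0"
    using compact_imp_bounded[OF K(1)] by (meson bounded_subset_ballD ball_subset_cball subset_trans)
  have "uniformly_continuous_on (cball 0 (B+1)) f"
    using cont by (intro compact_uniformly_continuous) (auto intro: continuous_on_subset)
  then obtain d where d: "d > 0" "\<And>x y. x \<in> cball 0 (B+1) \<Longrightarrow> y \<in> cball 0 (B+1) \<Longrightarrow> dist x y < d \<Longrightarrow> dist (f x) (f y) < e"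
    using \<open>e > 0\<close> unfolding uniformly_continuous_on_def by metis
  have "norm (f y - f x) < e" if "norm (y - x) < min d 1" for x y
  proof (cases "x \<in> cball 0 (B+1) \<and> y \<in> cball 0 (B+1)")
    case True then show ?thesis using d(2)[of y x] that by (auto simp: dist_norm)
  next
    case False
    have "norm y \<le> norm x + norm (y - x)" "norm x \<le> norm y + norm (y - x)"
      by norm+
    then have "x \<notin> K" "y \<notin> K" using B False that by auto
    then show ?thesis using K \<open>e > 0\<close> by simp
  qed
  then show ?thesis using that[of "min d 1"] d by auto
qed

text \<open>Mean value theorem on the segment, combined with uniform continuity of the gradient. The
  bound is uniform in \<open>x\<close>, which is what differentiation under an integral
  requires.\<close>

lemma C1_test_uniform_linearization:
  fixes h :: "'a::euclidean_space \<Rightarrow> real"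
  assumes "C1_test_function U h Dh" "e > 0"
  obtains d where "d > 0" "\<And>x k. norm k < d \<Longrightarrow> \<bar>h (x + k) - h x - k \<bullet> Dh x\<bar> \<le> e * norm k"
proof -
  obtain K where K: "compact K" "K \<subseteq> U" "\<And>x. x \<notin> K \<Longrightarrow> h x = 0" "\<And>x. x \<notin> K \<Longrightarrow> Dh x = 0"
    using C1_test_support[OF assms(1)] by metis
  have gd: "(h has_derivative (\<lambda>k. k \<bullet> Dh x)) (at x)" for x
    using assms by (auto simp: C1_test_function_def gderiv_def)
  have cont: "continuous_on UNIV Dh" using assms by (auto simp: C1_test_function_def)
  obtain d where d: "d > 0" and uc: "\<And>x y. norm (y - x) < d \<Longrightarrow> norm (Dh y - Dh x) < e"
    using uniformly_continuous_compact_support[OF cont K(1,4) \<open>e > 0\<close>] by metis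
  have "\<bar>h (x + k) - h x - k \<bullet> Dh x\<bar> \<le> e * norm k" if k: "norm k < d" for x k
  proof -
    have "((\<lambda>s. h (x + s *\<^sub>R k)) has_real_derivative (k \<bullet> Dh (x + s *\<^sub>R k))) (at s)" for s
    proof -
      have "((\<lambda>s. h (x + s *\<^sub>R k)) has_derivative (\<lambda>t. (t *\<^sub>R k) \<bullet> Dh (x + s *\<^sub>R k))) (at s)"
        by (rule has_derivative_compose[OF _ gd]) (auto intro!: derivative_eq_intros)
      then show ?thesis by (simp add: has_field_derivative_def mult_commute_abs)
    qed
    then obtain s where s: "0 < s" "s < 1" "h (x + 1 *\<^sub>R k) - h (x + 0 *\<^sub>R k) = (1 - 0) * (k \<bullet> Dh (x + s *\<^sub>R k))"
      using MVT2[of 0 1 "\<lambda>s. h (x + s *\<^sub>R k)" "\<lambda>s. k \<bullet> Dh (x + s *\<^sub>R k)"] by auto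
    then have "h (x + k) - h x - k \<bullet> Dh x = k \<bullet> (Dh (x + s *\<^sub>R k) - Dh x)"
      by (simp add: inner_diff_right)
    also have "\<bar>\<dots>\<bar> \<le> norm k * norm (Dh (x + s *\<^sub>R k) - Dh x)"
      by (rule Cauchy_Schwarz_ineq2)
    also have "\<dots> \<le> norm k * e"
    proof (intro mult_left_mono less_imp_le[OF uc])
      have "norm (x + s *\<^sub>R k - x) \<le> norm k" using s by (simp add: mult_left_le_one_le)
      then show "norm (x + s *\<^sub>R k - x) < d" using k by linarith
    qed auto
    finally show ?thesis by (simp add: mult.commute)
  qed
  then show ?thesis using that d by metis
qed

section \<open>Translation invariance and integration by parts\<close>

lemma lborel_integral_translate:
  fixes f :: "'a::euclidean_space \<Rightarrow> 'b::euclidean_space"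
  assumes "f \<in> borel_measurable borel"
  shows "(LINT x|lborel. f (x + k)) = (LINT x|lborel. f x)"
proof -
  have "(LINT x|lborel. f x) = (LINT x|distr lborel borel ((+) k). f x)"
    by (simp add: lborel_distr_plus)
  also have "\<dots> = (LINT x|lborel. f (k + x))"
    using assms by (subst integral_distr) auto
  finally show ?thesis by (simp add: add.commute)
qed

text \<open>By translation invariance the integral of \<open>h (x + t b) - h x\<close> is zero, and
  uniform linearization compares it with \<open>t\<close> times the integral of
  \<open>b \<bullet> Dh\<close>. This form of the divergence theorem avoids iterated
  integrals.\<close>

lemma integral_gradient_zero:
  fixes h :: "'a::euclidean_space \<Rightarrow> real"
  assumes "C1_test_function U h Dh"
  shows "(LINT x|lebesgue. Dh x) = 0"
proof -
  obtain K where K: "compact K" "K \<subseteq> U" "\<And>x. x \<notin> K \<Longrightarrow> h x = 0" "\<And>x. x \<notin> K \<Longrightarrow> Dh x = 0"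
    using C1_test_support[OF assms(1)] by metis
  have cont: "continuous_on UNIV Dh" using assms by (auto simp: C1_test_function_def)
  have ch: "continuous_on UNIV h" by (rule C1_test_continuous[OF assms])
  obtain B where B: "K \<subseteq> cball 0 B" "B > 0"
    using compact_imp_bounded[OF K(1)] by (meson bounded_subset_ballD ball_subset_cball subset_trans)
  \<comment> \<open>Volume of a ball with margin 1: since \<open>t \<le> 1\<close> below, the ball
    contains every point where \<open>h x\<close>, \<open>h (x + t b)\<close> or \<open>Dh x\<close>
    is nonzero.\<close>
  define c where "c = measure lborel (cball 0 (B+1) :: 'a set)"
  have iD: "integrable lborel Dh" by (rule integrable_continuous_compact_support[OF cont K(1,4)])
  have ih: "integrable lborel h" by (rule integrable_continuous_compact_support[OF ch K(1,3)])
  have "(LINT x|lborel. Dh x) \<bullet> b = 0" if b: "b \<in> Basis" for b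
  proof -
    have "\<bar>(LINT x|lborel. Dh x) \<bullet> b\<bar> \<le> e * (c + 1)" if "e > 0" for e
    proof -
      obtain d where d: "d > 0" "\<And>x k. norm k < d \<Longrightarrow> \<bar>h (x + k) - h x - k \<bullet> Dh x\<bar> \<le> e * norm k"
        using C1_test_uniform_linearization[OF assms \<open>e > 0\<close>] by metis
      define t where "t = min (d/2) 1"
      have t: "0 < t" "t < d" "t \<le> 1" using d by (auto simp: t_def)
      have nb: "norm (t *\<^sub>R b) = t" using b t by simp
      have it: "integrable lborel (\<lambda>x. h (x + t *\<^sub>R b))"
      proof (rule integrable_continuous_compact_support(1)[where K="cball 0 (B+1)"])
        show "continuous_on UNIV (\<lambda>x. h (x + t *\<^sub>R b))"
          by (intro continuous_on_compose2[OF ch] continuous_intros) auto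
        fix x assume "x \<notin> cball (0::'a) (B+1)"
        moreover have "norm x \<le> norm (x + t *\<^sub>R b) + norm (t *\<^sub>R b)"
            using norm_triangle_ineq4[of "x + t *\<^sub>R b" "t *\<^sub>R b"] by simp
        ultimately have "x + t *\<^sub>R b \<notin> K" using B t nb by auto
        then show "h (x + t *\<^sub>R b) = 0" by (rule K)
      qed auto
      have ii: "integrable lborel (\<lambda>x. (t *\<^sub>R b) \<bullet> Dh x)" using iD by auto
      have "t * ((LINT x|lborel. Dh x) \<bullet> b) = (LINT x|lborel. (t *\<^sub>R b) \<bullet> Dh x)"
        using iD by (simp add: inner_commute)
      \<comment> \<open>The two terms with \<open>h\<close> cancel after translation, so only the
        linearization error remains.\<close>
      also have "\<dots> = - (LINT x|lborel. h (x + t *\<^sub>R b) - h x - (t *\<^sub>R b) \<bullet> Dh x)"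
        using it ih ii lborel_integral_translate[of h "t *\<^sub>R b"] ch
        by (simp add: borel_measurable_continuous_onI)
      finally have "t * \<bar>(LINT x|lborel. Dh x) \<bullet> b\<bar> = \<bar>LINT x|lborel. h (x + t *\<^sub>R b) - h x - (t *\<^sub>R b) \<bullet> Dh x\<bar>"
        using t by (metis abs_minus_cancel abs_mult abs_of_pos)
      also have "\<dots> \<le> (LINT x|lborel. \<bar>h (x + t *\<^sub>R b) - h x - (t *\<^sub>R b) \<bullet> Dh x\<bar>)"
        by (rule integral_abs_bound)
      also have "\<dots> \<le> (LINT x|lborel. indicator (cball (0::'a) (B+1)) x * (e * t))"
      proof (rule integral_mono)
        show "integrable lborel (\<lambda>x. indicator (cball (0::'a) (B+1)) x * (e * t))"
          by (intro integrable_mult_left impI) (use emeasure_lborel_cball_finite[of "0::'a" "B+1"] in \<open>auto intro!: integrable_real_indicator\<close>)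
        fix x :: 'a
        show "\<bar>h (x + t *\<^sub>R b) - h x - (t *\<^sub>R b) \<bullet> Dh x\<bar> \<le> indicator (cball (0::'a) (B+1)) x * (e * t)"
        proof (cases "x \<in> cball (0::'a) (B+1)")
          case True then show ?thesis using d(2)[of "t *\<^sub>R b" x] nb t by auto
        next
          case False
          moreover have "norm x \<le> norm (x + t *\<^sub>R b) + norm (t *\<^sub>R b)"
            using norm_triangle_ineq4[of "x + t *\<^sub>R b" "t *\<^sub>R b"] by simp
          ultimately have "x + t *\<^sub>R b \<notin> K" "x \<notin> K" using B t nb by auto
          then show ?thesis using K t \<open>e > 0\<close> by simp
        qed
      qed (use it ih ii in auto)
      also have "\<dots> = c * (e * t)" by (simp add: c_def)
      finally have "t * \<bar>(LINT x|lborel. Dh x) \<bullet> b\<bar> \<le> t * (e * c)" by (simp add: mult_ac)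
      then have "\<bar>(LINT x|lborel. Dh x) \<bullet> b\<bar> \<le> e * c" using t by simp
      also have "\<dots> \<le> e * (c + 1)" using that by simp
      finally show ?thesis .
    qed
    note * = this
    have "c \<ge> 0" by (simp add: c_def)
    have "\<bar>(LINT x|lborel. Dh x) \<bullet> b\<bar> \<le> 0 + e" if "e > 0" for e
    proof -
      have "\<bar>(LINT x|lborel. Dh x) \<bullet> b\<bar> \<le> e / (c + 1) * (c + 1)"
        by (rule *) (use that \<open>c \<ge> 0\<close> in simp)
      also have "\<dots> = e" by (rule nonzero_divide_eq_eq[THEN iffD1, OF _ refl, symmetric]) (use \<open>c \<ge> 0\<close> in simp)
      finally show ?thesis by simp
    qed
    then have "\<bar>(LINT x|lborel. Dh x) \<bullet> b\<bar> \<le> 0" by (rule field_le_epsilon)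
    then show ?thesis by simp
  qed
  then have "(LINT x|lborel. Dh x) = 0" by - (rule euclidean_eqI, simp)
  then show ?thesis using integrable_continuous_compact_support(3)[OF cont K(1,4)] by simp
qed

section \<open>Mollification\<close>

lemma integrable_scaleR_bounded:
  fixes w :: "'a \<Rightarrow> 'b::euclidean_space" and f :: "'a \<Rightarrow> real"
  assumes "integrable M w" "f \<in> borel_measurable M" "AE x in M. \<bar>f x\<bar> \<le> C"
  shows "integrable M (\<lambda>x. f x *\<^sub>R w x)"
proof (rule Bochner_Integration.integrable_bound[where f="\<lambda>x. C *\<^sub>R w x"])
  show "AE x in M. norm (f x *\<^sub>R w x) \<le> norm (C *\<^sub>R w x)"
    using assms(3) by eventually_elim (auto intro!: mult_right_mono)
  have [measurable]: "w \<in> borel_measurable M" using assms(1) by auto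
  show "(\<lambda>x. f x *\<^sub>R w x) \<in> borel_measurable M" using assms(2) by measurable
qed (use assms in auto)

lemma borel_measurable_lebesgue_continuous:
  fixes f :: "'a::euclidean_space \<Rightarrow> 'b::topological_space"
  shows "continuous_on UNIV f \<Longrightarrow> f \<in> borel_measurable lebesgue"
  by (intro measurable_completion) (simp add: borel_measurable_continuous_onI)

lemma norm_integral_le:
  fixes f :: "'a \<Rightarrow> 'b::euclidean_space"
  assumes "integrable M f" "integrable M g" "AE x in M. norm (f x) \<le> g x"
  shows "norm (integral\<^sup>L M f) \<le> integral\<^sup>L M g"
proof -
  have "norm (integral\<^sup>L M f) \<le> (LINT x|M. norm (f x))" by (rule integral_norm_bound)
  also have "\<dots> \<le> integral\<^sup>L M g" using assms by (intro integral_mono_AE) auto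
  finally show ?thesis .
qed

section \<open>Density of compactly supported continuous functions in L^1\<close>

lemma integrable_indicator_cball:
  "integrable lebesgue (\<lambda>x::'a::euclidean_space. indicator (cball c r) x :: real)"
  by (intro integrable_real_indicator) (use emeasure_lborel_cball_finite[of c r] in auto)

lemma integrable_approx_bounded:
  fixes w :: "'a::euclidean_space \<Rightarrow> real"
  assumes w: "integrable lebesgue w" and "e > 0"
  obtains v n where "integrable lebesgue v" "n > 0" "\<And>x. \<bar>v x\<bar> \<le> n" "\<And>x. norm x > n \<Longrightarrow> v x = 0"
    "(LINT x|lebesgue. \<bar>w x - v x\<bar>) < e"
proof -
  have [measurable]: "w \<in> borel_measurable lebesgue" using w by auto
  define v where "v = (\<lambda>n x. indicator (cball 0 (real n)) x * max (- real n) (min (real n) (w x)))"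
  have [measurable]: "v n \<in> borel_measurable lebesgue" for n
    unfolding v_def by (intro borel_measurable_times borel_measurable_max borel_measurable_min borel_measurable_indicator) auto
  have bnd: "\<bar>v n x\<bar> \<le> \<bar>w x\<bar>" "\<bar>w x - v n x\<bar> \<le> \<bar>w x\<bar>" for n x
    by (auto simp: v_def indicator_def max_def min_def)
  have "(\<lambda>n. LINT x|lebesgue. \<bar>w x - v n x\<bar>) \<longlonglongrightarrow> (LINT x::'a|lebesgue. 0)"
  proof (rule integral_dominated_convergence[where w="\<lambda>x. \<bar>w x\<bar>"])
    show "AE x in lebesgue. (\<lambda>n. \<bar>w x - v n x\<bar>) \<longlonglongrightarrow> 0"
    proof (rule AE_I2)
      fix x
      obtain m :: nat where m: "norm x + \<bar>w x\<bar> \<le> real m" using real_arch_simple by blast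
      have "v n x = w x" if "n \<ge> m" for n
      proof -
        have "norm x \<le> real n" "\<bar>w x\<bar> \<le> real n"
          using m of_nat_mono[OF that, where 'a=real] abs_ge_zero[of "w x"] norm_ge_zero[of x] by linarith+
        then show ?thesis by (simp add: v_def)
      qed
      then have "\<forall>\<^sub>F n in sequentially. \<bar>w x - v n x\<bar> = 0"
        by (intro eventually_sequentiallyI[of m]) simp
      then show "(\<lambda>n. \<bar>w x - v n x\<bar>) \<longlonglongrightarrow> 0" by (rule tendsto_eventually)
    qed
  qed (use w bnd in auto)
  then have "(\<lambda>n. LINT x|lebesgue. \<bar>w x - v n x\<bar>) \<longlonglongrightarrow> 0" by simp
  then have "\<forall>\<^sub>F n in sequentially. (LINT x|lebesgue. \<bar>w x - v n x\<bar>) < e"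
    using \<open>e > 0\<close> by (rule order_tendstoD)
  then obtain N where N: "\<And>n. n \<ge> N \<Longrightarrow> (LINT x|lebesgue. \<bar>w x - v n x\<bar>) < e"
    by (auto simp: eventually_sequentially)
  define n where "n = Suc N"
  have n: "n > 0" "(LINT x|lebesgue. \<bar>w x - v n x\<bar>) < e" using N[of n] by (auto simp: n_def)
  show ?thesis
  proof (rule that[of "v n" "real n"])
    show "integrable lebesgue (v n)"
      by (rule Bochner_Integration.integrable_bound[OF w]) (use bnd in auto)
    show "\<bar>v n x\<bar> \<le> real n" for x by (auto simp: v_def indicator_def)
    show "v n x = 0" if "norm x > real n" for x using that by (auto simp: v_def)
  qed (use n in auto)
qed

text \<open>Measurability supplies continuous functions converging almost everywhere. Clipping them
  to the range of a bounded \<open>v\<close> and multiplying by a continuous cutoff does not change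
  the limit but provides a common integrable bound.\<close>

lemma integrable_approx_continuous:
  fixes w :: "'a::euclidean_space \<Rightarrow> real"
  assumes w: "integrable lebesgue w" and "e > 0"
  obtains g K where "continuous_on UNIV g" "compact K" "\<And>x. x \<notin> K \<Longrightarrow> g x = 0"
    "(LINT x|lebesgue. \<bar>w x - g x\<bar>) < e"
proof -
  obtain v n where v: "integrable lebesgue v" "n > 0" "\<And>x. \<bar>v x\<bar> \<le> n" "\<And>x. norm x > n \<Longrightarrow> v x = 0"
    "(LINT x|lebesgue. \<bar>w x - v x\<bar>) < e / 2"
    using integrable_approx_bounded[OF w, of "e/2"] \<open>e > 0\<close> by auto
  have [measurable]: "w \<in> borel_measurable lebesgue" "v \<in> borel_measurable lebesgue" using w v by auto
  have "v measurable_on UNIV"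
    by (rule lebesgue_measurable_imp_measurable_on) auto
  then obtain N g where N: "negligible N" and g: "\<And>k. continuous_on UNIV (g k)"
    and lim: "\<And>x. x \<notin> N \<Longrightarrow> (\<lambda>k. g k x) \<longlonglongrightarrow> v x"
    unfolding measurable_on_def by auto
  define h where "h = (\<lambda>k x. max 0 (min 1 (n + 1 - norm x)) * max (-n) (min n (g k x)))"
  have h: "continuous_on UNIV (h k)" for k
    unfolding h_def by (intro continuous_intros g)
  have hs: "h k x = 0" if "x \<notin> cball 0 (n+1)" for k x
    using that by (auto simp: h_def)
  have hb: "\<bar>h k x\<bar> \<le> n * indicator (cball 0 (n+1)) x" for k x
  proof (cases "x \<in> cball 0 (n+1)")
    case True
    have "\<bar>h k x\<bar> = \<bar>max 0 (min 1 (n + 1 - norm x))\<bar> * \<bar>max (-n) (min n (g k x))\<bar>"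
      by (simp add: h_def abs_mult)
    also have "\<dots> \<le> 1 * n" using v(2) by (intro mult_mono) auto
    finally show ?thesis using True by simp
  qed (simp add: hs)
  have [measurable]: "h k \<in> borel_measurable lebesgue" for k
    by (rule borel_measurable_lebesgue_continuous[OF h])
  have ih: "integrable lebesgue (h k)" for k
    by (rule integrable_continuous_compact_support(2)[OF h compact_cball hs])
  have "(\<lambda>k. LINT x|lebesgue. \<bar>v x - h k x\<bar>) \<longlonglongrightarrow> (LINT x::'a|lebesgue. 0)"
  proof (rule integral_dominated_convergence[where w="\<lambda>x. \<bar>v x\<bar> + n * indicator (cball 0 (n+1)) x"])
    show "AE x in lebesgue. (\<lambda>k. \<bar>v x - h k x\<bar>) \<longlonglongrightarrow> 0"
    proof -
      have "AE x in lebesgue. x \<notin> N"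
        using N by (simp add: AE_not_in negligible_iff_null_sets)
      then show ?thesis
      proof eventually_elim
        case (elim x)
        have "(\<lambda>k. h k x) \<longlonglongrightarrow> max 0 (min 1 (n + 1 - norm x)) * max (-n) (min n (v x))"
          unfolding h_def by (intro tendsto_intros lim elim)
        moreover have "max 0 (min 1 (n + 1 - norm x)) * max (-n) (min n (v x)) = v x"
          using v(3,4)[of x] v(2) by (cases "norm x > n") (auto simp: max_def min_def abs_le_iff)
        ultimately have "(\<lambda>k. v x - h k x) \<longlonglongrightarrow> v x - v x" by (intro tendsto_intros) auto
        then show ?case using tendsto_rabs_zero by fastforce
      qed
    qed
    show "AE x in lebesgue. norm \<bar>v x - h k x\<bar> \<le> \<bar>v x\<bar> + n * indicator (cball 0 (n+1)) x" for k
    proof (rule AE_I2)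
      fix x
      have "\<bar>v x - h k x\<bar> \<le> \<bar>v x\<bar> + \<bar>h k x\<bar>" by linarith
      then show "norm \<bar>v x - h k x\<bar> \<le> \<bar>v x\<bar> + n * indicator (cball 0 (n+1)) x" using hb[of k x] by simp
    qed
    show "integrable lebesgue (\<lambda>x. \<bar>v x\<bar> + n * indicator (cball 0 (n+1)) x)"
      by (intro Bochner_Integration.integrable_add integrable_abs integrable_mult_right v integrable_indicator_cball)
  qed auto
  then have "(\<lambda>k. LINT x|lebesgue. \<bar>v x - h k x\<bar>) \<longlonglongrightarrow> 0" by simp
  then have "\<forall>\<^sub>F k in sequentially. (LINT x|lebesgue. \<bar>v x - h k x\<bar>) < e/2"
    using \<open>e > 0\<close> by (intro order_tendstoD) auto
  then obtain k where k: "(LINT x|lebesgue. \<bar>v x - h k x\<bar>) < e/2"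
    by (auto simp: eventually_sequentially)
  have "(LINT x|lebesgue. \<bar>w x - h k x\<bar>) \<le> (LINT x|lebesgue. \<bar>w x - v x\<bar> + \<bar>v x - h k x\<bar>)"
    using w v ih by (intro integral_mono) auto
  also have "\<dots> = (LINT x|lebesgue. \<bar>w x - v x\<bar>) + (LINT x|lebesgue. \<bar>v x - h k x\<bar>)"
    using w v ih by (intro Bochner_Integration.integral_add) auto
  also have "\<dots> < e" using k v by simp
  finally have "(LINT x|lebesgue. \<bar>w x - h k x\<bar>) < e" .
  then show ?thesis by - (rule that[OF h compact_cball], rule hs, assumption+)
qed

section \<open>The mollifier and its convergence in L^1\<close>

definition bump :: "real \<Rightarrow> 'a::euclidean_space \<Rightarrow> real" where
  "bump e x = (max 0 (e\<^sup>2 - (norm x)\<^sup>2))\<^sup>2 / (LINT x::'a|lebesgue. (max 0 (e\<^sup>2 - (norm x)\<^sup>2))\<^sup>2)"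

definition Dbump :: "real \<Rightarrow> 'a::euclidean_space \<Rightarrow> 'a" where
  "Dbump e x = (2 * (- 2 * max 0 (e\<^sup>2 - (norm x)\<^sup>2) / (LINT x::'a|lebesgue. (max 0 (e\<^sup>2 - (norm x)\<^sup>2))\<^sup>2))) *\<^sub>R x"

lemma C1_test_bump:
  assumes "e > 0"
  shows "C1_test_function UNIV (bump e) (Dbump e :: 'a::euclidean_space \<Rightarrow> 'a)"
proof -
  define Z where "Z = (LINT x::'a|lebesgue. (max 0 (e\<^sup>2 - (norm x)\<^sup>2))\<^sup>2)"
  have "((\<lambda>s. (max 0 (e\<^sup>2 - s))\<^sup>2 / Z) has_real_derivative - 2 * max 0 (e\<^sup>2 - s) / Z) (at s)" for s
  proof -
    have "((\<lambda>s. (max 0 (e\<^sup>2 - s))\<^sup>2) has_real_derivative 2 * max 0 (e\<^sup>2 - s) * (-1)) (at s)"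
      by (rule DERIV_chain2[OF DERIV_max_0_square]) (auto intro!: derivative_eq_intros)
    from DERIV_cdivide[OF this, of Z] show ?thesis by simp
  qed
  from GDERIV_radial[OF this] have "GDERIV (bump e) x :> Dbump e x" for x :: 'a
    unfolding bump_def[abs_def] Dbump_def Z_def[symmetric] by simp
  moreover have "continuous_on UNIV (Dbump e :: 'a \<Rightarrow> 'a)"
    unfolding Dbump_def[abs_def] Z_def[symmetric] divide_inverse by (intro continuous_intros)
  moreover have "bump e x = 0" if "x \<notin> cball 0 e" for x :: 'a
  proof -
    have "e\<^sup>2 \<le> (norm x)\<^sup>2" using that assms by (intro power_mono) auto
    then show ?thesis by (simp add: bump_def)
  qed
  ultimately show ?thesis unfolding C1_test_function_def by (auto intro!: exI[of _ "cball 0 e"])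
qed

lemma bump_nonneg: "0 \<le> bump e x"
  unfolding bump_def by (intro divide_nonneg_nonneg Bochner_Integration.integral_nonneg) auto

lemma bump_minus: "bump e (x - y) = bump e (y - x)"
  by (simp add: bump_def norm_minus_commute)

lemma bump_support: "0 < e \<Longrightarrow> e \<le> norm x \<Longrightarrow> bump e x = 0"
  using power_mono[of e "norm x" 2] by (simp add: bump_def)

lemma continuous_on_bump: "e > 0 \<Longrightarrow> continuous_on S (bump e)"
  by (rule C1_test_continuous[OF C1_test_bump])

text \<open>Only the positivity of the normalizing integral needs an argument: division by 0 would
  make the bump vanish identically.\<close>

lemma bump_integral:
  assumes "e > 0"
  shows "integrable lborel (bump e :: 'a::euclidean_space \<Rightarrow> real)"
    and "(LINT x::'a|lborel. bump e x) = 1"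
    and "integrable lebesgue (bump e :: 'a::euclidean_space \<Rightarrow> real)"
    and "(LINT x::'a|lebesgue. bump e x) = 1"
proof -
  have b0: "bump e x = 0" if "x \<notin> cball 0 e" for x :: 'a
    using bump_support[OF assms, of x] that by auto
  note i = integrable_continuous_compact_support[OF continuous_on_bump[OF assms] compact_cball b0]
  show "integrable lborel (bump e :: 'a::euclidean_space \<Rightarrow> real)"
    "integrable lebesgue (bump e :: 'a::euclidean_space \<Rightarrow> real)" by (rule i; assumption)+
  define f where "f = (\<lambda>x::'a. (max 0 (e\<^sup>2 - (norm x)\<^sup>2))\<^sup>2)"
  have cf: "continuous_on UNIV f" unfolding f_def by (intro continuous_intros)
  have f0: "f x = 0" if "x \<notin> cball 0 e" for x :: 'a
    using power_mono[of e "norm x" 2] that assms by (simp add: f_def)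
  have iff: "integrable lebesgue f"
    by (rule integrable_continuous_compact_support[OF cf compact_cball f0])
  \<comment> \<open>Value of \<open>(e^2 - |x|^2)^2\<close> on the sphere
    \<open>|x| = e / 2\<close>, hence a lower bound for it in the ball of that radius.\<close>
  define c where "c = ((3/4) * e\<^sup>2)\<^sup>2"
  have c: "c > 0" using assms by (simp add: c_def)
  have "(LINT x|lebesgue. c * indicator (cball (0::'a) (e/2)) x) \<le> (LINT x|lebesgue. f x)"
  proof (rule integral_mono)
    show "c * indicator (cball (0::'a) (e/2)) x \<le> f x" for x
    proof (cases "x \<in> cball (0::'a) (e/2)")
      case True
      then have "(norm x)\<^sup>2 \<le> (e/2)\<^sup>2" by (intro power_mono) auto
      then have "(3/4) * e\<^sup>2 \<le> max 0 (e\<^sup>2 - (norm x)\<^sup>2)" using zero_le_power2[of "norm x"] unfolding power_divide by (simp only: le_max_iff_disj) simp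
      from power_mono[OF this, of 2] show ?thesis using True unfolding c_def f_def by simp
    qed (simp add: f_def)
  qed (use iff integrable_indicator_cball[of "0::'a" "e/2"] in auto)
  moreover have "(LINT x|lebesgue. c * indicator (cball (0::'a) (e/2)) x) > 0"
    using c assms by (simp add: content_cball_pos)
  ultimately have "(LINT x|lebesgue. f x) > 0" by linarith
  then show "(LINT x::'a|lebesgue. bump e x) = 1"
    unfolding bump_def f_def by simp
  moreover have "(LINT x::'a|lebesgue. bump e x) = (LINT x::'a|lborel. bump e x)" by (rule i; assumption)
  ultimately show "(LINT x::'a|lborel. bump e x) = 1" by simp
qed

definition mollify :: "real \<Rightarrow> ('a::euclidean_space \<Rightarrow> real) \<Rightarrow> 'a \<Rightarrow> real" where
  "mollify e w x = (LINT y|lebesgue. bump e (x - y) * w y)"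

lemma continuous_on_Dbump: "e > 0 \<Longrightarrow> continuous_on S (Dbump e)"
  using C1_test_bump unfolding C1_test_function_def by (blast intro: continuous_on_subset)

lemma bounded_bump: 
  assumes "e > 0"
  obtains C where "\<And>x::'a::euclidean_space. \<bar>bump e x\<bar> \<le> C" "\<And>x::'a. norm (Dbump e x) \<le> C"
proof -
  obtain K where K: "compact K" "K \<subseteq> UNIV" "\<And>x. x \<notin> K \<Longrightarrow> bump e x = 0" "\<And>x::'a. x \<notin> K \<Longrightarrow> Dbump e x = 0"
    using C1_test_support[OF C1_test_bump[OF assms]] by metis
  have "bounded (bump e ` K)" "bounded (Dbump e ` K)"
    using continuous_on_bump[OF assms] continuous_on_Dbump[OF assms] K(1)
    by (auto intro!: compact_imp_bounded compact_continuous_image)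
  then obtain a b where ab: "\<And>x. x \<in> K \<Longrightarrow> \<bar>bump e x\<bar> \<le> a" "\<And>x. x \<in> K \<Longrightarrow> norm (Dbump e x) \<le> b"
    unfolding bounded_iff by auto
  then have "\<bar>bump e x\<bar> \<le> \<bar>a\<bar> + \<bar>b\<bar>" "norm (Dbump e x) \<le> \<bar>a\<bar> + \<bar>b\<bar>" for x :: 'a
  proof -
    show "\<bar>bump e x\<bar> \<le> \<bar>a\<bar> + \<bar>b\<bar>" using ab(1)[of x] K(3)[of x] by (cases "x \<in> K") auto
    show "norm (Dbump e x) \<le> \<bar>a\<bar> + \<bar>b\<bar>" using ab(2)[of x] K(4)[of x] by (cases "x \<in> K") auto
  qed
  then show ?thesis by (rule that)
qed

lemma borel_measurable_bump_diff:
  assumes "e > 0"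
  shows "(\<lambda>y. bump e (x - y)) \<in> borel_measurable lebesgue" "(\<lambda>y. Dbump e (x - y)) \<in> borel_measurable lebesgue"
proof -
  show "(\<lambda>y. bump e (x - y)) \<in> borel_measurable lebesgue" "(\<lambda>y. Dbump e (x - y)) \<in> borel_measurable lebesgue"
    by (auto intro!: borel_measurable_lebesgue_continuous continuous_intros
         continuous_on_compose2[OF continuous_on_bump[OF assms, of UNIV]] continuous_on_compose2[OF continuous_on_Dbump[OF assms, of UNIV]])
qed

lemma integrable_bump_scaleR:
  fixes w :: "'a::euclidean_space \<Rightarrow> 'b::euclidean_space"
  assumes "e > 0" "integrable lebesgue w"
  shows "integrable lebesgue (\<lambda>y. bump e (x - y) *\<^sub>R w y)"
proof -
  obtain C where "\<And>x::'a::euclidean_space. \<bar>bump e x\<bar> \<le> C" using bounded_bump[OF assms(1)] by metis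
  then show ?thesis
    using borel_measurable_bump_diff(1)[OF assms(1)] assms(2) by (intro integrable_scaleR_bounded[where C=C]) auto
qed

lemma integrable_Dbump_scaleR:
  fixes w :: "'a::euclidean_space \<Rightarrow> real"
  assumes "e > 0" "integrable lebesgue w"
  shows "integrable lebesgue (\<lambda>y. w y *\<^sub>R Dbump e (x - y))"
proof -
  obtain C where C: "\<And>x::'a::euclidean_space. norm (Dbump e x) \<le> C" using bounded_bump[OF assms(1)] by metis
  have [measurable]: "w \<in> borel_measurable lebesgue" using assms by auto
  note [measurable] = borel_measurable_bump_diff(2)[OF assms(1)]
  show ?thesis
  proof (rule Bochner_Integration.integrable_bound[where f="\<lambda>y. C * w y"])
    show "AE y in lebesgue. norm (w y *\<^sub>R Dbump e (x - y)) \<le> norm (C * w y)"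
    proof (rule AE_I2)
      fix y
      have "norm (w y *\<^sub>R Dbump e (x - y)) \<le> \<bar>w y\<bar> * C" using C by (simp add: mult_left_mono)
      also have "\<dots> \<le> norm (C * w y)" by (simp add: abs_mult mult.commute mult_right_mono)
      finally show "norm (w y *\<^sub>R Dbump e (x - y)) \<le> norm (C * w y)" .
    qed
  qed (use assms in auto)
qed

text \<open>The linearization error of the kernel is uniform in its argument, so it can be
  integrated against \<open>|w|\<close> directly; this controls the increments of the convolution
  for every integrable \<open>w\<close>.\<close>

lemma GDERIV_mollify:
  fixes w :: "'a::euclidean_space \<Rightarrow> real"
  assumes e: "e > 0" and w: "integrable lebesgue w"
  shows "GDERIV (mollify e w) x :> (LINT y|lebesgue. w y *\<^sub>R Dbump e (x - y))"
    and "continuous_on UNIV (\<lambda>x. LINT y|lebesgue. w y *\<^sub>R Dbump e (x - y))"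
proof -
  \<comment> \<open>All errors below are multiples of this L^1 norm; dividing \<epsilon> by
    \<open>J + 1\<close> covers the case \<open>J = 0\<close>.\<close>
  define J where "J = (LINT y|lebesgue. \<bar>w y\<bar>)"
  have J: "J \<ge> 0" unfolding J_def by (rule Bochner_Integration.integral_nonneg) auto
  note iw = integrable_bump_scaleR[OF e w, simplified] and iD = integrable_Dbump_scaleR[OF e w]
  show "GDERIV (mollify e w) x :> (LINT y|lebesgue. w y *\<^sub>R Dbump e (x - y))"
    unfolding gderiv_def has_derivative_within_alt
  proof (intro conjI allI impI)
    fix \<epsilon> :: real assume "\<epsilon> > 0"
    then have "\<epsilon> / (J+1) > 0" using J by simp
    from C1_test_uniform_linearization[OF C1_test_bump[OF e] this]
    obtain d where d: "d > 0" "\<And>x k::'a. norm k < d \<Longrightarrow> \<bar>bump e (x + k) - bump e x - k \<bullet> Dbump e x\<bar> \<le> \<epsilon> / (J+1) * norm k"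
      by metis
    have "norm (mollify e w y - mollify e w x - (y - x) \<bullet> (LINT y|lebesgue. w y *\<^sub>R Dbump e (x - y))) \<le> \<epsilon> * norm (y - x)"
      if k: "norm (y - x) < d" for y
    proof -
      have "mollify e w y - mollify e w x - (y - x) \<bullet> (LINT y|lebesgue. w y *\<^sub>R Dbump e (x - y))
        = (LINT z|lebesgue. bump e (y - z) * w z - bump e (x - z) * w z - (y - x) \<bullet> (w z *\<^sub>R Dbump e (x - z)))"
      proof -
        have "(y - x) \<bullet> (LINT y|lebesgue. w y *\<^sub>R Dbump e (x - y)) = (LINT z|lebesgue. (y - x) \<bullet> (w z *\<^sub>R Dbump e (x - z)))"
          by (rule integral_inner_right[symmetric]) (rule iD)
        then show ?thesis
          unfolding mollify_def using iw[of x] iw[of y] integrable_inner_right[OF iD[of x], of "y - x"]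
          by (simp only:) (subst Bochner_Integration.integral_diff; simp)+
      qed
      also have "\<dots> = (LINT z|lebesgue. (bump e ((x - z) + (y - x)) - bump e (x - z) - (y - x) \<bullet> Dbump e (x - z)) * w z)"
        by (rule Bochner_Integration.integral_cong) (auto simp: algebra_simps)
      finally have "norm (mollify e w y - mollify e w x - (y - x) \<bullet> (LINT y|lebesgue. w y *\<^sub>R Dbump e (x - y)))
        \<le> (LINT z|lebesgue. \<epsilon> / (J+1) * norm (y - x) * \<bar>w z\<bar>)"
      proof (simp only:, intro norm_integral_le AE_I2)
        have "integrable lebesgue (\<lambda>z. bump e (y - z) * w z - bump e (x - z) * w z - (y - x) \<bullet> (w z *\<^sub>R Dbump e (x - z)))"
          by (intro Bochner_Integration.integrable_diff iw integrable_inner_right iD)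
        then show "integrable lebesgue (\<lambda>z. (bump e ((x - z) + (y - x)) - bump e (x - z) - (y - x) \<bullet> Dbump e (x - z)) * w z)"
          by (simp add: algebra_simps)
        show "norm ((bump e ((x - z) + (y - x)) - bump e (x - z) - (y - x) \<bullet> Dbump e (x - z)) * w z) \<le> \<epsilon> / (J+1) * norm (y - x) * \<bar>w z\<bar>" for z
          unfolding real_norm_def abs_mult by (intro mult_right_mono d(2)[OF k]) simp
      qed (use w in simp)
      also have "\<dots> = (\<epsilon> * norm (y - x)) * (J / (J+1))" by (simp add: J_def)
      also have "\<dots> \<le> (\<epsilon> * norm (y - x)) * 1" using J \<open>\<epsilon> > 0\<close> by (intro mult_left_mono) auto
      finally show ?thesis by simp
    qed
    then show "\<exists>d>0. \<forall>y\<in>UNIV. norm (y - x) < d \<longrightarrow>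
       norm (mollify e w y - mollify e w x - (y - x) \<bullet> (LINT y|lebesgue. w y *\<^sub>R Dbump e (x - y))) \<le> \<epsilon> * norm (y - x)"
      using d(1) by blast
  qed (rule bounded_linear_inner_left)
  obtain K where K: "compact K" "K \<subseteq> UNIV" "\<And>x. x \<notin> K \<Longrightarrow> bump e x = 0" "\<And>x::'a. x \<notin> K \<Longrightarrow> Dbump e x = 0"
    using C1_test_support[OF C1_test_bump[OF e]] by metis
  have cD: "continuous_on UNIV (Dbump e :: 'a \<Rightarrow> 'a)" by (rule continuous_on_Dbump[OF e])
  show "continuous_on UNIV (\<lambda>x. LINT y|lebesgue. w y *\<^sub>R Dbump e (x - y))"
    unfolding continuous_on_iff
  proof (intro ballI allI impI)
    fix x :: 'a and \<epsilon> :: real assume "\<epsilon> > 0"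
    then have "\<epsilon> / (J+1) > 0" using J by simp
    from uniformly_continuous_compact_support[OF cD K(1,4) this]
    obtain d where d: "d > 0" "\<And>x y::'a. norm (y - x) < d \<Longrightarrow> norm (Dbump e y - Dbump e x) < \<epsilon> / (J+1)" by metis
    have "dist (LINT z|lebesgue. w z *\<^sub>R Dbump e (y - z)) (LINT z|lebesgue. w z *\<^sub>R Dbump e (x - z)) < \<epsilon>"
      if k: "dist y x < d" for y
    proof -
      have "dist (LINT z|lebesgue. w z *\<^sub>R Dbump e (y - z)) (LINT z|lebesgue. w z *\<^sub>R Dbump e (x - z))
         = norm (LINT z|lebesgue. w z *\<^sub>R (Dbump e (y - z) - Dbump e (x - z)))"
        unfolding dist_norm using iD by (subst Bochner_Integration.integral_diff[symmetric]) (auto simp: scaleR_diff_right)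
      also have "\<dots> \<le> (LINT z|lebesgue. \<epsilon> / (J+1) * \<bar>w z\<bar>)"
      proof (intro norm_integral_le AE_I2)
        show "integrable lebesgue (\<lambda>z. w z *\<^sub>R (Dbump e (y - z) - Dbump e (x - z)))"
          using iD[of y] iD[of x] by (simp add: scaleR_diff_right)
        show "norm (w z *\<^sub>R (Dbump e (y - z) - Dbump e (x - z))) \<le> \<epsilon> / (J+1) * \<bar>w z\<bar>" for z
        proof -
          have "norm (Dbump e (y - z) - Dbump e (x - z)) \<le> \<epsilon> / (J+1)"
            using d(2)[of "y - z" "x - z"] k by (simp add: dist_norm)
          then have "norm (Dbump e (y - z) - Dbump e (x - z)) * \<bar>w z\<bar> \<le> \<epsilon> / (J+1) * \<bar>w z\<bar>"
            by (rule mult_right_mono) simp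
          then show ?thesis by (simp only: norm_scaleR mult.commute)
        qed
      qed (use w in auto)
      also have "\<dots> = \<epsilon> * (J / (J+1))" by (simp add: J_def)
      also have "\<dots> < \<epsilon> * 1" using J \<open>\<epsilon> > 0\<close> by (intro mult_strict_left_mono) auto
      finally show ?thesis by simp
    qed
    then show "\<exists>d>0. \<forall>x'\<in>UNIV. dist x' x < d \<longrightarrow>
       dist (LINT y|lebesgue. w y *\<^sub>R Dbump e (x' - y)) (LINT y|lebesgue. w y *\<^sub>R Dbump e (x - y)) < \<epsilon>"
      using d(1) by blast
  qed
qed

lemma continuous_on_mollify: "e > 0 \<Longrightarrow> integrable lebesgue w \<Longrightarrow> continuous_on S (mollify e w)"
  using GDERIV_mollify(1) unfolding gderiv_def
  by (meson continuous_at_imp_continuous_on has_derivative_continuous)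

text \<open>Tonelli: the kernel has integral 1 in \<open>x\<close> for every fixed \<open>y\<close>,
  so mollification is a contraction of L^1.\<close>

lemma mollify_L1_bound:
  fixes w :: "'a::euclidean_space \<Rightarrow> real"
  assumes e: "e > 0" and w: "integrable lebesgue w"
  shows "integrable lebesgue (mollify e w)"
    and "(LINT x|lebesgue. \<bar>mollify e w x\<bar>) \<le> (LINT x|lebesgue. \<bar>w x\<bar>)"
proof -
  have [measurable]: "w \<in> borel_measurable lebesgue" using w by auto
  \<comment> \<open>Exchanging the integrals requires Borel measurability on the product, so the
    Lebesgue measurable \<open>w\<close> is replaced by a Borel representative.\<close>
  obtain w' where [measurable]: "w' \<in> borel_measurable lborel" and ae: "AE x in lborel. w x = w' x"
    using completion_ex_borel_measurable_real[of w lborel] by auto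
  have ae': "AE x in lebesgue. w x = w' x" using ae by (rule AE_completion)
  have [measurable]: "(bump e :: 'a \<Rightarrow> real) \<in> borel_measurable borel"
    by (intro borel_measurable_continuous_onI continuous_on_bump e)
  have [measurable]: "mollify e w \<in> borel_measurable borel"
    by (intro borel_measurable_continuous_onI continuous_on_mollify e w)
  have "ennreal \<bar>mollify e w x\<bar> \<le> (\<integral>\<^sup>+ y. ennreal (bump e (x - y)) * ennreal \<bar>w' y\<bar> \<partial>lborel)" for x
  proof -
    have "ennreal \<bar>mollify e w x\<bar> \<le> (\<integral>\<^sup>+ y. ennreal \<bar>bump e (x - y) * w y\<bar> \<partial>lebesgue)"
      unfolding mollify_def using integrable_bump_scaleR[OF e w, of x]
      by (intro integral_norm_bound_ennreal[of _ "\<lambda>y. bump e (x - y) * w y", simplified]) simp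
    also have "\<dots> = (\<integral>\<^sup>+ y. ennreal \<bar>bump e (x - y) * w' y\<bar> \<partial>lebesgue)"
      using ae' by (intro nn_integral_cong_AE) auto
    also have "\<dots> = (\<integral>\<^sup>+ y. ennreal (bump e (x - y)) * ennreal \<bar>w' y\<bar> \<partial>lborel)"
      by (simp add: nn_integral_completion abs_mult bump_nonneg ennreal_mult)
    finally show ?thesis .
  qed
  then have "(\<integral>\<^sup>+ x. ennreal \<bar>mollify e w x\<bar> \<partial>lborel)
     \<le> (\<integral>\<^sup>+ x. \<integral>\<^sup>+ y. ennreal (bump e (x - y)) * ennreal \<bar>w' y\<bar> \<partial>lborel \<partial>lborel)"
    by (intro nn_integral_mono)
  also have "\<dots> = (\<integral>\<^sup>+ y. \<integral>\<^sup>+ x. ennreal (bump e (x - y)) * ennreal \<bar>w' y\<bar> \<partial>lborel \<partial>lborel)"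
    by (rule lborel_pair.Fubini'[symmetric]) measurable
  also have "\<dots> = (\<integral>\<^sup>+ y. ennreal \<bar>w' y\<bar> \<partial>lborel)"
  proof (rule nn_integral_cong)
    fix y :: 'a
    have "(\<integral>\<^sup>+ x. ennreal (bump e (x - y)) \<partial>lborel) = 1"
    proof -
      have "integrable lborel (\<lambda>x. bump e (x - y))"
        by (rule integrable_continuous_compact_support(1)[where K="cball y e"])
           (use e in \<open>auto intro!: continuous_on_compose2[OF continuous_on_bump[OF e, of UNIV]] continuous_intros bump_support simp: dist_norm norm_minus_commute\<close>)
      then have "(\<integral>\<^sup>+ x. ennreal (bump e (x - y)) \<partial>lborel) = ennreal (LINT x|lborel. bump e (x - y))"
        by (intro nn_integral_eq_integral) (auto simp: bump_nonneg)
      also have "(LINT x|lborel. bump e (x - y)) = 1"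
        using lborel_integral_translate[of "bump e" "-y"] bump_integral(2)[OF e] by simp
      finally show ?thesis by simp
    qed
    then show "(\<integral>\<^sup>+ x. ennreal (bump e (x - y)) * ennreal \<bar>w' y\<bar> \<partial>lborel) = ennreal \<bar>w' y\<bar>"
      by (subst nn_integral_multc) auto
  qed
  also have "\<dots> = (\<integral>\<^sup>+ y. ennreal \<bar>w y\<bar> \<partial>lebesgue)"
    using ae' by (subst nn_integral_completion[symmetric]) (intro nn_integral_cong_AE, auto)
  also have "\<dots> = ennreal (LINT y|lebesgue. \<bar>w y\<bar>)"
    using w by (intro nn_integral_eq_integral) auto
  finally have *: "(\<integral>\<^sup>+ x. ennreal \<bar>mollify e w x\<bar> \<partial>lebesgue) \<le> ennreal (LINT y|lebesgue. \<bar>w y\<bar>)"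
    by (simp add: nn_integral_completion)
  have m: "mollify e w \<in> borel_measurable lebesgue" by (intro measurable_completion) measurable
  show i: "integrable lebesgue (mollify e w)"
    using * m by (intro integrableI_bounded) (auto simp: top_unique less_top[symmetric])
  have "ennreal (LINT x|lebesgue. \<bar>mollify e w x\<bar>) = (\<integral>\<^sup>+ x. ennreal \<bar>mollify e w x\<bar> \<partial>lebesgue)"
    using i by (intro nn_integral_eq_integral[symmetric]) auto
  with * have "ennreal (LINT x|lebesgue. \<bar>mollify e w x\<bar>) \<le> ennreal (LINT x|lebesgue. \<bar>w x\<bar>)" by simp
  moreover have nn: "0 \<le> (LINT x|lebesgue. \<bar>w x\<bar>)" by (rule Bochner_Integration.integral_nonneg) simp
  ultimately show "(LINT x|lebesgue. \<bar>mollify e w x\<bar>) \<le> (LINT x|lebesgue. \<bar>w x\<bar>)"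
    by (simp only: ennreal_le_iff)
qed

lemma LINT_inner: "integrable M f \<Longrightarrow> integral\<^sup>L M f \<bullet> b = (LINT x|M. f x \<bullet> b)"
  by (rule integral_inner_left[symmetric])

lemma bump_diff_integral:
  fixes x :: "'a::euclidean_space"
  assumes e: "e > 0"
  shows "integrable lebesgue (\<lambda>y. bump e (x - y))" "(LINT y|lebesgue. bump e (x - y)) = 1"
proof -
  show "integrable lebesgue (\<lambda>y. bump e (x - y))"
    by (rule integrable_continuous_compact_support(2)[where K="cball x e"])
       (use e in \<open>auto intro!: continuous_on_compose2[OF continuous_on_bump[OF e, of UNIV]] continuous_intros bump_support simp: dist_norm\<close>)
  show "(LINT y|lebesgue. bump e (x - y)) = 1"
  proof -
    have [measurable]: "(bump e :: 'a \<Rightarrow> real) \<in> borel_measurable borel"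
      by (intro borel_measurable_continuous_onI continuous_on_bump e)
    have "(LINT y|lebesgue. bump e (x - y)) = (LINT y|lborel. bump e (y + - x))"
      by (subst integral_completion) (auto simp: bump_minus[of e x])
    also have "\<dots> = 1" by (subst lborel_integral_translate) (auto simp: bump_integral(2)[OF e])
    finally show ?thesis .
  qed
qed

lemma mollify_abs_le:
  fixes u :: "'a::euclidean_space \<Rightarrow> real"
  assumes e: "e > 0" and u: "integrable lebesgue u" and B: "AE x in lebesgue. \<bar>u x\<bar> \<le> B"
  shows "\<bar>mollify e u x\<bar> \<le> B"
proof -
  note ib = bump_diff_integral(1)[OF e, of x] and one = bump_diff_integral(2)[OF e, of x]
  have "\<bar>mollify e u x\<bar> \<le> (LINT y|lebesgue. \<bar>bump e (x - y) * u y\<bar>)"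
    unfolding mollify_def by (rule integral_abs_bound)
  also have "\<dots> \<le> (LINT y|lebesgue. bump e (x - y) * B)"
  proof (rule integral_mono_AE)
    show "integrable lebesgue (\<lambda>y. \<bar>bump e (x - y) * u y\<bar>)"
      using integrable_bump_scaleR[OF e u, of x] by (intro integrable_abs) simp
    show "AE y in lebesgue. \<bar>bump e (x - y) * u y\<bar> \<le> bump e (x - y) * B"
      using B by eventually_elim (simp add: abs_mult bump_nonneg mult_left_mono)
  qed (use ib in simp)
  also have "\<dots> = B" using one by simp
  finally show ?thesis .
qed

lemma mollify_diff:
  assumes e: "e > 0" and "integrable lebesgue v" "integrable lebesgue w"
  shows "mollify e (\<lambda>x. v x - w x) x = mollify e v x - mollify e w x"
  unfolding mollify_def right_diff_distrib
  using integrable_bump_scaleR[OF e assms(2), of x] integrable_bump_scaleR[OF e assms(3), of x]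
  by (intro Bochner_Integration.integral_diff) auto

text \<open>Uniform continuity makes the error uniformly small, and since the mollification radii
  are at most 1 it lives in one fixed ball.\<close>

lemma mollify_continuous_L1:
  fixes g :: "'a::euclidean_space \<Rightarrow> real"
  assumes g: "continuous_on UNIV g" "compact K" "\<And>x. x \<notin> K \<Longrightarrow> g x = 0" and "\<epsilon> > 0"
  shows "\<forall>\<^sub>F n in sequentially. (LINT x|lebesgue. \<bar>mollify (1 / Suc n) g x - g x\<bar>) < \<epsilon>"
proof -
  have ig: "integrable lebesgue g" by (rule integrable_continuous_compact_support(2)[OF g])
  obtain R where R: "K \<subseteq> cball 0 R" "R > 0"
    using compact_imp_bounded[OF g(2)] by (meson bounded_subset_ballD ball_subset_cball subset_trans)
  define c where "c = measure lebesgue (cball (0::'a) (R+1))"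
  have c: "c \<ge> 0" by (simp add: c_def)
  obtain d where d: "d > 0" "\<And>x y. norm (y - x) < d \<Longrightarrow> norm (g y - g x) < \<epsilon> / (c+1)"
    using uniformly_continuous_compact_support[OF g(1,2), of "\<epsilon> / (c+1)"] g(3) c \<open>\<epsilon> > 0\<close> by (metis add_nonneg_pos divide_pos_pos zero_less_one)
  obtain m where m: "m > 0" "1 / real m < d"
    using real_arch_inverse[of d] d(1) by (auto simp: inverse_eq_divide)
  have "(LINT x|lebesgue. \<bar>mollify (1 / Suc n) g x - g x\<bar>) < \<epsilon>" if "n \<ge> m" for n
  proof -
    define e where "e = 1 / real (Suc n)"
    have e: "e > 0" "e \<le> 1" by (auto simp: e_def)
    have "e \<le> 1 / real m" unfolding e_def using that m by (intro divide_left_mono) auto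
    then have ed: "e < d" using m by simp
    have iM: "integrable lebesgue (mollify e g)" by (rule mollify_L1_bound(1)[OF e(1) ig])
    have pt: "\<bar>mollify e g x - g x\<bar> \<le> \<epsilon> / (c+1)" for x
    proof -
      note ib = bump_diff_integral(1)[OF e(1), of x] and one = bump_diff_integral(2)[OF e(1), of x]
      have ibg: "integrable lebesgue (\<lambda>y. bump e (x - y) * g y)" using integrable_bump_scaleR[OF e(1) ig, of x] by simp
      have "mollify e g x - g x = (LINT y|lebesgue. bump e (x - y) * g y) - (LINT y|lebesgue. bump e (x - y) * g x)"
        using one by (simp add: mollify_def)
      also have "\<dots> = (LINT y|lebesgue. bump e (x - y) * (g y - g x))"
        using ibg ib by (subst Bochner_Integration.integral_diff[symmetric]) (auto simp: right_diff_distrib)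
      also have "\<bar>\<dots>\<bar> \<le> (LINT y|lebesgue. \<bar>bump e (x - y) * (g y - g x)\<bar>)"
        by (rule integral_abs_bound)
      also have "\<dots> \<le> (LINT y|lebesgue. bump e (x - y) * (\<epsilon> / (c+1)))"
      proof (rule integral_mono)
        show "integrable lebesgue (\<lambda>y. \<bar>bump e (x - y) * (g y - g x)\<bar>)"
          unfolding right_diff_distrib using ibg ib by auto
        show "\<bar>bump e (x - y) * (g y - g x)\<bar> \<le> bump e (x - y) * (\<epsilon> / (c+1))" for y
        proof (cases "norm (x - y) < e")
          case True
          then have "\<bar>g y - g x\<bar> \<le> \<epsilon> / (c+1)" using d(2)[of y x] ed by (auto simp: norm_minus_commute)
          then have "bump e (x - y) * \<bar>g y - g x\<bar> \<le> bump e (x - y) * (\<epsilon> / (c+1))"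
            by (rule mult_left_mono) (rule bump_nonneg)
          then show ?thesis by (simp only: abs_mult abs_of_nonneg[OF bump_nonneg])
        next
          case False
          then have "bump e (x - y) = 0" by (intro bump_support[OF e(1)]) simp
          then show ?thesis by simp
        qed
      qed (use ib in auto)
      also have "\<dots> = \<epsilon> / (c+1)" using one by simp
      finally show ?thesis .
    qed
    have z: "mollify e g x - g x = 0" if x: "x \<notin> cball 0 (R+1)" for x
    proof -
      have "bump e (x - y) * g y = 0" for y
      proof (cases "y \<in> K")
        case True
        then have "norm y \<le> R" using R by auto
        then have "e \<le> norm (x - y)" using x e norm_triangle_ineq2[of x y] by auto
        then have "bump e (x - y) = 0" by (rule bump_support[OF e(1)])
        then show ?thesis by simp
      qed (simp add: g)
      then have "mollify e g x = 0" unfolding mollify_def by (simp only: Bochner_Integration.integral_zero)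
      moreover have "x \<notin> K" using x R by auto
      ultimately show ?thesis using g(3) by simp
    qed
    have "(LINT x|lebesgue. \<bar>mollify e g x - g x\<bar>) \<le> (LINT x|lebesgue. indicator (cball (0::'a) (R+1)) x * (\<epsilon> / (c+1)))"
    proof (rule integral_mono)
      show "\<bar>mollify e g x - g x\<bar> \<le> indicator (cball (0::'a) (R+1)) x * (\<epsilon> / (c+1))" for x
        using pt[of x] z[of x] by (cases "x \<in> cball 0 (R+1)") auto
      show "integrable lebesgue (\<lambda>x. indicator (cball (0::'a) (R+1)) x * (\<epsilon> / (c+1)))"
        by (intro integrable_mult_left integrable_indicator_cball)
    qed (use iM ig in auto)
    also have "\<dots> = \<epsilon> * (c / (c + 1))" by (simp add: c_def)
    also have "\<dots> < \<epsilon> * 1" using c \<open>\<epsilon> > 0\<close> by (intro mult_strict_left_mono) auto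
    finally show ?thesis by (simp add: e_def)
  qed
  then show ?thesis by (auto simp: eventually_sequentially)
qed

text \<open>Approximate \<open>w\<close> by a continuous \<open>g\<close> and use the L^1
  contraction for the mollification of \<open>w - g\<close>; this makes three errors of size
  \<epsilon> / 3.\<close>

lemma mollify_tendsto_L1:
  fixes w :: "'a::euclidean_space \<Rightarrow> real"
  assumes w: "integrable lebesgue w"
  shows "(\<lambda>n. LINT x|lebesgue. \<bar>mollify (1 / Suc n) w x - w x\<bar>) \<longlonglongrightarrow> 0"
proof (rule order_tendstoI)
  fix a :: real assume "a < 0"
  then show "\<forall>\<^sub>F n in sequentially. a < (LINT x|lebesgue. \<bar>mollify (1 / Suc n) w x - w x\<bar>)"
    by (intro always_eventually allI less_le_trans[OF _ Bochner_Integration.integral_nonneg]) auto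
next
  fix \<epsilon> :: real assume "\<epsilon> > 0"
  then obtain g K where g: "continuous_on UNIV g" "compact K" "\<And>x. x \<notin> K \<Longrightarrow> g x = 0"
    and wg: "(LINT x|lebesgue. \<bar>w x - g x\<bar>) < \<epsilon> / 3"
    using integrable_approx_continuous[OF w, of "\<epsilon>/3"] by (metis divide_pos_pos zero_less_numeral)
  have ig: "integrable lebesgue g" by (rule integrable_continuous_compact_support(2)[OF g])
  have iwg: "integrable lebesgue (\<lambda>x. w x - g x)" using w ig by simp
  have "\<forall>\<^sub>F n in sequentially. (LINT x|lebesgue. \<bar>mollify (1 / Suc n) g x - g x\<bar>) < \<epsilon> / 3"
    using \<open>\<epsilon> > 0\<close> by (intro mollify_continuous_L1[OF g]) auto
  then show "\<forall>\<^sub>F n in sequentially. (LINT x|lebesgue. \<bar>mollify (1 / Suc n) w x - w x\<bar>) < \<epsilon>"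
  proof eventually_elim
    case (elim n)
    define e where "e = 1 / real (Suc n)"
    have e: "e > 0" by (simp add: e_def)
    note iM = mollify_L1_bound(1)[OF e]
    have "(LINT x|lebesgue. \<bar>mollify e w x - w x\<bar>)
      \<le> (LINT x|lebesgue. \<bar>mollify e (\<lambda>x. w x - g x) x\<bar> + \<bar>mollify e g x - g x\<bar> + \<bar>w x - g x\<bar>)"
      using iM[OF w] iM[OF ig] iM[OF iwg] w ig
      by (intro integral_mono) (auto simp: mollify_diff[OF e w ig])
    also have "\<dots> = (LINT x|lebesgue. \<bar>mollify e (\<lambda>x. w x - g x) x\<bar>) + (LINT x|lebesgue. \<bar>mollify e g x - g x\<bar>)
        + (LINT x|lebesgue. \<bar>w x - g x\<bar>)"
      using iM[OF w] iM[OF ig] iM[OF iwg] w ig by simp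
    also have "\<dots> < \<epsilon> / 3 + \<epsilon> / 3 + \<epsilon> / 3"
      using mollify_L1_bound(2)[OF e iwg] wg elim by (auto simp: e_def)
    finally show ?case by (simp add: e_def)
  qed
qed

text \<open>The chain rule is classical for the mollified functions; it passes to the limit because
  \<open>D(u * \<rho>) = Du * \<rho>\<close> converges in \<open>L\<^sup>1\<close> while \<open>f'(u * \<rho>)\<close> stays bounded and converges
  almost everywhere along a subsequence.\<close>

lemma weak_chain_rule_UNIV:
  fixes u :: "'a::euclidean_space \<Rightarrow> real" and G :: "'a \<Rightarrow> 'a"
  assumes u: "integrable lebesgue u" and G: "integrable lebesgue G"
    and B: "AE x in lebesgue. \<bar>u x\<bar> \<le> B"
    and weak: "\<And>\<zeta> D\<zeta>. C1_test_function UNIV \<zeta> D\<zeta> \<Longrightarrow>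
      (LINT x|lebesgue. u x *\<^sub>R D\<zeta> x) = - (LINT x|lebesgue. \<zeta> x *\<^sub>R G x)"
    and f: "\<And>t. (f has_real_derivative f' t) (at t)" "continuous_on UNIV f'"
    and test: "C1_test_function UNIV \<zeta> D\<zeta>"
  shows "(LINT x|lebesgue. f (u x) *\<^sub>R D\<zeta> x) = - (LINT x|lebesgue. \<zeta> x *\<^sub>R f' (u x) *\<^sub>R G x)"
proof -
  have cf: "continuous_on UNIV f" using f(1) by (meson DERIV_isCont continuous_at_imp_continuous_on)
  obtain K where K: "compact K" "K \<subseteq> UNIV" "\<And>x. x \<notin> K \<Longrightarrow> \<zeta> x = 0" "\<And>x. x \<notin> K \<Longrightarrow> D\<zeta> x = 0"
    using C1_test_support[OF test] by metis
  have c\<zeta>: "continuous_on UNIV \<zeta>" by (rule C1_test_continuous[OF test])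
  have cD: "continuous_on UNIV D\<zeta>" using test by (simp add: C1_test_function_def)
  have iD: "integrable lebesgue D\<zeta>" by (rule integrable_continuous_compact_support(2)[OF cD K(1,4)])
  have "bounded (\<zeta> ` K)" using c\<zeta> K by (intro compact_imp_bounded compact_continuous_image) (auto intro: continuous_on_subset)
  then obtain Z where Z: "\<And>x. x \<in> K \<Longrightarrow> \<bar>\<zeta> x\<bar> \<le> Z" unfolding bounded_iff by auto
  have Z: "\<bar>\<zeta> x\<bar> \<le> \<bar>Z\<bar>" for x using Z[of x] K(3)[of x] by (cases "x \<in> K") auto
  have "bounded (f ` {-\<bar>B\<bar>..\<bar>B\<bar>})" "bounded (f' ` {-\<bar>B\<bar>..\<bar>B\<bar>})"
    using cf f(2) by (auto intro!: compact_imp_bounded compact_continuous_image intro: continuous_on_subset)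
  then obtain Cf Cf' where "\<forall>t\<in>{-\<bar>B\<bar>..\<bar>B\<bar>}. norm (f t) \<le> Cf" "\<forall>t\<in>{-\<bar>B\<bar>..\<bar>B\<bar>}. norm (f' t) \<le> Cf'"
    unfolding bounded_iff by auto
  then have C: "\<And>t. \<bar>t\<bar> \<le> \<bar>B\<bar> \<Longrightarrow> \<bar>f t\<bar> \<le> Cf" "\<And>t. \<bar>t\<bar> \<le> \<bar>B\<bar> \<Longrightarrow> \<bar>f' t\<bar> \<le> Cf'"
    by (auto simp: abs_le_iff)
  have Cf'0: "0 \<le> Cf'" using C(2)[of 0] by auto
  have [measurable]: "u \<in> borel_measurable lebesgue" "G \<in> borel_measurable lebesgue" "D\<zeta> \<in> borel_measurable lebesgue"
    using u G iD by auto
  have [measurable]: "\<zeta> \<in> borel_measurable lebesgue" by (rule borel_measurable_lebesgue_continuous[OF c\<zeta>])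
  have [measurable]: "f \<in> borel_measurable borel" "f' \<in> borel_measurable borel"
    using cf f(2) by (auto intro: borel_measurable_continuous_onI)
  define U where "U = (\<lambda>n. mollify (1 / real (Suc n)) u)"
  define DU where "DU = (\<lambda>n x. LINT y|lebesgue. u y *\<^sub>R Dbump (1 / real (Suc n)) (x - y))"
  have e: "0 < 1 / real (Suc n)" for n by simp
  have gd: "GDERIV (U n) x :> DU n x" and cDU: "continuous_on UNIV (DU n)" for n x
    using GDERIV_mollify[OF e u] unfolding U_def DU_def by auto
  have cU: "continuous_on S (U n)" for S n unfolding U_def by (rule continuous_on_mollify[OF e u])
  have [measurable]: "U n \<in> borel_measurable lebesgue" for n by (rule borel_measurable_lebesgue_continuous[OF cU])
  have UB: "\<bar>U n x\<bar> \<le> \<bar>B\<bar>" for n x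
    unfolding U_def by (rule mollify_abs_le[OF e u]) (use B in \<open>auto elim: eventually_mono\<close>)
  have uB: "AE x in lebesgue. \<bar>u x\<bar> \<le> \<bar>B\<bar>" using B by (auto elim: eventually_mono)
  \<comment> \<open>Here the weak gradient enters: as a function of \<open>y\<close>,
    \<open>bump ?e (x - y)\<close> is itself a test function, so the derivative passes from the
    kernel to \<open>G\<close>.\<close>
  have DU_eq: "DU n x \<bullet> b = mollify (1 / real (Suc n)) (\<lambda>y. G y \<bullet> b) x" for n x b
  proof -
    let ?e = "1 / real (Suc n)"
    have "C1_test_function UNIV (\<lambda>y. bump ?e (x - y)) (\<lambda>y. - Dbump ?e (x - y))"
      unfolding C1_test_function_def
    proof (intro conjI allI)
      show "GDERIV (\<lambda>y. bump ?e (x - y)) y :> - Dbump ?e (x - y)" for y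
      proof -
        have "(bump ?e has_derivative (\<lambda>h. h \<bullet> Dbump ?e (x - y))) (at (x - y))"
          using C1_test_bump[OF e, of n, where 'a='a] by (simp add: C1_test_function_def gderiv_def)
        then have "((\<lambda>y. bump ?e (x - y)) has_derivative (\<lambda>h. (- h) \<bullet> Dbump ?e (x - y))) (at y)"
          by (rule has_derivative_compose[rotated]) (auto intro!: derivative_eq_intros)
        then show ?thesis by (simp add: gderiv_def)
      qed
      show "continuous_on UNIV (\<lambda>y. - Dbump ?e (x - y))"
        by (intro continuous_intros continuous_on_compose2[OF continuous_on_Dbump[OF e, of UNIV]]) auto
      show "\<exists>K. compact K \<and> K \<subseteq> UNIV \<and> (\<forall>y. y \<notin> K \<longrightarrow> bump ?e (x - y) = 0)"
        by (rule exI[of _ "cball x ?e"]) (auto intro!: bump_support simp: dist_norm)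
    qed
    from weak[OF this] have "DU n x = (LINT y|lebesgue. bump ?e (x - y) *\<^sub>R G y)"
      by (simp add: DU_def)
    then show ?thesis
      using integral_inner_left[OF integrable_bump_scaleR[OF e G, of n x], of b]
      by (simp add: mollify_def del: of_nat_Suc)
  qed
  have "(\<lambda>n. LINT x|lebesgue. norm (U n x - u x)) \<longlonglongrightarrow> 0"
    using mollify_tendsto_L1[OF u] by (simp add: U_def)
  moreover have "integrable lebesgue (\<lambda>x. U n x - u x)" for n
    using mollify_L1_bound(1)[OF e u] u by (simp add: U_def)
  ultimately obtain r :: "nat \<Rightarrow> nat" where r: "strict_mono r" "AE x in lebesgue. (\<lambda>n. U (r n) x - u x) \<longlonglongrightarrow> 0"
    using tendsto_L1_AE_subseq[of lebesgue "\<lambda>n x. U n x - u x"] by auto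
  have rU: "AE x in lebesgue. (\<lambda>n. U (r n) x) \<longlonglongrightarrow> u x"
    using r(2) by eventually_elim (simp add: LIM_zero_cancel)
  have comp: "(LINT x|lebesgue. f (u x) * (D\<zeta> x \<bullet> b)) = - (LINT x|lebesgue. \<zeta> x * f' (u x) * (G x \<bullet> b))" for b
  proof -
    define g where "g = (\<lambda>x. G x \<bullet> b)"
    define M where "M = (\<lambda>n. mollify (1 / real (Suc n)) g)"
    have ig: "integrable lebesgue g" using G by (simp add: g_def)
    have iM: "integrable lebesgue (M n)" for n unfolding M_def by (rule mollify_L1_bound(1)[OF e ig])
    have [measurable]: "g \<in> borel_measurable lebesgue" "M n \<in> borel_measurable lebesgue" for n
      using ig iM by auto
    have ibd: "integrable lebesgue (\<lambda>x. (\<zeta> x * f' (v x)) * h x)"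
      if "integrable lebesgue h" "v \<in> borel_measurable lebesgue" "AE x in lebesgue. \<bar>v x\<bar> \<le> \<bar>B\<bar>" for h v
    proof -
      have "AE x in lebesgue. \<bar>\<zeta> x * f' (v x)\<bar> \<le> \<bar>Z\<bar> * Cf'"
        using that(3) by eventually_elim (auto simp: abs_mult intro!: mult_mono Z C)
      from integrable_scaleR_bounded[OF that(1) _ this] that(2) show ?thesis by simp
    qed
    \<comment> \<open>For the mollified function the claim is classical: the gradient of
      \<open>f (U n) * \<zeta>\<close> has integral zero.\<close>
    have A1: "(LINT x|lebesgue. f (U n x) * (D\<zeta> x \<bullet> b)) = - (LINT x|lebesgue. \<zeta> x * f' (U n x) * M n x)" for n
    proof -
      have gdf: "GDERIV (\<lambda>x. f (U n x)) x :> f' (U n x) *\<^sub>R DU n x" for x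
        by (rule GDERIV_DERIV_compose[OF gd f(1)])
      have "C1_test_function UNIV (\<lambda>x. f (U n x) * \<zeta> x) (\<lambda>x. f (U n x) *\<^sub>R D\<zeta> x + \<zeta> x *\<^sub>R f' (U n x) *\<^sub>R DU n x)"
        using gdf cDU cU f(2) by (intro C1_test_mult test) (auto intro!: continuous_intros continuous_on_compose2[OF f(2)])
      from integral_gradient_zero[OF this]
      have z: "(LINT x|lebesgue. f (U n x) *\<^sub>R D\<zeta> x + \<zeta> x *\<^sub>R f' (U n x) *\<^sub>R DU n x) = 0" .
      have i1: "integrable lebesgue (\<lambda>x. f (U n x) *\<^sub>R D\<zeta> x)"
        by (intro integrable_scaleR_bounded[OF iD, where C=Cf]) (auto intro!: C UB)
      have i2: "integrable lebesgue (\<lambda>x. \<zeta> x *\<^sub>R f' (U n x) *\<^sub>R DU n x)"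
        by (rule integrable_continuous_compact_support(2)[OF _ K(1)])
           (auto simp: K intro!: continuous_intros cDU c\<zeta> continuous_on_compose2[OF f(2)] cU)
      have "0 = (LINT x|lebesgue. f (U n x) *\<^sub>R D\<zeta> x + \<zeta> x *\<^sub>R f' (U n x) *\<^sub>R DU n x) \<bullet> b" using z by simp
      also have "\<dots> = (LINT x|lebesgue. (f (U n x) *\<^sub>R D\<zeta> x) \<bullet> b) + (LINT x|lebesgue. (\<zeta> x *\<^sub>R f' (U n x) *\<^sub>R DU n x) \<bullet> b)"
        by (simp only: Bochner_Integration.integral_add[OF i1 i2] inner_add_left LINT_inner[OF i1] LINT_inner[OF i2])
      also have "(LINT x|lebesgue. (\<zeta> x *\<^sub>R f' (U n x) *\<^sub>R DU n x) \<bullet> b) = (LINT x|lebesgue. \<zeta> x * f' (U n x) * M n x)"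
        by (simp add: DU_eq M_def g_def mult.assoc)
      finally show ?thesis by simp
    qed
    have L1: "(\<lambda>n. LINT x|lebesgue. f (U (r n) x) * (D\<zeta> x \<bullet> b)) \<longlonglongrightarrow> (LINT x|lebesgue. f (u x) * (D\<zeta> x \<bullet> b))"
    proof (rule integral_dominated_convergence[where w="\<lambda>x. Cf * \<bar>D\<zeta> x \<bullet> b\<bar>"])
      show "AE x in lebesgue. (\<lambda>n. f (U (r n) x) * (D\<zeta> x \<bullet> b)) \<longlonglongrightarrow> f (u x) * (D\<zeta> x \<bullet> b)"
        using rU by eventually_elim (intro tendsto_intros continuous_on_tendsto_compose[OF cf], auto)
      show "AE x in lebesgue. norm (f (U (r n) x) * (D\<zeta> x \<bullet> b)) \<le> Cf * \<bar>D\<zeta> x \<bullet> b\<bar>" for n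
        by (auto simp: abs_mult intro!: mult_right_mono C UB)
    qed (use iD in auto)
    have L2: "(\<lambda>n. LINT x|lebesgue. \<zeta> x * f' (U (r n) x) * g x) \<longlonglongrightarrow> (LINT x|lebesgue. \<zeta> x * f' (u x) * g x)"
    proof (rule integral_dominated_convergence[where w="\<lambda>x. \<bar>Z\<bar> * Cf' * \<bar>g x\<bar>"])
      show "AE x in lebesgue. (\<lambda>n. \<zeta> x * f' (U (r n) x) * g x) \<longlonglongrightarrow> \<zeta> x * f' (u x) * g x"
        using rU by eventually_elim (intro tendsto_intros continuous_on_tendsto_compose[OF f(2)], auto)
      show "AE x in lebesgue. norm (\<zeta> x * f' (U (r n) x) * g x) \<le> \<bar>Z\<bar> * Cf' * \<bar>g x\<bar>" for n
        by (auto simp: abs_mult intro!: mult_right_mono mult_mono C UB Z)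
    qed (use ig in auto)
    \<comment> \<open>The factor \<open>M (r n)\<close> converges only in L^1, so its deviation from
      \<open>g\<close> is split off and paired with a bounded factor; the integral with the fixed
      \<open>g\<close> is the one treated by dominated convergence.\<close>
    have L3: "(\<lambda>n. LINT x|lebesgue. \<zeta> x * f' (U (r n) x) * (M (r n) x - g x)) \<longlonglongrightarrow> 0"
    proof (rule Lim_null_comparison)
      show "\<forall>\<^sub>F n in sequentially. norm (LINT x|lebesgue. \<zeta> x * f' (U (r n) x) * (M (r n) x - g x))
         \<le> \<bar>Z\<bar> * Cf' * (LINT x|lebesgue. \<bar>M (r n) x - g x\<bar>)"
      proof (intro always_eventually allI)
        fix n
        have "norm (LINT x|lebesgue. \<zeta> x * f' (U (r n) x) * (M (r n) x - g x))
          \<le> (LINT x|lebesgue. \<bar>Z\<bar> * Cf' * \<bar>M (r n) x - g x\<bar>)"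
        proof (intro norm_integral_le AE_I2)
          show "integrable lebesgue (\<lambda>x. \<zeta> x * f' (U (r n) x) * (M (r n) x - g x))"
            using iM ig UB by (intro ibd) auto
          show "norm (\<zeta> x * f' (U (r n) x) * (M (r n) x - g x)) \<le> \<bar>Z\<bar> * Cf' * \<bar>M (r n) x - g x\<bar>" for x
            by (auto simp: abs_mult intro!: mult_right_mono mult_mono C UB Z)
        qed (use iM ig in auto)
        then show "norm (LINT x|lebesgue. \<zeta> x * f' (U (r n) x) * (M (r n) x - g x))
         \<le> \<bar>Z\<bar> * Cf' * (LINT x|lebesgue. \<bar>M (r n) x - g x\<bar>)" by simp
      qed
      have "(\<lambda>n. LINT x|lebesgue. \<bar>M (r n) x - g x\<bar>) \<longlonglongrightarrow> 0"
        using LIMSEQ_subseq_LIMSEQ[OF mollify_tendsto_L1[OF ig] r(1)] by (simp add: o_def M_def)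
      from tendsto_mult_right_zero[OF this] show "(\<lambda>n. \<bar>Z\<bar> * Cf' * (LINT x|lebesgue. \<bar>M (r n) x - g x\<bar>)) \<longlonglongrightarrow> 0" .
    qed
    have "(LINT x|lebesgue. f (U (r n) x) * (D\<zeta> x \<bullet> b)) =
      - ((LINT x|lebesgue. \<zeta> x * f' (U (r n) x) * (M (r n) x - g x)) + (LINT x|lebesgue. \<zeta> x * f' (U (r n) x) * g x))" for n
    proof -
      have "integrable lebesgue (\<lambda>x. \<zeta> x * f' (U (r n) x) * (M (r n) x - g x))"
        "integrable lebesgue (\<lambda>x. \<zeta> x * f' (U (r n) x) * g x)"
        using iM ig UB by (auto intro!: ibd)
      from Bochner_Integration.integral_add[OF this] A1[of "r n"] show ?thesis
        by (simp add: algebra_simps)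
    qed
    then have "(\<lambda>n. LINT x|lebesgue. f (U (r n) x) * (D\<zeta> x \<bullet> b)) \<longlonglongrightarrow> - (0 + (LINT x|lebesgue. \<zeta> x * f' (u x) * g x))"
      using tendsto_minus[OF tendsto_add[OF L3 L2]] by simp
    with L1 have "(LINT x|lebesgue. f (u x) * (D\<zeta> x \<bullet> b)) = - (0 + (LINT x|lebesgue. \<zeta> x * f' (u x) * g x))"
      by (rule LIMSEQ_unique)
    then show ?thesis by (simp add: g_def)
  qed
  show ?thesis
  proof (rule euclidean_eqI)
    fix b :: 'a
    have "AE x in lebesgue. \<bar>f (u x)\<bar> \<le> Cf" using uB by eventually_elim (rule C)
    then have i1: "integrable lebesgue (\<lambda>x. f (u x) *\<^sub>R D\<zeta> x)"
      by (intro integrable_scaleR_bounded[OF iD]) auto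
    have "AE x in lebesgue. \<bar>\<zeta> x * f' (u x)\<bar> \<le> \<bar>Z\<bar> * Cf'"
      using uB by eventually_elim (auto simp: abs_mult intro!: mult_mono Z C)
    then have i2: "integrable lebesgue (\<lambda>x. (\<zeta> x * f' (u x)) *\<^sub>R G x)"
      by (intro integrable_scaleR_bounded[OF G]) auto
    then have i2: "integrable lebesgue (\<lambda>x. \<zeta> x *\<^sub>R f' (u x) *\<^sub>R G x)" by (simp only: scaleR_scaleR)
    show "(LINT x|lebesgue. f (u x) *\<^sub>R D\<zeta> x) \<bullet> b = - (LINT x|lebesgue. \<zeta> x *\<^sub>R f' (u x) *\<^sub>R G x) \<bullet> b"
      using comp[of b] by (simp only: inner_minus_left LINT_inner[OF i1] LINT_inner[OF i2] inner_scaleR_left mult.assoc)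
  qed
qed

section \<open>Calculus of weak gradients\<close>

text \<open>In the variable \<open>s = |x|^2\<close> it is 1 for
  \<open>2 / n^2 \<le> s \<le> n^2\<close> and 0 for \<open>s \<le> 1 / n^2\<close> or
  \<open>s \<ge> 2 * n^2\<close>: it removes the origin and infinity at the reciprocal scales
  \<open>1 / n\<close> and \<open>n\<close>.\<close>

definition annular_cutoff :: "real \<Rightarrow> real \<Rightarrow> real" where
  "annular_cutoff n s = smooth_step (n\<^sup>2 * s - 1) * smooth_step (2 - s / n\<^sup>2)"

definition annular_cutoff_deriv :: "real \<Rightarrow> real \<Rightarrow> real" where
  "annular_cutoff_deriv n s = smooth_step (n\<^sup>2 * s - 1) * (smooth_step_deriv (2 - s / n\<^sup>2) * (- 1 / n\<^sup>2)) + smooth_step_deriv (n\<^sup>2 * s - 1) * n\<^sup>2 * smooth_step (2 - s / n\<^sup>2)"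

lemma DERIV_cut: "(annular_cutoff n has_real_derivative annular_cutoff_deriv n s) (at s)"
proof -
  have 1: "((\<lambda>s. smooth_step (n\<^sup>2 * s - 1)) has_real_derivative smooth_step_deriv (n\<^sup>2 * s - 1) * n\<^sup>2) (at s)"
    by (rule DERIV_chain2[OF DERIV_step]) (auto intro!: derivative_eq_intros)
  have 2: "((\<lambda>s. smooth_step (2 - s / n\<^sup>2)) has_real_derivative smooth_step_deriv (2 - s / n\<^sup>2) * (- 1 / n\<^sup>2)) (at s)"
    by (rule DERIV_chain2[OF DERIV_step], rule DERIV_cong[OF DERIV_diff[OF DERIV_const DERIV_cdivide[OF DERIV_ident]]]) simp
  show ?thesis
    unfolding annular_cutoff_def[abs_def] annular_cutoff_deriv_def by (rule DERIV_cong[OF DERIV_mult[OF 1 2]]) (simp only: ac_simps)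
qed

lemma continuous_on_dcut: "continuous_on S (annular_cutoff_deriv n)"
proof -
  have st: "continuous_on UNIV smooth_step"
    by (intro continuous_at_imp_continuous_on ballI DERIV_isCont[OF DERIV_step])
  have 1: "continuous_on UNIV (\<lambda>s. n\<^sup>2 * s - 1)" by (intro continuous_intros)
  have 2: "continuous_on UNIV (\<lambda>s. 2 - s / n\<^sup>2)" unfolding divide_inverse by (intro continuous_intros)
  have "continuous_on UNIV (annular_cutoff_deriv n)"
    unfolding annular_cutoff_deriv_def
    by (intro continuous_on_add continuous_on_mult continuous_on_const
        continuous_on_compose2[OF st 1] continuous_on_compose2[OF st 2]
        continuous_on_compose2[OF continuous_on_dstep[of UNIV] 1] continuous_on_compose2[OF continuous_on_dstep[of UNIV] 2] subset_UNIV)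
  then show ?thesis by (rule continuous_on_subset) auto
qed

lemma cut_bounds: "0 \<le> annular_cutoff n s" "annular_cutoff n s \<le> 1"
  using step_bounds[of "n\<^sup>2 * s - 1"] step_bounds[of "2 - s / n\<^sup>2"] by (auto simp: annular_cutoff_def intro!: mult_nonneg_nonneg mult_le_one)

lemma cut_eq_0: "n > 0 \<Longrightarrow> n\<^sup>2 * s \<le> 1 \<or> 2 * n\<^sup>2 \<le> s \<Longrightarrow> annular_cutoff n s = 0"
  by (auto simp: annular_cutoff_def step_eq field_simps)

lemma cut_eq_1: "n > 0 \<Longrightarrow> 2 \<le> n\<^sup>2 * s \<Longrightarrow> s \<le> n\<^sup>2 \<Longrightarrow> annular_cutoff n s = 1"
  and dcut_eq_0: "n > 0 \<Longrightarrow> 2 \<le> n\<^sup>2 * s \<Longrightarrow> s \<le> n\<^sup>2 \<Longrightarrow> annular_cutoff_deriv n s = 0"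
  by (auto simp: annular_cutoff_def annular_cutoff_deriv_def step_eq dstep_eq field_simps)

text \<open>Scale invariance: each step has its derivative where the rescaled variable
  \<open>n^2 * s\<close> or \<open>s / n^2\<close> is at most 2, and multiplication by
  \<open>s\<close> cancels the scale. Each of the two contributions is at most
  \<open>2 * M\<close>.\<close>

lemma dcut_bounded:
  obtains C where "C > 0" "\<And>n s. n > 0 \<Longrightarrow> s \<ge> 0 \<Longrightarrow> \<bar>s * annular_cutoff_deriv n s\<bar> \<le> C"
proof -
  obtain M where M: "M > 0" "\<And>t. \<bar>smooth_step_deriv t\<bar> \<le> M" using dstep_bounded by blast
  have "\<bar>s * annular_cutoff_deriv n s\<bar> \<le> 4 * M" if n: "n > 0" and s: "s \<ge> 0" for n s
  proof -
    have st: "\<bar>smooth_step t\<bar> \<le> 1" for t using step_bounds[of t] by auto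
    have key: "\<bar>y * smooth_step_deriv z\<bar> \<le> 2 * M" if "y \<ge> 0" "y > 2 \<Longrightarrow> smooth_step_deriv z = 0" for y z
      using that M(1) M(2)[of z] by (cases "y > 2") (auto simp: abs_mult intro!: mult_mono)
    have 1: "\<bar>(s / n\<^sup>2) * smooth_step_deriv (2 - s / n\<^sup>2)\<bar> \<le> 2 * M"
      using s n by (intro key) (auto intro: dstep_eq)
    have 2: "\<bar>(n\<^sup>2 * s) * smooth_step_deriv (n\<^sup>2 * s - 1)\<bar> \<le> 2 * M"
      using s n by (intro key) (auto intro: dstep_eq)
    have "s * annular_cutoff_deriv n s = - (smooth_step (n\<^sup>2 * s - 1) * ((s / n\<^sup>2) * smooth_step_deriv (2 - s / n\<^sup>2))) + ((n\<^sup>2 * s) * smooth_step_deriv (n\<^sup>2 * s - 1)) * smooth_step (2 - s / n\<^sup>2)"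
      by (simp add: annular_cutoff_deriv_def algebra_simps)
    then have "\<bar>s * annular_cutoff_deriv n s\<bar> \<le> \<bar>smooth_step (n\<^sup>2 * s - 1) * ((s / n\<^sup>2) * smooth_step_deriv (2 - s / n\<^sup>2))\<bar> + \<bar>((n\<^sup>2 * s) * smooth_step_deriv (n\<^sup>2 * s - 1)) * smooth_step (2 - s / n\<^sup>2)\<bar>"
      by linarith
    also have "\<dots> \<le> 1 * (2 * M) + (2 * M) * 1"
      unfolding abs_mult[of "smooth_step _"] abs_mult[of _ "smooth_step _"]
      using M(1) by (intro add_mono mult_mono 1 2 st) auto
    finally show ?thesis by simp
  qed
  then show ?thesis using M(1) by (intro that[of "4 * M"]) auto
qed

lemma C1_test_cut:
  assumes "n > 0"
  shows "C1_test_function (UNIV - {0::'a::euclidean_space}) (\<lambda>x. annular_cutoff n ((norm x)\<^sup>2)) (\<lambda>x. (2 * annular_cutoff_deriv n ((norm x)\<^sup>2)) *\<^sub>R x)"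
  unfolding C1_test_function_def
proof (intro conjI allI)
  show "GDERIV (\<lambda>x. annular_cutoff n ((norm x)\<^sup>2)) x :> (2 * annular_cutoff_deriv n ((norm x)\<^sup>2)) *\<^sub>R x" for x :: 'a
    by (rule GDERIV_radial[OF DERIV_cut])
  show "continuous_on UNIV (\<lambda>x::'a. (2 * annular_cutoff_deriv n ((norm x)\<^sup>2)) *\<^sub>R x)"
    by (intro continuous_intros continuous_on_compose2[OF continuous_on_dcut[of UNIV]]) auto
  show "\<exists>K. compact K \<and> K \<subseteq> UNIV - {0} \<and> (\<forall>x::'a. x \<notin> K \<longrightarrow> annular_cutoff n ((norm x)\<^sup>2) = 0)"
  proof (intro exI conjI allI impI)
    show "compact (cball 0 (2 * n) - ball (0::'a) (1 / n))" by (intro compact_diff) auto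
    show "cball 0 (2 * n) - ball (0::'a) (1 / n) \<subseteq> UNIV - {0}" using assms by auto
    fix x :: 'a assume "x \<notin> cball 0 (2 * n) - ball 0 (1 / n)"
    then consider "norm x \<ge> 2 * n" | "norm x \<le> 1 / n" by auto
    then show "annular_cutoff n ((norm x)\<^sup>2) = 0"
    proof cases
      case 1
      then have "(2 * n)\<^sup>2 \<le> (norm x)\<^sup>2" using assms by (intro power_mono) auto
      then have "2 * n\<^sup>2 \<le> (norm x)\<^sup>2" using zero_le_power2[of n] unfolding power_mult_distrib power2_eq_square[of 2] by linarith
      then show ?thesis using assms by (intro cut_eq_0) auto
    next
      case 2
      then have "(n * norm x)\<^sup>2 \<le> 1\<^sup>2" using assms by (intro power_mono) (auto simp: field_simps)
      then show ?thesis using assms by (intro cut_eq_0) (auto simp: power_mult_distrib)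
    qed
  qed
qed

lemma cut_near_compact:
  assumes "compact K" "K \<subseteq> UNIV - {0::'a::euclidean_space}"
  obtains m :: nat where "m > 0" "\<And>n x. n \<ge> m \<Longrightarrow> x \<in> K \<Longrightarrow> annular_cutoff (real n) ((norm x)\<^sup>2) = 1"
    "\<And>n x. n \<ge> m \<Longrightarrow> x \<in> K \<Longrightarrow> annular_cutoff_deriv (real n) ((norm x)\<^sup>2) = 0"
proof -
  have "bounded K" using assms compact_imp_bounded by blast
  then obtain R where R: "\<And>x. x \<in> K \<Longrightarrow> norm x \<le> R" unfolding bounded_iff by auto
  have "closed K" "0 \<notin> K" using assms compact_imp_closed by auto
  then obtain d where d: "d > 0" "\<And>x. x \<in> K \<Longrightarrow> d \<le> dist 0 x"
    using separate_point_closed[of K 0] by auto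
  obtain m :: nat where m: "real m > max R (2 / d)" using reals_Archimedean2 by blast
  have mpos: "m > 0" using m d(1) by (cases m) auto
  have *: "2 \<le> (real n)\<^sup>2 * (norm x)\<^sup>2 \<and> (norm x)\<^sup>2 \<le> (real n)\<^sup>2" if n: "n \<ge> m" and x: "x \<in> K" for n x
  proof
    have nm: "real m \<le> real n" using n by simp
    have "norm x \<le> real n" using R[OF x] m nm by linarith
    then show "(norm x)\<^sup>2 \<le> (real n)\<^sup>2" by (intro power_mono) auto
    have "2 \<le> real m * d" using m d(1) by (simp add: field_simps)
    also have "\<dots> \<le> real n * norm x" using d(2)[OF x] d(1) nm by (intro mult_mono) auto
    finally have "2\<^sup>2 \<le> (real n * norm x)\<^sup>2" by (intro power_mono) auto
    then show "2 \<le> (real n)\<^sup>2 * (norm x)\<^sup>2" by (simp add: power_mult_distrib)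
  qed
  show ?thesis
    by (rule that[OF mpos]) (use * mpos in \<open>auto intro!: cut_eq_1 dcut_eq_0\<close>)
qed

section \<open>Local integrability and the rules for weak gradients\<close>

lemma loc_integrable_times_continuous:
  fixes w :: "'a::euclidean_space \<Rightarrow> 'b::euclidean_space"
  assumes "loc_integrable U w" "continuous_on UNIV \<zeta>" "compact K" "K \<subseteq> U" "\<And>x. x \<notin> K \<Longrightarrow> \<zeta> x = 0"
  shows "integrable lebesgue (\<lambda>x. \<zeta> x *\<^sub>R w x)"
proof -
  have i: "integrable lebesgue (\<lambda>x. indicator K x *\<^sub>R w x)"
    using assms by (auto simp: loc_integrable_def set_integrable_def)
  have "bounded (\<zeta> ` K)" using assms(2,3) by (intro compact_imp_bounded compact_continuous_image) (auto intro: continuous_on_subset)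
  then obtain Z where Z: "\<And>x. x \<in> K \<Longrightarrow> \<bar>\<zeta> x\<bar> \<le> Z" unfolding bounded_iff by auto
  have Z: "\<bar>\<zeta> x\<bar> \<le> \<bar>Z\<bar>" for x using Z[of x] assms(5)[of x] by (cases "x \<in> K") auto
  have "integrable lebesgue (\<lambda>x. \<zeta> x *\<^sub>R (indicator K x *\<^sub>R w x))"
    by (rule integrable_scaleR_bounded[OF i borel_measurable_lebesgue_continuous[OF assms(2)] AE_I2[OF Z]])
  moreover have "\<zeta> x *\<^sub>R (indicator K x *\<^sub>R w x) = \<zeta> x *\<^sub>R w x" for x
    using assms(5)[of x] by (cases "x \<in> K") auto
  ultimately show ?thesis by (simp only:)
qed

lemma loc_integrable_real_times_continuous:
  fixes w :: "'a::euclidean_space \<Rightarrow> real" and \<zeta> :: "'a \<Rightarrow> 'b::euclidean_space"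
  assumes "loc_integrable U w" "continuous_on UNIV \<zeta>" "compact K" "K \<subseteq> U" "\<And>x. x \<notin> K \<Longrightarrow> \<zeta> x = 0"
  shows "integrable lebesgue (\<lambda>x. w x *\<^sub>R \<zeta> x)"
proof -
  have "integrable lebesgue (\<lambda>x. norm (\<zeta> x) *\<^sub>R w x)"
    by (rule loc_integrable_times_continuous[OF assms(1) _ assms(3,4)]) (auto intro!: continuous_intros assms)
  moreover have "(\<lambda>x. w x *\<^sub>R \<zeta> x) \<in> borel_measurable lebesgue"
  proof -
    have "integrable lebesgue (\<lambda>x. indicator K x *\<^sub>R w x)"
      using assms by (auto simp: loc_integrable_def set_integrable_def)
    then have [measurable]: "(\<lambda>x. indicator K x *\<^sub>R w x) \<in> borel_measurable lebesgue" by auto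
    have [measurable]: "\<zeta> \<in> borel_measurable lebesgue" by (rule borel_measurable_lebesgue_continuous[OF assms(2)])
    have "(\<lambda>x. (indicator K x *\<^sub>R w x) *\<^sub>R \<zeta> x) \<in> borel_measurable lebesgue" by measurable
    moreover have "(indicator K x *\<^sub>R w x) *\<^sub>R \<zeta> x = w x *\<^sub>R \<zeta> x" for x
      using assms(5)[of x] by (cases "x \<in> K") auto
    ultimately show ?thesis by (simp only:)
  qed
  ultimately show ?thesis
    by (rule Bochner_Integration.integrable_bound) (auto simp: abs_mult)
qed

lemma C1_test_LINT:
  assumes "C1_test_function U \<zeta> D\<zeta>"
  shows "(LINT x:U|lebesgue. u x *\<^sub>R D\<zeta> x) = (LINT x|lebesgue. u x *\<^sub>R D\<zeta> x)"
    and "(LINT x:U|lebesgue. \<zeta> x *\<^sub>R v x) = (LINT x|lebesgue. \<zeta> x *\<^sub>R v x)"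
proof -
  obtain K where K: "K \<subseteq> U" "\<And>x. x \<notin> K \<Longrightarrow> \<zeta> x = 0" "\<And>x. x \<notin> K \<Longrightarrow> D\<zeta> x = 0"
    using C1_test_support[OF assms] by metis
  have "indicator U x *\<^sub>R u x *\<^sub>R D\<zeta> x = u x *\<^sub>R D\<zeta> x" "indicator U x *\<^sub>R \<zeta> x *\<^sub>R v x = \<zeta> x *\<^sub>R v x" for x
    using K by (cases "x \<in> U"; auto)+
  then show "(LINT x:U|lebesgue. u x *\<^sub>R D\<zeta> x) = (LINT x|lebesgue. u x *\<^sub>R D\<zeta> x)"
    "(LINT x:U|lebesgue. \<zeta> x *\<^sub>R v x) = (LINT x|lebesgue. \<zeta> x *\<^sub>R v x)"
    unfolding set_lebesgue_integral_def by (simp_all only:)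
qed

lemma weak_gradient_iff:
  "weak_gradient U u Du \<longleftrightarrow> loc_integrable U u \<and> loc_integrable U Du \<and>
     (\<forall>\<zeta> D\<zeta>. C1_test_function U \<zeta> D\<zeta> \<longrightarrow>
        (LINT x|lebesgue. u x *\<^sub>R D\<zeta> x) = - (LINT x|lebesgue. \<zeta> x *\<^sub>R Du x))"
  unfolding weak_gradient_def by (auto simp: C1_test_LINT)

lemma loc_integrable_continuous:
  fixes u :: "'a::euclidean_space \<Rightarrow> 'b::euclidean_space"
  assumes "continuous_on U u"
  shows "loc_integrable U u"
  unfolding loc_integrable_def set_integrable_def
proof (intro allI impI)
  fix K assume K: "compact K" "K \<subseteq> U"
  have "integrable lborel (\<lambda>x. indicator K x *\<^sub>R u x)"
    using assms K by (intro borel_integrable_compact) (auto intro: continuous_on_subset)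
  moreover from this have "(\<lambda>x. indicator K x *\<^sub>R u x) \<in> borel_measurable lborel" by auto
  ultimately show "integrable lebesgue (\<lambda>x. indicator K x *\<^sub>R u x)"
    by (subst integrable_completion)
qed

text \<open>The product of \<open>u\<close> with a test function is again a test function, so its
  gradient integrates to zero.\<close>

lemma weak_gradient_classical:
  fixes u :: "'a::euclidean_space \<Rightarrow> real"
  assumes "open U" "\<And>x. x \<in> U \<Longrightarrow> GDERIV u x :> Du x" "continuous_on U Du"
  shows "weak_gradient U u Du"
  unfolding weak_gradient_iff
proof (intro conjI allI impI)
  have "continuous_on U u"
    using assms(2) unfolding gderiv_def by (meson continuous_at_imp_continuous_on has_derivative_continuous)
  then show lu: "loc_integrable U u" by (rule loc_integrable_continuous)
  show lD: "loc_integrable U Du" by (rule loc_integrable_continuous[OF assms(3)])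
  fix \<zeta> D\<zeta> assume test: "C1_test_function U \<zeta> D\<zeta>"
  obtain K where K: "compact K" "K \<subseteq> U" "\<And>x. x \<notin> K \<Longrightarrow> \<zeta> x = 0" "\<And>x. x \<notin> K \<Longrightarrow> D\<zeta> x = 0"
    using C1_test_support[OF test] by metis
  have z: "(LINT x|lebesgue. u x *\<^sub>R D\<zeta> x + \<zeta> x *\<^sub>R Du x) = 0"
    by (rule integral_gradient_zero[OF C1_test_mult[OF assms test]])
  have i1: "integrable lebesgue (\<lambda>x. u x *\<^sub>R D\<zeta> x)"
    using test by (intro loc_integrable_real_times_continuous[OF lu _ K(1,2,4)]) (auto simp: C1_test_function_def)
  have i2: "integrable lebesgue (\<lambda>x. \<zeta> x *\<^sub>R Du x)"
    by (rule loc_integrable_times_continuous[OF lD C1_test_continuous[OF test] K(1,2,3)])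
  show "(LINT x|lebesgue. u x *\<^sub>R D\<zeta> x) = - (LINT x|lebesgue. \<zeta> x *\<^sub>R Du x)"
    using z by (simp only: Bochner_Integration.integral_add[OF i1 i2] add_eq_0_iff2)
qed

lemma loc_integrable_mult_continuous:
  fixes w :: "'a::euclidean_space \<Rightarrow> 'b::euclidean_space"
  assumes "loc_integrable U w" "continuous_on UNIV \<eta>"
  shows "loc_integrable U (\<lambda>x. \<eta> x *\<^sub>R w x)"
  unfolding loc_integrable_def set_integrable_def
proof (intro allI impI)
  fix K assume K: "compact K" "K \<subseteq> U"
  have i: "integrable lebesgue (\<lambda>x. indicator K x *\<^sub>R w x)"
    using assms K by (auto simp: loc_integrable_def set_integrable_def)
  have "bounded (\<eta> ` K)" using assms(2) K by (intro compact_imp_bounded compact_continuous_image) (auto intro: continuous_on_subset)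
  then obtain Z where Z: "\<And>x. x \<in> K \<Longrightarrow> \<bar>\<eta> x\<bar> \<le> Z" unfolding bounded_iff by auto
  have [measurable]: "\<eta> \<in> borel_measurable lebesgue" by (rule borel_measurable_lebesgue_continuous[OF assms(2)])
  have KK: "K \<in> sets lebesgue" using K by (simp add: compact_imp_closed lmeasurable_compact fmeasurableD)
  have "integrable lebesgue (\<lambda>x. (indicator K x * \<eta> x) *\<^sub>R (indicator K x *\<^sub>R w x))"
  proof (rule integrable_scaleR_bounded[OF i, where C="\<bar>Z\<bar>"])
    show "AE x in lebesgue. \<bar>indicator K x * \<eta> x\<bar> \<le> \<bar>Z\<bar>"
    proof (rule AE_I2)
      fix x show "\<bar>indicator K x * \<eta> x\<bar> \<le> \<bar>Z\<bar>" using Z[of x] by (cases "x \<in> K") auto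
    qed
  qed (use KK in measurable)
  moreover have "(indicator K x * \<eta> x) *\<^sub>R (indicator K x *\<^sub>R w x) = indicator K x *\<^sub>R \<eta> x *\<^sub>R w x" for x
    by (cases "x \<in> K") auto
  ultimately show "integrable lebesgue (\<lambda>x. indicator K x *\<^sub>R \<eta> x *\<^sub>R w x)" by (simp only:)
qed

text \<open>The weak identity for \<open>u\<close> is applied to the test function
  \<open>\<eta> * \<zeta>\<close>; the Leibniz term with \<open>D\<eta>\<close> moves to the other
  side.\<close>

lemma weak_gradient_mult:
  fixes u :: "'a::euclidean_space \<Rightarrow> real"
  assumes "open U" "weak_gradient U u Du" and \<eta>: "\<And>x. GDERIV \<eta> x :> D\<eta> x" "continuous_on UNIV D\<eta>"
  shows "weak_gradient U (\<lambda>x. \<eta> x * u x) (\<lambda>x. \<eta> x *\<^sub>R Du x + u x *\<^sub>R D\<eta> x)"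
  unfolding weak_gradient_iff
proof (intro conjI allI impI)
  have lu: "loc_integrable U u" and lD: "loc_integrable U Du" using assms(2) by (auto simp: weak_gradient_def)
  have c: "continuous_on UNIV \<eta>"
    using \<eta>(1) unfolding gderiv_def by (meson continuous_at_imp_continuous_on has_derivative_continuous)
  show "loc_integrable U (\<lambda>x. \<eta> x * u x)" using loc_integrable_mult_continuous[OF lu c] by simp
  have l2: "loc_integrable U (\<lambda>x. u x *\<^sub>R D\<eta> x)"
  proof -
    \<comment> \<open>The vector field \<open>u D\<eta>\<close> is treated one component at a time,
      each being a continuous scalar times \<open>u\<close>.\<close>
    have "set_integrable lebesgue K (\<lambda>x. \<Sum>b\<in>Basis. ((D\<eta> x \<bullet> b) *\<^sub>R u x) *\<^sub>R b)" if K: "compact K" "K \<subseteq> U" for K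
    proof -
      have "integrable lebesgue (\<lambda>x. indicator K x *\<^sub>R ((D\<eta> x \<bullet> b) *\<^sub>R u x))" for b
      proof -
        have "loc_integrable U (\<lambda>x. (D\<eta> x \<bullet> b) *\<^sub>R u x)"
          by (rule loc_integrable_mult_continuous[OF lu]) (intro continuous_intros \<eta>(2))
        then show ?thesis using K unfolding loc_integrable_def set_integrable_def by blast
      qed
      then have "integrable lebesgue (\<lambda>x. \<Sum>b\<in>Basis. (indicator K x *\<^sub>R ((D\<eta> x \<bullet> b) *\<^sub>R u x)) *\<^sub>R b)"
        by (intro Bochner_Integration.integrable_sum integrable_scaleR_left) auto
      then show ?thesis by (simp add: set_integrable_def scaleR_sum_right)
    qed
    note l = this
    have eq: "(\<Sum>b\<in>Basis. ((D\<eta> x \<bullet> b) *\<^sub>R u x) *\<^sub>R b) = u x *\<^sub>R D\<eta> x" for x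
    proof -
      have "(\<Sum>b\<in>Basis. ((D\<eta> x \<bullet> b) *\<^sub>R u x) *\<^sub>R b) = u x *\<^sub>R (\<Sum>b\<in>Basis. (D\<eta> x \<bullet> b) *\<^sub>R b)"
        by (simp add: scaleR_sum_right mult.commute)
      then show ?thesis by (simp add: euclidean_representation)
    qed
    show ?thesis using l unfolding loc_integrable_def eq by blast
  qed
  show "loc_integrable U (\<lambda>x. \<eta> x *\<^sub>R Du x + u x *\<^sub>R D\<eta> x)"
    using l2 loc_integrable_mult_continuous[OF lD c]
    by (auto simp: loc_integrable_def set_integrable_def scaleR_add_right)
  fix \<zeta> D\<zeta> assume test: "C1_test_function U \<zeta> D\<zeta>"
  obtain K where K: "compact K" "K \<subseteq> U" "\<And>x. x \<notin> K \<Longrightarrow> \<zeta> x = 0" "\<And>x. x \<notin> K \<Longrightarrow> D\<zeta> x = 0"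
    using C1_test_support[OF test] by metis
  have c\<zeta>: "continuous_on UNIV \<zeta>" by (rule C1_test_continuous[OF test])
  have cD: "continuous_on UNIV D\<zeta>" using test by (simp add: C1_test_function_def)
  have "C1_test_function U (\<lambda>x. \<eta> x * \<zeta> x) (\<lambda>x. \<eta> x *\<^sub>R D\<zeta> x + \<zeta> x *\<^sub>R D\<eta> x)"
    by (rule C1_test_mult[OF assms(1) \<eta>(1) _ test]) (auto intro: continuous_on_subset[OF \<eta>(2)])
  then have *: "(LINT x|lebesgue. u x *\<^sub>R (\<eta> x *\<^sub>R D\<zeta> x + \<zeta> x *\<^sub>R D\<eta> x)) = - (LINT x|lebesgue. (\<eta> x * \<zeta> x) *\<^sub>R Du x)"
    using assms(2) unfolding weak_gradient_iff by blast
  have i1: "integrable lebesgue (\<lambda>x. u x *\<^sub>R (\<eta> x *\<^sub>R D\<zeta> x))"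
    by (rule loc_integrable_real_times_continuous[OF lu _ K(1,2)]) (auto intro!: continuous_intros c cD simp: K)
  have i2: "integrable lebesgue (\<lambda>x. u x *\<^sub>R (\<zeta> x *\<^sub>R D\<eta> x))"
    by (rule loc_integrable_real_times_continuous[OF lu _ K(1,2)]) (auto intro!: continuous_intros c\<zeta> \<eta>(2) simp: K)
  have i3: "integrable lebesgue (\<lambda>x. (\<eta> x * \<zeta> x) *\<^sub>R Du x)"
    by (rule loc_integrable_times_continuous[OF lD _ K(1,2)]) (auto intro!: continuous_intros c c\<zeta> simp: K)
  have "(LINT x|lebesgue. (\<eta> x * u x) *\<^sub>R D\<zeta> x) = (LINT x|lebesgue. u x *\<^sub>R (\<eta> x *\<^sub>R D\<zeta> x))"
    by (simp add: mult.commute)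
  also have "\<dots> = - (LINT x|lebesgue. (\<eta> x * \<zeta> x) *\<^sub>R Du x) - (LINT x|lebesgue. u x *\<^sub>R (\<zeta> x *\<^sub>R D\<eta> x))"
    using * Bochner_Integration.integral_add[OF i1 i2] by (simp only: scaleR_add_right eq_diff_eq)
  also have "\<dots> = - (LINT x|lebesgue. (\<eta> x * \<zeta> x) *\<^sub>R Du x + u x *\<^sub>R (\<zeta> x *\<^sub>R D\<eta> x))"
    by (simp only: Bochner_Integration.integral_add[OF i3 i2] minus_add_distrib diff_conv_add_uminus)
  also have "(\<lambda>x. (\<eta> x * \<zeta> x) *\<^sub>R Du x + u x *\<^sub>R (\<zeta> x *\<^sub>R D\<eta> x)) = (\<lambda>x. \<zeta> x *\<^sub>R (\<eta> x *\<^sub>R Du x + u x *\<^sub>R D\<eta> x))"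
    by (simp add: fun_eq_iff scaleR_add_right mult.commute)
  finally show "(LINT x|lebesgue. (\<eta> x * u x) *\<^sub>R D\<zeta> x) = - (LINT x|lebesgue. \<zeta> x *\<^sub>R (\<eta> x *\<^sub>R Du x + u x *\<^sub>R D\<eta> x))" .
qed

lemma compact_in_sets_lebesgue: "compact K \<Longrightarrow> K \<in> sets lebesgue"
  by (simp add: fmeasurableD lmeasurable_compact)

lemma loc_integrable_comp_scaleR:
  fixes w :: "'a::euclidean_space \<Rightarrow> 'b::euclidean_space" and u :: "'a \<Rightarrow> real"
  assumes u: "loc_integrable U u" and w: "loc_integrable U w"
    and bnd: "\<And>K. compact K \<Longrightarrow> K \<subseteq> U \<Longrightarrow> \<exists>C. AE x in lebesgue. x \<in> K \<longrightarrow> \<bar>u x\<bar> \<le> C"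
    and g: "continuous_on UNIV g"
  shows "loc_integrable U (\<lambda>x. g (u x) *\<^sub>R w x)"
  unfolding loc_integrable_def set_integrable_def
proof (intro allI impI)
  fix K assume K: "compact K" "K \<subseteq> U"
  have iu: "integrable lebesgue (\<lambda>x. indicator K x *\<^sub>R u x)" and iw: "integrable lebesgue (\<lambda>x. indicator K x *\<^sub>R w x)"
    using u w K by (auto simp: loc_integrable_def set_integrable_def)
  have [measurable]: "(\<lambda>x. indicator K x *\<^sub>R u x) \<in> borel_measurable lebesgue" using iu by auto
  have [measurable]: "g \<in> borel_measurable borel" using g by (rule borel_measurable_continuous_onI)
  obtain C where C: "AE x in lebesgue. x \<in> K \<longrightarrow> \<bar>u x\<bar> \<le> C" using bnd[OF K] by blast
  have "bounded (g ` {-\<bar>C\<bar>..\<bar>C\<bar>})"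
    using g by (auto intro!: compact_imp_bounded compact_continuous_image intro: continuous_on_subset)
  then obtain M where M: "\<forall>t\<in>{-\<bar>C\<bar>..\<bar>C\<bar>}. norm (g t) \<le> M" unfolding bounded_iff by auto
  \<comment> \<open>Measurability is at hand only for \<open>u\<close> multiplied by the indicator
    of \<open>K\<close>, so \<open>g\<close> is composed with that product. On \<open>K\<close>
    nothing changes, and off \<open>K\<close> the factor \<open>w\<close> is cut off as
    well.\<close>
  have "integrable lebesgue (\<lambda>x. g (indicator K x *\<^sub>R u x) *\<^sub>R (indicator K x *\<^sub>R w x))"
  proof (rule integrable_scaleR_bounded[OF iw])
    show "AE x in lebesgue. \<bar>g (indicator K x *\<^sub>R u x)\<bar> \<le> M"
      using C
    proof eventually_elim
      case (elim x)
      have "indicator K x *\<^sub>R u x \<in> {-\<bar>C\<bar>..\<bar>C\<bar>}" using elim by (cases "x \<in> K") (auto simp: abs_le_iff)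
      then show ?case using M by auto
    qed
  qed measurable
  moreover have "g (indicator K x *\<^sub>R u x) *\<^sub>R (indicator K x *\<^sub>R w x) = indicator K x *\<^sub>R g (u x) *\<^sub>R w x" for x
    by (cases "x \<in> K") auto
  ultimately show "integrable lebesgue (\<lambda>x. indicator K x *\<^sub>R g (u x) *\<^sub>R w x)" by (simp only:)
qed

text \<open>Multiplication by a cutoff that is 1 on the support of the test function produces a
  bounded integrable function on the whole space, to which the global rule applies. On that support
  neither the function nor its gradient is changed.\<close>

lemma weak_gradient_chain:
  fixes u :: "'a::euclidean_space \<Rightarrow> real"
  assumes wg: "weak_gradient (UNIV - {0}) u Du"
    and bnd: "\<And>K. compact K \<Longrightarrow> K \<subseteq> UNIV - {0} \<Longrightarrow> \<exists>C. AE x in lebesgue. x \<in> K \<longrightarrow> \<bar>u x\<bar> \<le> C"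
    and f: "\<And>t. (f has_real_derivative f' t) (at t)" "continuous_on UNIV f'"
  shows "weak_gradient (UNIV - {0}) (\<lambda>x. f (u x)) (\<lambda>x. f' (u x) *\<^sub>R Du x)"
  unfolding weak_gradient_iff
proof (intro conjI allI impI)
  let ?U = "UNIV - {0::'a}"
  have lu: "loc_integrable ?U u" and lD: "loc_integrable ?U Du" using wg by (auto simp: weak_gradient_def)
  have cf: "continuous_on UNIV f" by (intro continuous_at_imp_continuous_on ballI DERIV_isCont[OF f(1)])
  have "loc_integrable ?U (\<lambda>x. f (u x) *\<^sub>R (1::real))"
    by (rule loc_integrable_comp_scaleR[OF lu _ bnd cf]) (auto intro!: loc_integrable_continuous)
  then show "loc_integrable ?U (\<lambda>x. f (u x))" by simp
  show "loc_integrable ?U (\<lambda>x. f' (u x) *\<^sub>R Du x)"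
    by (rule loc_integrable_comp_scaleR[OF lu lD bnd f(2)])
  fix \<zeta> D\<zeta> assume test: "C1_test_function ?U \<zeta> D\<zeta>"
  obtain K where K: "compact K" "K \<subseteq> ?U" "\<And>x. x \<notin> K \<Longrightarrow> \<zeta> x = 0" "\<And>x. x \<notin> K \<Longrightarrow> D\<zeta> x = 0"
    using C1_test_support[OF test] by metis
  obtain m :: nat where m: "m > 0" "\<And>x. x \<in> K \<Longrightarrow> annular_cutoff (real m) ((norm x)\<^sup>2) = 1" "\<And>x. x \<in> K \<Longrightarrow> annular_cutoff_deriv (real m) ((norm x)\<^sup>2) = 0"
    using cut_near_compact[OF K(1,2)] by (metis order_refl)
  define \<omega> where "\<omega> = (\<lambda>x::'a. annular_cutoff (real m) ((norm x)\<^sup>2))"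
  define D\<omega> where "D\<omega> = (\<lambda>x::'a. (2 * annular_cutoff_deriv (real m) ((norm x)\<^sup>2)) *\<^sub>R x)"
  have t\<omega>: "C1_test_function ?U \<omega> D\<omega>" unfolding \<omega>_def D\<omega>_def using m by (intro C1_test_cut) simp
  obtain L where L: "compact L" "L \<subseteq> ?U" "\<And>x. x \<notin> L \<Longrightarrow> \<omega> x = 0" "\<And>x. x \<notin> L \<Longrightarrow> D\<omega> x = 0"
    using C1_test_support[OF t\<omega>] by metis
  have c\<omega>: "continuous_on UNIV \<omega>" by (rule C1_test_continuous[OF t\<omega>])
  have cD\<omega>: "continuous_on UNIV D\<omega>" using t\<omega> by (simp add: C1_test_function_def)
  define v where "v = (\<lambda>x. \<omega> x * u x)"
  define G where "G = (\<lambda>x. \<omega> x *\<^sub>R Du x + u x *\<^sub>R D\<omega> x)"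
  have i\<omega>D: "integrable lebesgue (\<lambda>x. \<omega> x *\<^sub>R Du x)"
    by (rule loc_integrable_times_continuous[OF lD c\<omega> L(1,2,3)])
  have iuD: "integrable lebesgue (\<lambda>x. u x *\<^sub>R D\<omega> x)"
    by (rule loc_integrable_real_times_continuous[OF lu cD\<omega> L(1,2,4)])
  have "integrable lebesgue (\<lambda>x. \<omega> x *\<^sub>R u x)"
    by (rule loc_integrable_times_continuous[OF lu c\<omega> L(1,2,3)])
  then have iv: "integrable lebesgue v" by (simp add: v_def)
  have iG: "integrable lebesgue G" unfolding G_def by (rule Bochner_Integration.integrable_add[OF i\<omega>D iuD])
  obtain C where C: "AE x in lebesgue. x \<in> L \<longrightarrow> \<bar>u x\<bar> \<le> C" using bnd[OF L(1,2)] by blast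
  have vC: "AE x in lebesgue. \<bar>v x\<bar> \<le> \<bar>C\<bar>"
    using C
  proof eventually_elim
    case (elim x)
    show ?case
    proof (cases "x \<in> L")
      case True
      have "\<bar>v x\<bar> \<le> 1 * \<bar>C\<bar>"
        unfolding v_def abs_mult using True elim cut_bounds[of "real m" "(norm x)\<^sup>2"]
        by (intro mult_mono) (auto simp: \<omega>_def)
      then show ?thesis by simp
    qed (simp add: v_def L)
  qed
  \<comment> \<open>The cutoff vanishes near 0, so every test function on the whole space becomes
    admissible in the punctured one after multiplication by \<omega>.\<close>
  have weak: "(LINT x|lebesgue. v x *\<^sub>R D\<xi> x) = - (LINT x|lebesgue. \<xi> x *\<^sub>R G x)"
    if \<xi>: "C1_test_function UNIV \<xi> D\<xi>" for \<xi> D\<xi>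
  proof -
    have c\<xi>: "continuous_on UNIV \<xi>" by (rule C1_test_continuous[OF \<xi>])
    have cD\<xi>: "continuous_on UNIV D\<xi>" using \<xi> by (simp add: C1_test_function_def)
    have "C1_test_function ?U (\<lambda>x. \<xi> x * \<omega> x) (\<lambda>x. \<xi> x *\<^sub>R D\<omega> x + \<omega> x *\<^sub>R D\<xi> x)"
      by (rule C1_test_mult[OF _ _ _ t\<omega>]) (use \<xi> in \<open>auto simp: C1_test_function_def intro: continuous_on_subset\<close>)
    then have *: "(LINT x|lebesgue. u x *\<^sub>R (\<xi> x *\<^sub>R D\<omega> x + \<omega> x *\<^sub>R D\<xi> x)) = - (LINT x|lebesgue. (\<xi> x * \<omega> x) *\<^sub>R Du x)"
      using wg unfolding weak_gradient_iff by blast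
    have i1: "integrable lebesgue (\<lambda>x. u x *\<^sub>R (\<xi> x *\<^sub>R D\<omega> x))"
      by (rule loc_integrable_real_times_continuous[OF lu _ L(1,2)]) (auto intro!: continuous_intros c\<xi> cD\<omega> simp: L)
    have i2: "integrable lebesgue (\<lambda>x. u x *\<^sub>R (\<omega> x *\<^sub>R D\<xi> x))"
      by (rule loc_integrable_real_times_continuous[OF lu _ L(1,2)]) (auto intro!: continuous_intros c\<omega> cD\<xi> simp: L)
    have i3: "integrable lebesgue (\<lambda>x. (\<xi> x * \<omega> x) *\<^sub>R Du x)"
      by (rule loc_integrable_times_continuous[OF lD _ L(1,2)]) (auto intro!: continuous_intros c\<omega> c\<xi> simp: L)
    have "(LINT x|lebesgue. v x *\<^sub>R D\<xi> x) = (LINT x|lebesgue. u x *\<^sub>R (\<omega> x *\<^sub>R D\<xi> x))"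
      by (simp add: v_def mult.commute)
    also have "\<dots> = - (LINT x|lebesgue. (\<xi> x * \<omega> x) *\<^sub>R Du x) - (LINT x|lebesgue. u x *\<^sub>R (\<xi> x *\<^sub>R D\<omega> x))"
      using * Bochner_Integration.integral_add[OF i2 i1] by (simp only: scaleR_add_right eq_diff_eq add.commute)
    also have "\<dots> = - (LINT x|lebesgue. (\<xi> x * \<omega> x) *\<^sub>R Du x + u x *\<^sub>R (\<xi> x *\<^sub>R D\<omega> x))"
      by (simp only: Bochner_Integration.integral_add[OF i3 i1] minus_add_distrib diff_conv_add_uminus)
    also have "(\<lambda>x. (\<xi> x * \<omega> x) *\<^sub>R Du x + u x *\<^sub>R (\<xi> x *\<^sub>R D\<omega> x)) = (\<lambda>x. \<xi> x *\<^sub>R G x)"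
      by (simp add: fun_eq_iff G_def scaleR_add_right mult.commute)
    finally show ?thesis .
  qed
  have "(LINT x|lebesgue. f (v x) *\<^sub>R D\<zeta> x) = - (LINT x|lebesgue. \<zeta> x *\<^sub>R f' (v x) *\<^sub>R G x)"
    by (rule weak_chain_rule_UNIV[OF iv iG vC weak f C1_test_mono[OF test]]) auto
  moreover have "f (v x) *\<^sub>R D\<zeta> x = f (u x) *\<^sub>R D\<zeta> x" for x
    using K(4)[of x] m(2)[of x] by (cases "x \<in> K") (auto simp: v_def \<omega>_def)
  moreover have "\<zeta> x *\<^sub>R f' (v x) *\<^sub>R G x = \<zeta> x *\<^sub>R f' (u x) *\<^sub>R Du x" for x
    using K(3)[of x] m(2,3)[of x] by (cases "x \<in> K") (auto simp: v_def \<omega>_def G_def D\<omega>_def)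
  ultimately show "(LINT x|lebesgue. f (u x) *\<^sub>R D\<zeta> x) = - (LINT x|lebesgue. \<zeta> x *\<^sub>R f' (u x) *\<^sub>R Du x)"
    by (simp only:)
qed

section \<open>Integration by parts against radial fields across the origin\<close>

lemma AE_nonzero: "AE x in lebesgue. x \<noteq> (0::'a::euclidean_space)"
  by (rule AE_completion, rule AE_lborel_singleton)

lemma eventually_cut:
  assumes "x \<noteq> (0::'a::euclidean_space)"
  shows "\<forall>\<^sub>F n in sequentially. annular_cutoff (real (Suc n)) ((norm x)\<^sup>2) = 1"
    "\<forall>\<^sub>F n in sequentially. annular_cutoff_deriv (real (Suc n)) ((norm x)\<^sup>2) = 0"
proof -
  have "compact {x}" "{x} \<subseteq> UNIV - {0}" using assms by auto
  then obtain m :: nat where m: "\<And>n y. n \<ge> m \<Longrightarrow> y \<in> {x} \<Longrightarrow> annular_cutoff (real n) ((norm y)\<^sup>2) = 1"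
    "\<And>n y. n \<ge> m \<Longrightarrow> y \<in> {x} \<Longrightarrow> annular_cutoff_deriv (real n) ((norm y)\<^sup>2) = 0"
    by (rule cut_near_compact) blast
  show "\<forall>\<^sub>F n in sequentially. annular_cutoff (real (Suc n)) ((norm x)\<^sup>2) = 1"
    by (rule eventually_sequentiallyI[of m]) (rule m, simp_all)
  show "\<forall>\<^sub>F n in sequentially. annular_cutoff_deriv (real (Suc n)) ((norm x)\<^sup>2) = 0"
    by (rule eventually_sequentiallyI[of m]) (rule m, simp_all)
qed

text \<open>The origin is removable: the error produced by cutting off near \<open>0\<close> and near \<open>\<infinity>\<close> is
  dominated by \<open>\<bar>\<phi> G\<bar>\<close>, because \<open>s * annular_cutoff_deriv n s\<close> is bounded uniformly in \<open>n\<close>.\<close>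

lemma radial_integration_by_parts:
  fixes \<phi> :: "'a::euclidean_space \<Rightarrow> real" and D\<phi> :: "'a \<Rightarrow> 'a"
  assumes wg: "weak_gradient (UNIV - {0}) \<phi> D\<phi>"
    and G: "\<And>s. s > 0 \<Longrightarrow> (G has_real_derivative G' s) (at s)" "continuous_on {0<..} G'"
    and i1: "integrable lebesgue (\<lambda>x. \<phi> x * G ((norm x)\<^sup>2))"
    and i2: "integrable lebesgue (\<lambda>x. \<phi> x * (real DIM('a) * G ((norm x)\<^sup>2) + 2 * (norm x)\<^sup>2 * G' ((norm x)\<^sup>2)))"
    and i3: "integrable lebesgue (\<lambda>x. G ((norm x)\<^sup>2) * (x \<bullet> D\<phi> x))"
  shows "(LINT x|lebesgue. \<phi> x * (real DIM('a) * G ((norm x)\<^sup>2) + 2 * (norm x)\<^sup>2 * G' ((norm x)\<^sup>2)))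
    = - (LINT x|lebesgue. G ((norm x)\<^sup>2) * (x \<bullet> D\<phi> x))"
proof -
  let ?U = "UNIV - {0::'a}"
  \<comment> \<open>Off the origin, this is the divergence of the field
    \<open>G (|x|^2) x\<close>.\<close>
  define H where "H = (\<lambda>x::'a. real DIM('a) * G ((norm x)\<^sup>2) + 2 * (norm x)\<^sup>2 * G' ((norm x)\<^sup>2))"
  have lu: "loc_integrable ?U \<phi>" and lD: "loc_integrable ?U D\<phi>" using wg by (auto simp: weak_gradient_def)
  obtain C where C: "C > 0" "\<And>n s. n > 0 \<Longrightarrow> s \<ge> 0 \<Longrightarrow> \<bar>s * annular_cutoff_deriv n s\<bar> \<le> C" using dcut_bounded by blast
  have c1: "continuous_on UNIV (\<lambda>x::'a. annular_cutoff n ((norm x)\<^sup>2))" for n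
  proof -
    have "continuous_on UNIV (annular_cutoff n)" by (intro continuous_at_imp_continuous_on ballI DERIV_isCont[OF DERIV_cut])
    then show ?thesis by (rule continuous_on_compose2) (auto intro!: continuous_intros)
  qed
  have c2: "continuous_on UNIV (\<lambda>x::'a. (norm x)\<^sup>2 * annular_cutoff_deriv n ((norm x)\<^sup>2))" for n
    by (intro continuous_on_mult continuous_on_compose2[OF continuous_on_dcut[of UNIV]]) (auto intro!: continuous_intros)
  have icut: "integrable lebesgue (\<lambda>x. annular_cutoff n ((norm x)\<^sup>2) * h x)" if "integrable lebesgue h" for h :: "'a \<Rightarrow> real" and n
  proof -
    have "AE x::'a in lebesgue. \<bar>annular_cutoff n ((norm x)\<^sup>2)\<bar> \<le> 1" using cut_bounds by (intro AE_I2) simp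
    from integrable_scaleR_bounded[OF that borel_measurable_lebesgue_continuous[OF c1] this] show ?thesis by simp
  qed
  have idcut: "integrable lebesgue (\<lambda>x. ((norm x)\<^sup>2 * annular_cutoff_deriv (real (Suc n)) ((norm x)\<^sup>2)) * h x)" if "integrable lebesgue h" for h :: "'a \<Rightarrow> real" and n
  proof -
    have "AE x::'a in lebesgue. \<bar>(norm x)\<^sup>2 * annular_cutoff_deriv (real (Suc n)) ((norm x)\<^sup>2)\<bar> \<le> C" by (intro AE_I2 C(2)) auto
    from integrable_scaleR_bounded[OF that borel_measurable_lebesgue_continuous[OF c2] this] show ?thesis by simp
  qed
  have tend: "(\<lambda>n. LINT x|lebesgue. annular_cutoff (real (Suc n)) ((norm x)\<^sup>2) * h x) \<longlonglongrightarrow> (LINT x|lebesgue. h x)"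
    if h: "integrable lebesgue h" for h :: "'a \<Rightarrow> real"
  proof (rule integral_dominated_convergence[where w="\<lambda>x. \<bar>h x\<bar>"])
    show "AE x in lebesgue. (\<lambda>n. annular_cutoff (real (Suc n)) ((norm x)\<^sup>2) * h x) \<longlonglongrightarrow> h x"
      using AE_nonzero
    proof eventually_elim
      case (elim x)
      show ?case
        by (rule tendsto_eventually, rule eventually_mono[OF eventually_cut(1)[OF elim]]) simp
    qed
    show "AE x in lebesgue. norm (annular_cutoff (real (Suc n)) ((norm x)\<^sup>2) * h x) \<le> \<bar>h x\<bar>" for n
    proof (rule AE_I2)
      fix x :: 'a
      have "\<bar>annular_cutoff (real (Suc n)) ((norm x)\<^sup>2)\<bar> * \<bar>h x\<bar> \<le> 1 * \<bar>h x\<bar>"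
        using cut_bounds[of "real (Suc n)" "(norm x)\<^sup>2"] by (intro mult_right_mono) auto
      then show "norm (annular_cutoff (real (Suc n)) ((norm x)\<^sup>2) * h x) \<le> \<bar>h x\<bar>" by (simp add: abs_mult)
    qed
    show "(\<lambda>x. annular_cutoff (real (Suc n)) ((norm x)\<^sup>2) * h x) \<in> borel_measurable lebesgue" for n using icut[OF h] by blast
  qed (use h in auto)
  have tend0: "(\<lambda>n. LINT x|lebesgue. ((norm x)\<^sup>2 * annular_cutoff_deriv (real (Suc n)) ((norm x)\<^sup>2)) * h x) \<longlonglongrightarrow> 0"
    if h: "integrable lebesgue h" for h :: "'a \<Rightarrow> real"
  proof -
    have "(\<lambda>n. LINT x|lebesgue. ((norm x)\<^sup>2 * annular_cutoff_deriv (real (Suc n)) ((norm x)\<^sup>2)) * h x) \<longlonglongrightarrow> (LINT x::'a|lebesgue. 0)"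
    proof (rule integral_dominated_convergence[where w="\<lambda>x. C * \<bar>h x\<bar>"])
      show "AE x in lebesgue. (\<lambda>n. ((norm x)\<^sup>2 * annular_cutoff_deriv (real (Suc n)) ((norm x)\<^sup>2)) * h x) \<longlonglongrightarrow> 0"
        using AE_nonzero
      proof eventually_elim
        case (elim x)
        show ?case
          by (rule tendsto_eventually, rule eventually_mono[OF eventually_cut(2)[OF elim]]) simp
      qed
      show "AE x in lebesgue. norm (((norm x)\<^sup>2 * annular_cutoff_deriv (real (Suc n)) ((norm x)\<^sup>2)) * h x) \<le> C * \<bar>h x\<bar>" for n
        unfolding real_norm_def abs_mult[of _ "h _"] by (intro AE_I2 mult_right_mono C(2)) auto
      show "(\<lambda>x. ((norm x)\<^sup>2 * annular_cutoff_deriv (real (Suc n)) ((norm x)\<^sup>2)) * h x) \<in> borel_measurable lebesgue" for n using idcut[OF h] by blast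
    qed (use h in auto)
    then show ?thesis by simp
  qed
  have iH: "integrable lebesgue (\<lambda>x. \<phi> x * H x)" using i2 by (simp only: H_def)
  have smooth_step: "(LINT x|lebesgue. annular_cutoff n ((norm x)\<^sup>2) * (\<phi> x * H x))
      + 2 * (LINT x|lebesgue. ((norm x)\<^sup>2 * annular_cutoff_deriv n ((norm x)\<^sup>2)) * (\<phi> x * G ((norm x)\<^sup>2)))
      = - (LINT x|lebesgue. annular_cutoff n ((norm x)\<^sup>2) * (G ((norm x)\<^sup>2) * (x \<bullet> D\<phi> x)))" if n: "n = real (Suc k)" for n k
  proof -
    have npos: "n > 0" using n by simp
    \<comment> \<open>Component \<open>b\<close> of the radial field. Each component times the
      cutoff is a scalar test function, and summing the \<open>b\<close>-components of the resulting
      identities produces the divergence.\<close>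
    define \<eta> where "\<eta> = (\<lambda>b x::'a. G ((norm x)\<^sup>2) * (x \<bullet> b))"
    define D\<eta> where "D\<eta> = (\<lambda>b x::'a. G ((norm x)\<^sup>2) *\<^sub>R b + (x \<bullet> b) *\<^sub>R ((2 * G' ((norm x)\<^sup>2)) *\<^sub>R x))"
    have gd: "GDERIV (\<eta> b) x :> D\<eta> b x" if "x \<in> ?U" for b x
    proof -
      have "GDERIV (\<lambda>x. x \<bullet> b) x :> b" unfolding gderiv_def by (rule bounded_linear_imp_has_derivative[OF bounded_linear_inner_left])
      moreover have "GDERIV (\<lambda>x. G ((norm x)\<^sup>2)) x :> (2 * G' ((norm x)\<^sup>2)) *\<^sub>R x"
        using that by (intro GDERIV_radial G) auto
      ultimately show ?thesis unfolding \<eta>_def D\<eta>_def by (intro GDERIV_mult)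
    qed
    have cG: "continuous_on {0<..} G" by (intro continuous_at_imp_continuous_on ballI DERIV_isCont[OF G(1)]) auto
    have cD: "continuous_on ?U (D\<eta> b)" for b
      unfolding D\<eta>_def
      by (intro continuous_intros continuous_on_compose2[OF cG] continuous_on_compose2[OF G(2)]) auto
    define \<omega> where "\<omega> = (\<lambda>x::'a. annular_cutoff n ((norm x)\<^sup>2))"
    define D\<omega> where "D\<omega> = (\<lambda>x::'a. (2 * annular_cutoff_deriv n ((norm x)\<^sup>2)) *\<^sub>R x)"
    have t\<omega>: "C1_test_function ?U \<omega> D\<omega>" unfolding \<omega>_def D\<omega>_def using npos by (rule C1_test_cut)
    have t: "C1_test_function ?U (\<lambda>x. \<eta> b x * \<omega> x) (\<lambda>x. \<eta> b x *\<^sub>R D\<omega> x + \<omega> x *\<^sub>R D\<eta> b x)" for b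
      by (rule C1_test_mult[OF _ gd cD t\<omega>]) auto
    have tc: "continuous_on UNIV (\<lambda>x. \<eta> b x *\<^sub>R D\<omega> x + \<omega> x *\<^sub>R D\<eta> b x)" for b
      using t[of b] by (simp add: C1_test_function_def)
    have ia: "integrable lebesgue (\<lambda>x. \<phi> x *\<^sub>R (\<eta> b x *\<^sub>R D\<omega> x + \<omega> x *\<^sub>R D\<eta> b x))" for b
    proof -
      obtain L where L: "compact L" "L \<subseteq> ?U" "\<And>x. x \<notin> L \<Longrightarrow> \<eta> b x *\<^sub>R D\<omega> x + \<omega> x *\<^sub>R D\<eta> b x = 0"
        using C1_test_support[OF t[of b]] by metis
      show ?thesis by (rule loc_integrable_real_times_continuous[OF lu tc L])
    qed
    have ib: "integrable lebesgue (\<lambda>x. (\<eta> b x * \<omega> x) *\<^sub>R D\<phi> x)" for b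
    proof -
      obtain L where L: "compact L" "L \<subseteq> ?U" "\<And>x. x \<notin> L \<Longrightarrow> \<eta> b x * \<omega> x = 0"
        using C1_test_support[OF t[of b]] by metis
      show ?thesis by (rule loc_integrable_times_continuous[OF lD C1_test_continuous[OF t] L])
    qed
    have "(LINT x|lebesgue. \<phi> x *\<^sub>R (\<eta> b x *\<^sub>R D\<omega> x + \<omega> x *\<^sub>R D\<eta> b x)) = - (LINT x|lebesgue. (\<eta> b x * \<omega> x) *\<^sub>R D\<phi> x)" for b
      using wg t[of b] unfolding weak_gradient_iff by blast
    then have "(LINT x|lebesgue. (\<phi> x *\<^sub>R (\<eta> b x *\<^sub>R D\<omega> x + \<omega> x *\<^sub>R D\<eta> b x)) \<bullet> b) = - (LINT x|lebesgue. ((\<eta> b x * \<omega> x) *\<^sub>R D\<phi> x) \<bullet> b)" for b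
      by (simp only: LINT_inner[OF ia, symmetric] LINT_inner[OF ib, symmetric] inner_minus_left)
    then have "(\<Sum>b\<in>Basis. LINT x|lebesgue. (\<phi> x *\<^sub>R (\<eta> b x *\<^sub>R D\<omega> x + \<omega> x *\<^sub>R D\<eta> b x)) \<bullet> b)
      = (\<Sum>b\<in>Basis. - (LINT x|lebesgue. ((\<eta> b x * \<omega> x) *\<^sub>R D\<phi> x) \<bullet> b))" by (simp only:)
    then have "(LINT x|lebesgue. (\<Sum>b\<in>Basis. (\<phi> x *\<^sub>R (\<eta> b x *\<^sub>R D\<omega> x + \<omega> x *\<^sub>R D\<eta> b x)) \<bullet> b))
      = - (LINT x|lebesgue. (\<Sum>b\<in>Basis. ((\<eta> b x * \<omega> x) *\<^sub>R D\<phi> x) \<bullet> b))"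
      by (simp only: sum_negf Bochner_Integration.integral_sum[OF integrable_inner_left[OF ia]] Bochner_Integration.integral_sum[OF integrable_inner_left[OF ib]])
    \<comment> \<open>The gradient of the cutoff is parallel to \<open>x\<close>, so it contributes
      only the term with \<open>|x|^2\<close> times \<open>annular_cutoff_deriv\<close>, the one
      that vanishes in the limit.\<close>
    moreover have "(\<Sum>b\<in>Basis. (\<phi> x *\<^sub>R (\<eta> b x *\<^sub>R D\<omega> x + \<omega> x *\<^sub>R D\<eta> b x)) \<bullet> b)
        = annular_cutoff n ((norm x)\<^sup>2) * (\<phi> x * H x) + 2 * (((norm x)\<^sup>2 * annular_cutoff_deriv n ((norm x)\<^sup>2)) * (\<phi> x * G ((norm x)\<^sup>2)))" for x
    proof -
      have n2: "(norm x)\<^sup>2 = (\<Sum>b\<in>Basis. (x \<bullet> b) * (x \<bullet> b))"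
        unfolding power2_norm_eq_inner by (rule euclidean_inner)
      have "(\<phi> x *\<^sub>R (\<eta> b x *\<^sub>R D\<omega> x + \<omega> x *\<^sub>R D\<eta> b x)) \<bullet> b
        = \<phi> x * G ((norm x)\<^sup>2) * 2 * annular_cutoff_deriv n ((norm x)\<^sup>2) * ((x \<bullet> b) * (x \<bullet> b))
          + \<phi> x * \<omega> x * G ((norm x)\<^sup>2) + \<phi> x * \<omega> x * 2 * G' ((norm x)\<^sup>2) * ((x \<bullet> b) * (x \<bullet> b))" if "b \<in> Basis" for b
        using that by (simp add: \<eta>_def D\<omega>_def D\<eta>_def inner_add_left algebra_simps)
      then have "(\<Sum>b\<in>Basis. (\<phi> x *\<^sub>R (\<eta> b x *\<^sub>R D\<omega> x + \<omega> x *\<^sub>R D\<eta> b x)) \<bullet> b)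
        = (\<Sum>b\<in>(Basis::'a set). \<phi> x * G ((norm x)\<^sup>2) * 2 * annular_cutoff_deriv n ((norm x)\<^sup>2) * ((x \<bullet> b) * (x \<bullet> b))
          + \<phi> x * \<omega> x * G ((norm x)\<^sup>2) + \<phi> x * \<omega> x * 2 * G' ((norm x)\<^sup>2) * ((x \<bullet> b) * (x \<bullet> b)))"
        by (rule sum.cong[OF refl])
      also have "\<dots> = \<phi> x * G ((norm x)\<^sup>2) * 2 * annular_cutoff_deriv n ((norm x)\<^sup>2) * (norm x)\<^sup>2
          + real DIM('a) * (\<phi> x * \<omega> x * G ((norm x)\<^sup>2)) + \<phi> x * \<omega> x * 2 * G' ((norm x)\<^sup>2) * (norm x)\<^sup>2"
        unfolding sum.distrib sum_distrib_left[symmetric] n2[symmetric] by simp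
      finally show ?thesis by (simp add: \<omega>_def H_def algebra_simps)
    qed
    moreover have "(\<Sum>b\<in>Basis. ((\<eta> b x * \<omega> x) *\<^sub>R D\<phi> x) \<bullet> b) = annular_cutoff n ((norm x)\<^sup>2) * (G ((norm x)\<^sup>2) * (x \<bullet> D\<phi> x))" for x
    proof -
      have "(\<Sum>b\<in>Basis. ((\<eta> b x * \<omega> x) *\<^sub>R D\<phi> x) \<bullet> b) = \<omega> x * G ((norm x)\<^sup>2) * (\<Sum>b\<in>Basis. (x \<bullet> b) * (D\<phi> x \<bullet> b))"
        by (simp add: \<eta>_def sum_distrib_left mult_ac)
      then show ?thesis by (simp add: \<omega>_def euclidean_inner[symmetric] mult_ac)
    qed
    ultimately have "(LINT x|lebesgue. annular_cutoff n ((norm x)\<^sup>2) * (\<phi> x * H x) + 2 * (((norm x)\<^sup>2 * annular_cutoff_deriv n ((norm x)\<^sup>2)) * (\<phi> x * G ((norm x)\<^sup>2))))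
      = - (LINT x|lebesgue. annular_cutoff n ((norm x)\<^sup>2) * (G ((norm x)\<^sup>2) * (x \<bullet> D\<phi> x)))" by (simp only:)
    moreover have "integrable lebesgue (\<lambda>x. annular_cutoff n ((norm x)\<^sup>2) * (\<phi> x * H x))"
      by (rule icut[OF iH])
    moreover have "integrable lebesgue (\<lambda>x. ((norm x)\<^sup>2 * annular_cutoff_deriv n ((norm x)\<^sup>2)) * (\<phi> x * G ((norm x)\<^sup>2)))"
      unfolding n by (rule idcut[OF i1])
    ultimately show ?thesis
      by (simp only: Bochner_Integration.integral_add integrable_mult_right integral_mult_right_zero)
  qed
  have "(\<lambda>n. (LINT x|lebesgue. annular_cutoff (real (Suc n)) ((norm x)\<^sup>2) * (\<phi> x * H x))
      + 2 * (LINT x|lebesgue. ((norm x)\<^sup>2 * annular_cutoff_deriv (real (Suc n)) ((norm x)\<^sup>2)) * (\<phi> x * G ((norm x)\<^sup>2)))) \<longlonglongrightarrow> (LINT x|lebesgue. \<phi> x * H x) + 2 * 0"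
    by (intro tendsto_intros tend tend0 iH i1)
  moreover have "(\<lambda>n. - (LINT x|lebesgue. annular_cutoff (real (Suc n)) ((norm x)\<^sup>2) * (G ((norm x)\<^sup>2) * (x \<bullet> D\<phi> x)))) \<longlonglongrightarrow> - (LINT x|lebesgue. G ((norm x)\<^sup>2) * (x \<bullet> D\<phi> x))"
    by (intro tendsto_intros tend i3)
  ultimately have "(LINT x|lebesgue. \<phi> x * H x) + 2 * 0 = - (LINT x|lebesgue. G ((norm x)\<^sup>2) * (x \<bullet> D\<phi> x))"
    unfolding smooth_step[OF refl] by (rule LIMSEQ_unique)
  then show ?thesis by (simp add: H_def)
qed

text \<open>For negative exponents the ball is decomposed dyadically. The balls \<open>B k\<close>,
  weighted by the bound \<open>c k\<close> for the function on the shell, contribute a geometric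
  series with ratio \<open>2 powr (- a - N)\<close>, which is below 1 exactly when
  \<open>a > -N\<close>.\<close>

lemma integrable_norm_powr_cball:
  fixes R :: real
  assumes a: "a > - real DIM('a::euclidean_space)"
  shows "integrable lebesgue (\<lambda>x::'a. indicator (cball 0 R) x * norm x powr a)"
proof (cases "a \<ge> 0 \<or> R \<le> 0")
  case True
  have "integrable lebesgue (\<lambda>x::'a. (norm x powr a * indicator (cball 0 R) x) *\<^sub>R (indicator (cball 0 R) x :: real))"
  proof (rule integrable_scaleR_bounded[OF integrable_indicator_cball])
    show "AE x::'a in lebesgue. \<bar>norm x powr a * indicator (cball 0 R) x\<bar> \<le> \<bar>R powr a\<bar>"
      using AE_nonzero
    proof eventually_elim
      case (elim x)
      show ?case
      proof (cases "x \<in> cball 0 R")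
        case t: True
        have "norm x \<le> R" using t by simp
        moreover have "norm x > 0" using elim by simp
        ultimately have "a \<ge> 0" using True by linarith
        then show ?thesis using t by (auto intro!: powr_mono2)
      qed simp
    qed
    have "(\<lambda>x::'a. norm x powr a) \<in> borel_measurable borel" by measurable
    then have "(\<lambda>x::'a. norm x powr a) \<in> borel_measurable lebesgue" by (intro measurable_completion) simp
    then show "(\<lambda>x::'a. norm x powr a * indicator (cball 0 R) x) \<in> borel_measurable lebesgue"
      by (intro borel_measurable_times borel_measurable_indicator) auto
  qed
  moreover have "(norm x powr a * indicator (cball 0 R) x) *\<^sub>R (indicator (cball 0 R) x :: real) = indicator (cball 0 R) x * norm x powr a" for x :: 'a
    by (cases "x \<in> cball 0 R") auto
  ultimately show ?thesis by (simp only:)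
next
  case False
  then have aneg: "a < 0" and R: "R > 0" by auto
  define N where "N = DIM('a)"
  define B where "B = (\<lambda>k::nat. cball (0::'a) (R / 2 ^ k))"
  \<comment> \<open>Value of \<open>|x|^a\<close> on the inner sphere of the \<open>k\<close>-th
    dyadic shell, an upper bound on that shell because \<open>a < 0\<close>.\<close>
  define c where "c = (\<lambda>k::nat. (R / 2 ^ Suc k) powr a)"
  define q where "q = 2 powr (- a - real N)"
  have q: "0 < q" "q < 1" using a powr_less_mono[of "- a - real N" 0 2] by (auto simp: q_def N_def)
  have cB: "c k * (unit_ball_vol (real N) * (R / 2 ^ k) ^ N) = ((R / 2) powr a * unit_ball_vol (real N) * R ^ N) * q ^ k" for k
  proof -
    have "R / 2 ^ Suc k = (R / 2) * 2 powr (- real k)"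
      using R by (simp add: powr_minus powr_realpow field_simps)
    then have "c k = ((R / 2) * 2 powr (- real k)) powr a" by (simp only: c_def)
    also have "\<dots> = (R/2) powr a * (2 powr (- real k)) powr a" by (rule powr_mult)
    also have "(2 powr (- real k)) powr a = 2 powr (- a * real k)" by (simp add: powr_powr mult.commute)
    finally have 1: "c k = (R/2) powr a * 2 powr (- a * real k)" .
    have "(R / 2 ^ k) ^ N = R ^ N * 2 powr (- real N * real k)"
      by (simp add: power_divide powr_minus powr_realpow[symmetric] powr_powr field_simps power_mult[symmetric])
    moreover have "q ^ k = 2 powr (- a * real k) * 2 powr (- real N * real k)"
      by (simp add: q_def powr_realpow[symmetric] powr_powr powr_add[symmetric] algebra_simps)
    ultimately show ?thesis using 1 by (simp add: mult_ac)
  qed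
  have pt: "ennreal (indicator (cball 0 R) x * norm x powr a) \<le> (\<Sum>k. ennreal (c k) * indicator (B k) x)" if x: "x \<noteq> 0" for x :: 'a
  proof (cases "x \<in> cball 0 R")
    case True
    have "\<exists>k. \<not> norm x \<le> R / 2 ^ k"
    proof -
      obtain k where "R / norm x < 2 ^ k" using real_arch_pow[of 2 "R / norm x"] by auto
      then have "\<not> norm x \<le> R / 2 ^ k" using x by (simp add: field_simps)
      then show ?thesis by blast
    qed
    \<comment> \<open>The first \<open>k\<close> with \<open>|x| > R / 2^k\<close> is positive
      because \<open>x\<close> lies in the ball, and its predecessor is the index of the shell of
      \<open>x\<close>.\<close>
    then obtain k where k: "\<not> norm x \<le> R / 2 ^ k" "\<And>j. j < k \<Longrightarrow> norm x \<le> R / 2 ^ j"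
      using exists_least_iff[of "\<lambda>k. \<not> norm x \<le> R / 2 ^ k"] by blast
    have "k \<noteq> 0" using True k(1) by (intro notI) auto
    then obtain j where j: "k = Suc j" by (cases k) auto
    have "norm x powr a \<le> c j"
      unfolding c_def using k(1) j R aneg by (intro powr_mono2') auto
    then have "ennreal (indicator (cball 0 R) x * norm x powr a) \<le> ennreal (c j) * indicator (B j) x"
      using True k(2)[of j] j by (auto simp: B_def ennreal_leI)
    also have "\<dots> \<le> (\<Sum>k. ennreal (c k) * indicator (B k) x)"
    proof -
      define h where "h = (\<lambda>k. ennreal (c k) * indicator (B k) x)"
      have "sum h {j} \<le> suminf h" by (intro sum_le_suminf) auto
      then have "h j \<le> suminf h" by simp
      then show ?thesis by (simp only: h_def)
    qed
    finally show ?thesis .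
  qed auto
  have "(\<lambda>x::'a. norm x powr a) \<in> borel_measurable borel" by measurable
  then have meas: "(\<lambda>x::'a. indicator (cball 0 R) x * norm x powr a) \<in> borel_measurable borel"
    by (intro borel_measurable_times borel_measurable_indicator) auto
  have "(\<integral>\<^sup>+ x. ennreal (indicator (cball (0::'a) R) x * norm x powr a) \<partial>lborel)
     \<le> (\<integral>\<^sup>+ x. (\<Sum>k. ennreal (c k) * indicator (B k) x) \<partial>lborel)"
    using pt by (intro nn_integral_mono_AE eventually_mono[OF AE_lborel_singleton[of 0]]) auto
  also have "\<dots> = (\<Sum>k. \<integral>\<^sup>+ x. ennreal (c k) * indicator (B k) x \<partial>lborel)"
    by (intro nn_integral_suminf borel_measurable_times_ennreal borel_measurable_const borel_measurable_indicator) (simp add: B_def)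
  also have "\<dots> = (\<Sum>k. ennreal (((R / 2) powr a * unit_ball_vol (real N) * R ^ N) * q ^ k))"
  proof (rule suminf_cong)
    fix k
    have "(\<integral>\<^sup>+ x. ennreal (c k) * indicator (B k) x \<partial>lborel) = ennreal (c k) * ennreal (unit_ball_vol (real N) * (R / 2 ^ k) ^ N)"
      using R unfolding B_def N_def by (subst nn_integral_cmult_indicator) (auto simp: emeasure_cball)
    also have "\<dots> = ennreal (c k * (unit_ball_vol (real N) * (R / 2 ^ k) ^ N))"
      by (rule ennreal_mult''[symmetric]) (use R in \<open>simp add: unit_ball_vol_nonneg\<close>)
    finally show "(\<integral>\<^sup>+ x. ennreal (c k) * indicator (B k) x \<partial>lborel) = ennreal (((R / 2) powr a * unit_ball_vol (real N) * R ^ N) * q ^ k)"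
      unfolding cB .
  qed
  also have "\<dots> < \<infinity>"
  proof -
    have "summable (\<lambda>k. ((R / 2) powr a * unit_ball_vol (real N) * R ^ N) * q ^ k)"
      using q by (intro summable_mult summable_geometric) auto
    then have "(\<Sum>k. ennreal (((R / 2) powr a * unit_ball_vol (real N) * R ^ N) * q ^ k)) \<noteq> top"
      using R q by (intro ennreal_suminf_neq_top) (auto intro!: mult_nonneg_nonneg)
    then show ?thesis by (simp add: less_top)
  qed
  finally have "integrable lborel (\<lambda>x::'a. indicator (cball 0 R) x * norm x powr a)"
    using meas by (intro integrableI_nonneg) auto
  then show ?thesis using meas by (subst integrable_completion) auto
qed

section \<open>The radial equation\<close>

text \<open>At 0 the difference quotient is \<open>|h|^a\<close>, which tends to 0 because
  \<open>a > 0\<close>. These odd powers, composed with a solution, make up the test functions of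
  the nonexistence part.\<close>

lemma DERIV_abs_powr_mult:
  fixes a z :: real
  assumes "a > 0"
  shows "((\<lambda>z. \<bar>z\<bar> powr a * z) has_real_derivative (a + 1) * \<bar>z\<bar> powr a) (at z)"
proof -
  consider "z > 0" | "z < 0" | "z = 0" by linarith
  then show ?thesis
  proof cases
    case 1
    have "((\<lambda>z. z powr a * z) has_real_derivative a * z powr (a - 1) * z + 1 * z powr a) (at z)"
      using DERIV_mult[OF has_real_derivative_powr[OF 1, of a] DERIV_ident] by simp
    moreover have "a * z powr (a - 1) * z + 1 * z powr a = (a + 1) * \<bar>z\<bar> powr a"
      using 1 by (simp add: powr_diff algebra_simps)
    ultimately have "((\<lambda>z. z powr a * z) has_real_derivative (a + 1) * \<bar>z\<bar> powr a) (at z)" by simp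
    then show ?thesis
      by (rule has_field_derivative_transform_within_open[where S="{0<..}"]) (use 1 in auto)
  next
    case 2
    have "((\<lambda>z. (-z) powr a) has_real_derivative a * (-z) powr (a - 1) * (-1)) (at z)"
      by (rule DERIV_chain2[OF has_real_derivative_powr]) (use 2 in \<open>auto intro!: derivative_eq_intros\<close>)
    from DERIV_mult[OF this DERIV_ident]
    have "((\<lambda>z. (-z) powr a * z) has_real_derivative a * (-z) powr (a - 1) * (-1) * z + 1 * (-z) powr a) (at z)" by simp
    moreover have "a * (-z) powr (a - 1) * (-1) * z + 1 * (-z) powr a = (a + 1) * \<bar>z\<bar> powr a"
      using 2 by (simp add: powr_diff divide_simps) (simp add: algebra_simps)
    ultimately have "((\<lambda>z. (-z) powr a * z) has_real_derivative (a + 1) * \<bar>z\<bar> powr a) (at z)" by simp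
    then show ?thesis
      by (rule has_field_derivative_transform_within_open[where S="{..<0}"]) (use 2 in auto)
  next
    case 3
    have "((\<lambda>h::real. \<bar>h\<bar> powr a) \<longlongrightarrow> \<bar>0\<bar> powr a) (at 0)"
      using assms by (intro tendsto_powr' tendsto_intros) auto
    then have "((\<lambda>h::real. \<bar>h\<bar> powr a) \<longlongrightarrow> 0) (at 0)" by simp
    moreover have "\<forall>\<^sub>F h::real in at 0. \<bar>h\<bar> powr a = \<bar>h\<bar> powr a * h / h"
      by (auto simp: eventually_at_filter)
    ultimately have "((\<lambda>h::real. \<bar>h\<bar> powr a * h / h) \<longlongrightarrow> 0) (at 0)"
      by (rule Lim_transform_eventually)
    then show ?thesis using 3 by (simp add: has_field_derivative_iff)
  qed
qed

lemma continuous_on_abs_powr: "a > 0 \<Longrightarrow> continuous_on S (\<lambda>z::real. \<bar>z\<bar> powr a)"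
  by (intro continuous_on_powr' continuous_intros) auto

lemma abs_powr_mult_eq: "z \<ge> 0 \<Longrightarrow> \<bar>z\<bar> powr (p - 1) * z = z powr p" for z p :: real
  by (cases "z = 0") (auto simp: powr_diff)

text \<open>The nonlinearity is truncated to make it bounded and globally Lipschitz.\<close>

definition trunc_pow :: "real \<Rightarrow> real \<Rightarrow> real \<Rightarrow> real" where
  "trunc_pow p s x = max 0 (min x s) powr p"

text \<open>Clamping to \<open>[0, s]\<close> is 1-Lipschitz, and on that interval the mean value
  theorem bounds the increment of the power.\<close>

lemma trunc_pow_lipschitz:
  assumes "p > 1" "s > 0"
  shows "\<bar>trunc_pow p s x - trunc_pow p s y\<bar> \<le> p * s powr (p - 1) * \<bar>x - y\<bar>"
proof -
  have main: "\<bar>b powr p - a powr p\<bar> \<le> p * s powr (p - 1) * (b - a)" if "0 \<le> a" "a < b" "b \<le> s" for a b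
  proof -
    note lt = that(2)
    obtain z where z: "a < z" "z < b" "\<bar>b\<bar> powr (p - 1) * b - \<bar>a\<bar> powr (p - 1) * a = (b - a) * ((p - 1 + 1) * \<bar>z\<bar> powr (p - 1))"
      using MVT2[OF lt, of "\<lambda>z. \<bar>z\<bar> powr (p - 1) * z" "\<lambda>z. (p - 1 + 1) * \<bar>z\<bar> powr (p - 1)"]
        DERIV_abs_powr_mult[of "p - 1"] assms by force
    have e: "b powr p - a powr p = (b - a) * (p * \<bar>z\<bar> powr (p - 1))"
      using z(3) that by (simp add: abs_powr_mult_eq[of b p, simplified] abs_powr_mult_eq[of a p, simplified])
    have "\<bar>z\<bar> powr (p - 1) \<le> s powr (p - 1)" using z that assms by (intro powr_mono2) auto
    then have "(b - a) * (p * \<bar>z\<bar> powr (p - 1)) \<le> (b - a) * (p * s powr (p - 1))"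
      using that assms by (intro mult_left_mono) auto
    moreover have "0 \<le> (b - a) * (p * \<bar>z\<bar> powr (p - 1))" using that assms by auto
    ultimately show ?thesis unfolding e by (simp add: mult_ac)
  qed
  define a where "a = max 0 (min x s)"
  define b where "b = max 0 (min y s)"
  have ab: "0 \<le> a" "a \<le> s" "0 \<le> b" "b \<le> s" "\<bar>a - b\<bar> \<le> \<bar>x - y\<bar>" using assms by (auto simp: a_def b_def)
  have "\<bar>a powr p - b powr p\<bar> \<le> p * s powr (p - 1) * \<bar>a - b\<bar>"
    using main[of a b] main[of b a] ab by (cases a b rule: linorder_cases) (auto simp: abs_minus_commute)
  also have "\<dots> \<le> p * s powr (p - 1) * \<bar>x - y\<bar>" using ab assms by (intro mult_left_mono) auto
  finally show ?thesis by (simp add: trunc_pow_def a_def b_def)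
qed

lemma continuous_on_trunc_pow: "p > 0 \<Longrightarrow> continuous_on S (trunc_pow p s)"
  unfolding trunc_pow_def[abs_def] by (intro continuous_on_powr' continuous_intros) auto

lemma trunc_pow_bounds:
  assumes "p > 0" "s > 0"
  shows "0 \<le> trunc_pow p s x" "trunc_pow p s x \<le> s powr p"
  using assms by (auto simp: trunc_pow_def intro!: powr_mono2)

section \<open>The radial initial value problem as a fixed point equation\<close>

lemma integral_bound_real:
  fixes f :: "real \<Rightarrow> real"
  assumes "continuous_on {0..t} f" "0 \<le> t" "\<And>q. 0 \<le> q \<Longrightarrow> q \<le> t \<Longrightarrow> \<bar>f q\<bar> \<le> B"
  shows "\<bar>integral {0..t} f\<bar> \<le> B * t"
  using integral_bound[of 0 t f B] assms by auto

text \<open>The expression is the integral of \<open>(1 - (q/t)^\<kappa>) f(q)\<close> over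
  \<open>[0, t]\<close>, which is what integrating
  \<open>(t^(\<kappa>+1) u')' = - c t^\<kappa> f\<close> twice produces up to the factor
  \<open>- c / \<kappa>\<close>. The 2 comes from estimating the two terms separately.\<close>

lemma picard_bound:
  fixes f :: "real \<Rightarrow> real"
  assumes "continuous_on {0..} f" "0 < t" "\<kappa> > 0" "\<And>q. 0 \<le> q \<Longrightarrow> q \<le> t \<Longrightarrow> \<bar>f q\<bar> \<le> F q"
    "(F has_integral I) {0..t}"
  shows "\<bar>integral {0..t} f - t powr (-\<kappa>) * integral {0..t} (\<lambda>q. q powr \<kappa> * f q)\<bar> \<le> 2 * I"
proof -
  have cf: "continuous_on {0..t} f" using assms(1) by (rule continuous_on_subset) auto
  have cp: "continuous_on {0..t} (\<lambda>q. q powr \<kappa>)" using assms(3) by (intro continuous_on_powr' continuous_intros) auto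
  have i: "f integrable_on {0..t}" "(\<lambda>q. q powr \<kappa> * f q) integrable_on {0..t}"
    by (intro integrable_continuous_real continuous_intros cf cp)+
  have F: "F integrable_on {0..t}" "integral {0..t} F = I" using assms(5) by (auto simp: has_integral_iff)
  have "norm (integral {0..t} f) \<le> integral {0..t} F"
    using i F assms(4) by (intro integral_norm_bound_integral) auto
  moreover have "norm (integral {0..t} (\<lambda>q. q powr \<kappa> * f q)) \<le> integral {0..t} (\<lambda>q. t powr \<kappa> * F q)"
  proof (rule integral_norm_bound_integral)
    fix q assume q: "q \<in> {0..t}"
    have "\<bar>q powr \<kappa>\<bar> * \<bar>f q\<bar> \<le> t powr \<kappa> * F q"
      using q assms(3,4) by (intro mult_mono) (auto intro!: powr_mono2)
    then show "norm (q powr \<kappa> * f q) \<le> t powr \<kappa> * F q" by (simp add: abs_mult)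
  qed (use i F in \<open>auto intro!: integrable_on_mult_right\<close>)
  then have "t powr (-\<kappa>) * \<bar>integral {0..t} (\<lambda>q. q powr \<kappa> * f q)\<bar> \<le> t powr (-\<kappa>) * (t powr \<kappa> * I)"
    using F by (intro mult_left_mono) auto
  moreover have "t powr (-\<kappa>) * (t powr \<kappa> * I) = I" using assms(2) by (simp add: powr_minus field_simps)
  ultimately show ?thesis using F by (simp add: abs_mult abs_triangle_ineq4[THEN order_trans])
qed

lemma exp_has_integral: "M > 0 \<Longrightarrow> t \<ge> 0 \<Longrightarrow> ((\<lambda>q. exp (M * q)) has_integral (exp (M * t) - 1) / M) {0..t}" for M t :: real
proof -
  assume "M > 0" "t \<ge> 0"
  have "((\<lambda>q. exp (M * q)) has_integral exp (M * t) / M - exp (M * 0) / M) {0..t}"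
    by (rule fundamental_theorem_of_calculus[OF \<open>t \<ge> 0\<close>])
       (use \<open>M > 0\<close> in \<open>auto intro!: derivative_eq_intros simp: has_real_derivative_iff_has_vector_derivative[symmetric]\<close>)
  then show ?thesis by (simp add: diff_divide_distrib)
qed

text \<open>In the derivative of \<open>T\<close> the terms with \<open>f t\<close> cancel, which
  leaves the flux. At 0 the power \<open>t powr (-\<kappa>)\<close> is singular, and continuity
  comes from the linear bound instead.\<close>

lemma picard_continuous:
  fixes f :: "real \<Rightarrow> real"
  assumes f: "continuous_on {0..} f" "\<And>q. 0 \<le> q \<Longrightarrow> \<bar>f q\<bar> \<le> B" and \<kappa>: "\<kappa> > 0"
  defines "T \<equiv> \<lambda>t. integral {0..t} f - t powr (-\<kappa>) * integral {0..t} (\<lambda>q. q powr \<kappa> * f q)"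
  shows "continuous_on {0..} T" "\<And>t. t \<ge> 0 \<Longrightarrow> \<bar>T t\<bar> \<le> 2 * (B * t)"
    "\<And>t. t > 0 \<Longrightarrow> (T has_real_derivative \<kappa> * t powr (-\<kappa>-1) * integral {0..t} (\<lambda>q. q powr \<kappa> * f q)) (at t)"
    "\<And>t. t > 0 \<Longrightarrow> ((\<lambda>t. integral {0..t} (\<lambda>q. q powr \<kappa> * f q)) has_real_derivative t powr \<kappa> * f t) (at t)"
proof -
  have cp: "continuous_on {0..} (\<lambda>q. q powr \<kappa> * f q)" using \<kappa> by (intro continuous_on_powr' continuous_intros f) auto
  have FTC: "((\<lambda>t. integral {0..t} g) has_real_derivative g t) (at t)" if g: "continuous_on {0..} g" and t: "t > 0" for g :: "real \<Rightarrow> real" and t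
  proof -
    have "((\<lambda>t. integral {0..t} g) has_real_derivative g t) (at t within {0..t+1})"
      using t by (intro integral_has_real_derivative continuous_on_subset[OF g]) auto
    moreover have "at t within {0..t+1} = at t" using t by (intro at_within_interior) auto
    ultimately show ?thesis by simp
  qed
  show B: "\<bar>T t\<bar> \<le> 2 * (B * t)" if "t \<ge> 0" for t
  proof (cases "t = 0")
    case False
    then show ?thesis unfolding T_def using that f
      by (intro picard_bound[OF f(1) _ \<kappa>, where F="\<lambda>q. B"]) (use has_integral_const_real[of B 0 t] in \<open>auto simp: mult.commute\<close>)
  qed (simp add: T_def)
  show R: "((\<lambda>t. integral {0..t} (\<lambda>q. q powr \<kappa> * f q)) has_real_derivative t powr \<kappa> * f t) (at t)" if "t > 0" for t
    by (rule FTC[OF cp that])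
  show D: "(T has_real_derivative \<kappa> * t powr (-\<kappa>-1) * integral {0..t} (\<lambda>q. q powr \<kappa> * f q)) (at t)" if t: "t > 0" for t
  proof -
    have "(T has_real_derivative f t - ((-\<kappa>) * t powr (-\<kappa> - 1) * integral {0..t} (\<lambda>q. q powr \<kappa> * f q) + (t powr \<kappa> * f t) * t powr (-\<kappa>))) (at t)"
      unfolding T_def by (intro DERIV_diff DERIV_mult FTC[OF f(1) t] has_real_derivative_powr[OF t] R[OF t])
    then show ?thesis using t by (simp add: powr_minus field_simps)
  qed
  show "continuous_on {0..} T"
    unfolding continuous_on_eq_continuous_within
  proof
    fix t :: real assume "t \<in> {0..}"
    then have "t > 0 \<or> t = 0" by auto
    then consider "t > 0" | "t = 0" by blast
    then show "continuous (at t within {0..}) T"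
    proof cases
      case 1
      show ?thesis by (rule continuous_at_imp_continuous_at_within[OF DERIV_isCont[OF D[OF 1]]])
    next
      case 2
      have "(T \<longlongrightarrow> 0) (at 0 within {0..})"
      proof (rule Lim_null_comparison)
        show "\<forall>\<^sub>F t in at 0 within {0..}. norm (T t) \<le> 2 * (B * t)"
          using B by (auto simp: eventually_at_filter)
        have "((\<lambda>t. 2 * (B * t)) \<longlongrightarrow> 2 * (B * 0)) (at 0 within {0..})" by (intro tendsto_intros)
        then show "((\<lambda>t. 2 * (B * t)) \<longlongrightarrow> 0) (at 0 within {0..})" by simp
      qed
      then show ?thesis using 2 by (simp add: continuous_within T_def)
    qed
  qed
qed

text \<open>Banach's fixed point theorem for the unknown \<open>exp (- M * t) * u t\<close>. The
  exponential weight makes the map a contraction on the whole half-line at once, so that global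
  existence requires no continuation argument.\<close>

lemma picard_solution:
  fixes s p \<kappa> c :: real
  assumes s: "s > 0" and p: "p > 1" and \<kappa>: "\<kappa> > 0" and c: "c > 0"
  obtains u P where "u 0 = s" "continuous_on {0..} u"
    "\<And>t. t > 0 \<Longrightarrow> (u has_real_derivative - c * t powr (-\<kappa>-1) * P t) (at t)"
    "\<And>t. t > 0 \<Longrightarrow> (P has_real_derivative t powr \<kappa> * trunc_pow p s (u t)) (at t)"
    "\<And>t. t > 0 \<Longrightarrow> 0 \<le> P t" "\<And>t. t > 0 \<Longrightarrow> P t \<le> t powr (\<kappa> + 1) * s powr p"
proof -
  define g where "g = trunc_pow p s"
  define Lip where "Lip = p * s powr (p - 1)"
  have Lip: "Lip > 0" using p s by (simp add: Lip_def)
  \<comment> \<open>Chosen so that the Lipschitz constant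
    \<open>(c / \<kappa>) * 2 * Lip / M\<close> of the map is \<open>1/2\<close>.\<close>
  define M where "M = 4 * (c / \<kappa>) * Lip"
  have M: "M > 0" using Lip c \<kappa> by (simp add: M_def)
  define h where "h = (\<lambda>(v :: real \<Rightarrow>\<^sub>C real) q. g (exp (M * q) * apply_bcontfun v q))"
  have cg: "continuous_on S g" for S unfolding g_def using p by (intro continuous_on_trunc_pow) auto
  have ch: "continuous_on S (h v)" for S v
    unfolding h_def by (intro continuous_on_compose2[OF cg[of UNIV]] continuous_intros) auto
  have hb: "0 \<le> h v q" "\<bar>h v q\<bar> \<le> s powr p" for v q
    using trunc_pow_bounds[of p s] p s by (auto simp: h_def g_def)
  define T where "T = (\<lambda>f t. integral {0..t} f - t powr (-\<kappa>) * integral {0..t} (\<lambda>q. q powr \<kappa> * f q))"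
  have Tcont: "continuous_on {0..} (T (h v))" for v
    unfolding T_def by (rule picard_continuous(1)[OF ch hb(2) \<kappa>])
  have Tb: "\<bar>T (h v) t\<bar> \<le> 2 * (s powr p * t)" if "t \<ge> 0" for v t
    unfolding T_def by (rule picard_continuous(2)[OF ch hb(2) \<kappa> that])
  \<comment> \<open>Functions are extended to negative \<open>t\<close> by their value at 0, since
    the bounded continuous functions are taken on the whole line.\<close>
  define \<Phi> where "\<Phi> = (\<lambda>v t. exp (- M * max 0 t) * (s - (c / \<kappa>) * T (h v) (max 0 t)))"
  have \<Phi>b: "\<Phi> v \<in> bcontfun" for v
    unfolding bcontfun_def
  proof (intro CollectI conjI)
    show "continuous_on UNIV (\<Phi> v)"
      unfolding \<Phi>_def by (intro continuous_intros continuous_on_compose2[OF Tcont]) auto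
    have "\<bar>\<Phi> v t\<bar> \<le> s + (c / \<kappa>) * (2 * (s powr p * (1 / M)))" for t
    proof -
      define r where "r = max 0 t"
      have r: "r \<ge> 0" by (simp add: r_def)
      have e1: "exp (- M * r) \<le> 1" using M r by simp
      have "M * r \<le> exp (M * r)" using exp_ge_add_one_self[of "M * r"] by linarith
      then have e2: "exp (- M * r) * r \<le> 1 / M"
        using M by (simp add: exp_minus field_simps)
      have "\<bar>s - (c / \<kappa>) * T (h v) r\<bar> \<le> s + (c / \<kappa>) * \<bar>T (h v) r\<bar>"
        using s c \<kappa> abs_triangle_ineq4[of s "(c / \<kappa>) * T (h v) r"] by (simp add: abs_mult)
      also have "\<dots> \<le> s + (c / \<kappa>) * (2 * (s powr p * r))"
        using Tb[OF r] c \<kappa> by (intro add_mono mult_left_mono) auto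
      finally have "\<bar>\<Phi> v t\<bar> \<le> exp (- M * r) * (s + (c / \<kappa>) * (2 * (s powr p * r)))"
        unfolding \<Phi>_def r_def[symmetric] by (simp add: abs_mult)
      also have "\<dots> = exp (- M * r) * s + (c / \<kappa>) * (2 * (s powr p * (exp (- M * r) * r)))"
        by (simp add: algebra_simps)
      also have "\<dots> \<le> 1 * s + (c / \<kappa>) * (2 * (s powr p * (1 / M)))"
        using e1 e2 s c \<kappa> by (intro add_mono mult_left_mono mult_right_mono) auto
      finally show ?thesis by simp
    qed
    then show "bounded (range (\<Phi> v))" unfolding bounded_iff by auto
  qed
  define F where "F = (\<lambda>v. Bcontfun (\<Phi> v))"
  have aF: "apply_bcontfun (F v) = \<Phi> v" for v unfolding F_def by (rule Bcontfun_inverse[OF \<Phi>b])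
  have contr: "dist (F v) (F w) \<le> (1/2) * dist v w" for v w
  proof (rule dist_bound)
    fix t :: real
    define r where "r = max 0 t"
    have r: "r \<ge> 0" by (simp add: r_def)
    have TT: "\<bar>T (h v) r - T (h w) r\<bar> \<le> 2 * (Lip * dist v w * ((exp (M * r) - 1) / M))"
    proof (cases "r = 0")
      case False
      then have r0: "r > 0" using r by simp
      have i: "h v integrable_on {0..r}" "h w integrable_on {0..r}" by (intro integrable_continuous_real ch)+
      have cp: "continuous_on {0..r} (\<lambda>q. q powr \<kappa>)" using \<kappa> by (intro continuous_on_powr' continuous_intros) auto
      have j: "(\<lambda>q. q powr \<kappa> * h v q) integrable_on {0..r}" "(\<lambda>q. q powr \<kappa> * h w q) integrable_on {0..r}"
        by (intro integrable_continuous_real continuous_intros ch cp)+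
      have "T (h v) r - T (h w) r = T (\<lambda>q. h v q - h w q) r"
        unfolding T_def right_diff_distrib
        by (simp add: integral_diff i j right_diff_distrib)
      also have "\<bar>\<dots>\<bar> \<le> 2 * (Lip * dist v w * ((exp (M * r) - 1) / M))"
        unfolding T_def
      proof (rule picard_bound[OF _ r0 \<kappa>, where F="\<lambda>q. Lip * dist v w * exp (M * q)"])
        show "continuous_on {0..} (\<lambda>q. h v q - h w q)" by (intro continuous_intros ch)
        show "((\<lambda>q. Lip * dist v w * exp (M * q)) has_integral Lip * dist v w * ((exp (M * r) - 1) / M)) {0..r}"
          by (intro has_integral_mult_right exp_has_integral M r)
        fix q
        have "\<bar>h v q - h w q\<bar> \<le> Lip * \<bar>exp (M * q) * apply_bcontfun v q - exp (M * q) * apply_bcontfun w q\<bar>"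
          unfolding h_def g_def Lip_def by (rule trunc_pow_lipschitz[OF p s])
        also have "\<dots> = Lip * (exp (M * q) * dist (apply_bcontfun v q) (apply_bcontfun w q))"
          by (simp add: dist_real_def right_diff_distrib[symmetric] abs_mult)
        also have "\<dots> \<le> Lip * (exp (M * q) * dist v w)"
          using Lip by (intro mult_left_mono dist_bounded) auto
        finally show "\<bar>h v q - h w q\<bar> \<le> Lip * dist v w * exp (M * q)" by (simp add: mult_ac)
      qed
      finally show ?thesis .
    qed (simp add: T_def)
    have "dist (apply_bcontfun (F v) t) (apply_bcontfun (F w) t) = exp (- M * r) * ((c / \<kappa>) * \<bar>T (h v) r - T (h w) r\<bar>)"
    proof -
      have "\<Phi> v t - \<Phi> w t = exp (- M * r) * ((c / \<kappa>) * (T (h w) r - T (h v) r))"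
        by (simp add: \<Phi>_def r_def[symmetric] algebra_simps)
      then show ?thesis using c \<kappa> by (simp add: aF dist_real_def abs_mult abs_minus_commute)
    qed
    also have "\<dots> \<le> exp (- M * r) * ((c / \<kappa>) * (2 * (Lip * dist v w * (exp (M * r) / M))))"
    proof -
      have "(exp (M * r) - 1) / M \<le> exp (M * r) / M" using M by (intro divide_right_mono) auto
      then have "2 * (Lip * dist v w * ((exp (M * r) - 1) / M)) \<le> 2 * (Lip * dist v w * (exp (M * r) / M))"
        using Lip by (intro mult_left_mono) auto
      then have "\<bar>T (h v) r - T (h w) r\<bar> \<le> 2 * (Lip * dist v w * (exp (M * r) / M))" using TT by linarith
      then show ?thesis using c \<kappa> by (intro mult_left_mono) auto
    qed
    also have "\<dots> = (c / \<kappa>) * (2 * (Lip * dist v w * (1 / M)))"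
      by (simp add: exp_minus field_simps)
    also have "\<dots> = (1/2) * dist v w"
      using c \<kappa> Lip by (simp add: M_def field_simps)
    finally show "dist (apply_bcontfun (F v) t) (apply_bcontfun (F w) t) \<le> (1/2) * dist v w" .
  qed
  have "\<exists>!v. F v = v"
    by (rule banach_fix_type[where c="1/2"]) (use contr in auto)
  then obtain v where v: "F v = v" by blast
  define u where "u = (\<lambda>t. s - (c / \<kappa>) * T (h v) t)"
  define P where "P = (\<lambda>t. integral {0..t} (\<lambda>q. q powr \<kappa> * h v q))"
  have uv: "apply_bcontfun v t = exp (- M * t) * u t" if "t \<ge> 0" for t
    using aF[of v] that by (simp add: v \<Phi>_def u_def)
  have hu: "h v t = trunc_pow p s (u t)" if "t \<ge> 0" for t
    using that by (simp add: h_def g_def uv mult.assoc[symmetric] exp_add[symmetric])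
  show ?thesis
  proof (rule that[of u P])
    show "u 0 = s" by (simp add: u_def T_def)
    show "continuous_on {0..} u" unfolding u_def by (intro continuous_intros Tcont)
    fix t :: real assume t: "t > 0"
    have du: "(u has_real_derivative 0 - (c / \<kappa>) * (\<kappa> * t powr (-\<kappa>-1) * P t)) (at t)"
      unfolding u_def T_def P_def
      by (intro DERIV_diff DERIV_const DERIV_cmult picard_continuous(3)[OF ch hb(2) \<kappa> t])
    show "(u has_real_derivative - c * t powr (-\<kappa>-1) * P t) (at t)"
      by (rule DERIV_cong[OF du]) (use \<kappa> in simp)
    show "(P has_real_derivative t powr \<kappa> * trunc_pow p s (u t)) (at t)"
      using picard_continuous(4)[OF ch hb(2) \<kappa> t, of v] hu[of t] t unfolding P_def by simp
    have cp: "continuous_on {0..t} (\<lambda>q. q powr \<kappa>)" using \<kappa> by (intro continuous_on_powr' continuous_intros) auto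
    have j: "continuous_on {0..t} (\<lambda>q. q powr \<kappa> * h v q)" by (intro continuous_intros ch cp)
    show "0 \<le> P t" unfolding P_def
      by (rule Henstock_Kurzweil_Integration.integral_nonneg) (use j hb(1) in \<open>auto intro!: integrable_continuous_real\<close>)
    have "\<bar>P t\<bar> \<le> (t powr \<kappa> * s powr p) * t"
      unfolding P_def
    proof (rule integral_bound_real[OF j])
      show "\<bar>q powr \<kappa> * h v q\<bar> \<le> t powr \<kappa> * s powr p" if "0 \<le> q" "q \<le> t" for q
        unfolding abs_mult using that \<kappa> by (intro mult_mono hb) (auto intro!: powr_mono2)
    qed (use t in auto)
    then show "P t \<le> t powr (\<kappa> + 1) * s powr p" using t by (simp add: powr_add mult_ac)
  qed
qed

text \<open>Convexity of the power of the positive part: the tangent at \<open>L\<close> lies below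
  the graph. For \<open>w \<ge> 0\<close> this is Young's inequality for \<open>w / L\<close> and 1
  with the exponents \<open>p\<close> and \<open>p / (p - 1)\<close>; for \<open>w < 0\<close> the
  tangent is already \<le> 0.\<close>

lemma powr_tangent:
  fixes p L w :: real
  assumes "p > 1" "L > 0"
  shows "L powr p + p * L powr (p - 1) * (w - L) \<le> max 0 w powr p"
proof (cases "w \<ge> 0")
  case True
  have "(w / L) * 1 \<le> (w / L) powr p / p + 1 powr (p / (p - 1)) / (p / (p - 1))"
  proof (rule Youngs_inequality)
    show "1 / p + 1 / (p / (p - 1)) = 1" using assms by (simp add: field_simps)
    show "p / (p - 1) > 1" using assms by (simp add: field_simps)
  qed (use assms True in auto)
  then have "w / L \<le> (w / L) powr p / p + (p - 1) / p" by simp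
  then have "p * (w / L) \<le> p * ((w / L) powr p / p + (p - 1) / p)" using assms by (intro mult_left_mono) auto
  also have "\<dots> = (w / L) powr p + (p - 1)" using assms by (simp add: distrib_left)
  finally have "p * (w / L) \<le> (w / L) powr p + (p - 1)" .
  then have "L powr p * (p * (w / L)) \<le> L powr p * ((w / L) powr p + (p - 1))" by (intro mult_left_mono) auto
  moreover have "L powr p * (w / L) powr p = w powr p"
    using assms True by (simp add: powr_divide)
  moreover have "L powr p * (p * (w / L)) = p * L powr (p - 1) * w" "L powr p = L powr (p - 1) * L"
    using assms by (auto simp: powr_diff field_simps)
  ultimately have "p * L powr (p - 1) * w \<le> w powr p + L powr p * (p - 1)" by (simp add: algebra_simps)
  then show ?thesis using True \<open>L powr p = L powr (p - 1) * L\<close> by (simp add: algebra_simps)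
next
  case False
  have e: "L powr p = L powr (p - 1) * L" using assms by (simp add: powr_diff)
  have "p * L powr (p - 1) * w \<le> 0" using False assms by (intro mult_nonneg_nonpos) auto
  moreover have "L powr (p - 1) * L * (1 - p) \<le> 0" using assms by (intro mult_nonneg_nonpos) auto
  ultimately have "L powr p + p * L powr (p - 1) * (w - L) \<le> 0" unfolding e by (simp add: algebra_simps)
  then show ?thesis using False by simp
qed

text \<open>The function is nondecreasing and starts from 0. The start is a one-sided limit because
  the functions it is applied to carry powers of \<open>t\<close> and are controlled only for
  \<open>t > 0\<close>.\<close>

lemma nonneg_of_DERIV_nonneg:
  fixes F :: "real \<Rightarrow> real"
  assumes d: "\<And>t. 0 < t \<Longrightarrow> t < T \<Longrightarrow> \<exists>D. (F has_real_derivative D) (at t) \<and> D \<ge> 0"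
    and lim: "(F \<longlongrightarrow> 0) (at_right 0)" and t: "0 < t" "t < T"
  shows "F t \<ge> 0"
proof -
  have "F x \<le> F t" if "0 < x" "x < t" for x
    by (rule DERIV_nonneg_imp_nondecreasing[OF less_imp_le[OF that(2)]]) (use d t that in auto)
  then have "\<forall>\<^sub>F x in at_right 0. F x \<le> F t"
    unfolding eventually_at_right_field using t(1) by blast
  then show ?thesis using tendsto_upperbound[OF lim] by simp
qed

lemma powr_tendsto_0: "a > 0 \<Longrightarrow> ((\<lambda>t::real. t powr a) \<longlongrightarrow> 0) (at_right 0)"
proof -
  assume a: "a > 0"
  have "((\<lambda>t::real. t powr a) \<longlongrightarrow> 0 powr a) (at_right 0)"
    using a by (intro tendsto_powr' tendsto_intros) (auto simp: eventually_at_filter)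
  then show ?thesis by simp
qed

text \<open>In the variables \<open>D = t d/dt\<close>, \<open>w = t\<^sup>\<alpha> u\<close> with \<open>\<alpha> = 1/(p-1)\<close> the equation reads
  \<open>D\<^sup>2w + (\<kappa>-2\<alpha>) Dw - \<alpha>(\<kappa>-\<alpha>) w + c w\<^sup>p = 0\<close>, with constant solution \<open>L\<close>. Since \<open>w\<^sup>p\<close> lies above its
  tangent at \<open>L\<close>, \<open>z = L - w\<close> satisfies \<open>(D + k1)(D + k2) z \<ge> 0\<close>, where the roots \<open>k1, k2\<close> are real exactly
  because \<open>4p\<alpha>(\<kappa>-\<alpha>) \<le> \<kappa>\<^sup>2\<close>. Integrating twice from \<open>t = 0\<close> gives \<open>w \<le> L\<close>; then \<open>t\<^sup>\<kappa>\<^sup>-\<^sup>2\<^sup>\<alpha> Dw\<close> is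
  nondecreasing as long as \<open>w \<ge> 0\<close>, so that \<open>w\<close> increases and \<open>u\<close> never vanishes.\<close>

lemma radial_profile:
  fixes s p \<kappa> c \<alpha> :: real
  assumes s: "s > 0" and p: "p > 1" and \<kappa>: "\<kappa> > 0" and c: "c > 0"
    and \<alpha>: "\<alpha> * (p - 1) = 1" and A: "\<kappa> - 2 * \<alpha> > 0" and stab: "4 * p * \<alpha> * (\<kappa> - \<alpha>) \<le> \<kappa>\<^sup>2"
  obtains u P where "u 0 = s" "continuous_on {0..} u"
    "\<And>t. t \<ge> 0 \<Longrightarrow> 0 < u t" "\<And>t. t \<ge> 0 \<Longrightarrow> u t \<le> s"
    "\<And>t. t > 0 \<Longrightarrow> (u has_real_derivative - c * t powr (-\<kappa>-1) * P t) (at t)"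
    "\<And>t. t > 0 \<Longrightarrow> (P has_real_derivative t powr \<kappa> * u t powr p) (at t)"
    "\<And>t. t > 0 \<Longrightarrow> 0 \<le> P t" "\<And>t. t > 0 \<Longrightarrow> P t \<le> t powr (\<kappa> + 1) * s powr p"
    "\<And>t. t > 0 \<Longrightarrow> p * c * t * u t powr (p - 1) \<le> \<kappa>\<^sup>2 / 4"
proof -
  obtain u P where u0: "u 0 = s" and cu: "continuous_on {0..} u"
    and du: "\<And>t. t > 0 \<Longrightarrow> (u has_real_derivative - c * t powr (-\<kappa>-1) * P t) (at t)"
    and dP: "\<And>t. t > 0 \<Longrightarrow> (P has_real_derivative t powr \<kappa> * trunc_pow p s (u t)) (at t)"
    and P0: "\<And>t. t > 0 \<Longrightarrow> 0 \<le> P t" and P1: "\<And>t. t > 0 \<Longrightarrow> P t \<le> t powr (\<kappa> + 1) * s powr p"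
    using picard_solution[OF s p \<kappa> c] by metis
  have \<alpha>0: "\<alpha> > 0" using \<alpha> p by (metis diff_gt_0_iff_gt zero_less_mult_pos2 zero_less_one)
  have \<alpha>p: "\<alpha> + 1 = \<alpha> * p" using \<alpha> by (simp add: algebra_simps)
  \<comment> \<open>Up to sign, the coefficient of \<open>w\<close> in the equation in logarithmic
    form; it is positive because \<kappa> > 2\<alpha> > 0.\<close>
  define Bc where "Bc = \<alpha> * (\<kappa> - \<alpha>)"
  have Bc: "Bc > 0" using \<alpha>0 A by (simp add: Bc_def)
  have us: "u t \<le> s" if t: "t \<ge> 0" for t
  proof (cases "t = 0")
    case False
    have "u t \<le> u 0"
    proof (rule DERIV_nonpos_imp_decreasing_open[where f=u, OF t])
      show "continuous_on {0..t} u" using cu by (rule continuous_on_subset) auto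
      fix x assume "0 < x" "x < t"
      then show "\<exists>y. DERIV u x :> y \<and> y \<le> 0"
        using du[of x] P0[of x] c by (intro exI[of _ "- c * x powr (-\<kappa>-1) * P x"]) (auto intro!: mult_nonneg_nonneg)
    qed
    then show ?thesis by (simp add: u0)
  qed (simp add: u0)
  \<comment> \<open>The bound \<open>u \<le> s\<close> makes the upper truncation inactive; the
    positive part stays until \<open>u\<close> is known to be positive.\<close>
  have tp: "trunc_pow p s (u t) = max 0 (u t) powr p" if "t > 0" for t
    using us[of t] that by (simp add: trunc_pow_def min_absorb1)
  define w where "w = (\<lambda>t. t powr \<alpha> * u t)"
  \<comment> \<open>The rescaled flux. It expresses \<open>t w'\<close> as
    \<open>\<alpha> w - c Y\<close>, so that \<open>u\<close> has to be differentiated only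
    once.\<close>
  define Y where "Y = (\<lambda>t. t powr (\<alpha> - \<kappa>) * P t)"
  define Dw where "Dw = (\<lambda>t. \<alpha> * w t - c * Y t)"
  have dw: "(w has_real_derivative Dw t / t) (at t)" if t: "t > 0" for t
  proof -
    have "(w has_real_derivative \<alpha> * t powr (\<alpha> - 1) * u t + (- c * t powr (-\<kappa>-1) * P t) * t powr \<alpha>) (at t)"
      unfolding w_def by (rule DERIV_mult[OF has_real_derivative_powr[OF t] du[OF t]])
    moreover have "\<alpha> * t powr (\<alpha> - 1) * u t + (- c * t powr (-\<kappa>-1) * P t) * t powr \<alpha> = Dw t / t"
      using t by (simp add: Dw_def w_def Y_def powr_diff powr_minus field_simps)
    ultimately show ?thesis by simp
  qed
  have maxw: "max 0 (w t) powr p = t powr (\<alpha> + 1) * max 0 (u t) powr p" if t: "t > 0" for t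
  proof -
    have "max 0 (w t) = t powr \<alpha> * max 0 (u t)"
      using t by (auto simp: w_def max_def zero_le_mult_iff mult_le_0_iff)
    then have "max 0 (w t) powr p = (t powr \<alpha>) powr p * max 0 (u t) powr p" by (simp add: powr_mult)
    then show ?thesis by (simp add: powr_powr \<alpha>p)
  qed
  have dY: "(Y has_real_derivative ((\<alpha> - \<kappa>) * Y t + max 0 (w t) powr p) / t) (at t)" if t: "t > 0" for t
  proof -
    have "(Y has_real_derivative (\<alpha> - \<kappa>) * t powr (\<alpha> - \<kappa> - 1) * P t + (t powr \<kappa> * trunc_pow p s (u t)) * t powr (\<alpha> - \<kappa>)) (at t)"
      unfolding Y_def by (rule DERIV_mult[OF has_real_derivative_powr[OF t] dP[OF t]])
    moreover have "(\<alpha> - \<kappa>) * t powr (\<alpha> - \<kappa> - 1) * P t + (t powr \<kappa> * trunc_pow p s (u t)) * t powr (\<alpha> - \<kappa>)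
       = ((\<alpha> - \<kappa>) * Y t + max 0 (w t) powr p) / t"
      using t unfolding tp[OF t] maxw[OF t] Y_def by (simp add: powr_diff powr_add field_simps)
    ultimately show ?thesis by simp
  qed
  have dDw: "(Dw has_real_derivative ((2 * \<alpha> - \<kappa>) * Dw t + Bc * w t - c * max 0 (w t) powr p) / t) (at t)" if t: "t > 0" for t
  proof -
    have "((\<lambda>t. \<alpha> * w t - c * Y t) has_real_derivative \<alpha> * (Dw t / t) - c * (((\<alpha> - \<kappa>) * Y t + max 0 (w t) powr p) / t)) (at t)"
      by (intro DERIV_diff DERIV_cmult dw[OF t] dY[OF t])
    moreover have "(\<lambda>t. \<alpha> * w t - c * Y t) = Dw" by (simp add: Dw_def fun_eq_iff)
    moreover have "\<alpha> * (Dw t / t) - c * (((\<alpha> - \<kappa>) * Y t + max 0 (w t) powr p) / t)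
      = ((2 * \<alpha> - \<kappa>) * Dw t + Bc * w t - c * max 0 (w t) powr p) / t"
      using t by (simp add: Dw_def Bc_def field_simps)
    ultimately show ?thesis by simp
  qed
  have limw: "(w \<longlongrightarrow> 0) (at_right 0)"
  proof -
    have "(u \<longlongrightarrow> s) (at 0 within {0..})" using cu u0 unfolding continuous_on by auto
    then have "(u \<longlongrightarrow> s) (at_right 0)" by (rule tendsto_within_subset) auto
    then have "(w \<longlongrightarrow> 0 * s) (at_right 0)" unfolding w_def by (intro tendsto_mult powr_tendsto_0 \<alpha>0)
    then show ?thesis by simp
  qed
  have limY: "(Y \<longlongrightarrow> 0) (at_right 0)"
  proof (rule Lim_null_comparison)
    show "\<forall>\<^sub>F t in at_right 0. norm (Y t) \<le> t powr (\<alpha> + 1) * s powr p"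
      unfolding eventually_at_filter
    proof (rule always_eventually, intro allI impI)
      fix t :: real assume "t \<in> {0<..}"
      then have t: "t > 0" by simp
      have "norm (Y t) = t powr (\<alpha> - \<kappa>) * P t" using P0[OF t] by (simp add: Y_def abs_mult)
      also have "\<dots> \<le> t powr (\<alpha> - \<kappa>) * (t powr (\<kappa> + 1) * s powr p)" by (intro mult_left_mono P1 t) auto
      also have "\<dots> = t powr (\<alpha> + 1) * s powr p" using t by (simp add: powr_diff powr_add field_simps)
      finally show "norm (Y t) \<le> t powr (\<alpha> + 1) * s powr p" .
    qed
    have "((\<lambda>t. t powr (\<alpha> + 1) * s powr p) \<longlongrightarrow> 0 * s powr p) (at_right 0)"
      using \<alpha>0 by (intro tendsto_mult powr_tendsto_0 tendsto_const) auto
    then show "((\<lambda>t. t powr (\<alpha> + 1) * s powr p) \<longlongrightarrow> 0) (at_right 0)" by simp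
  qed
  have limDw: "(Dw \<longlongrightarrow> 0) (at_right 0)"
  proof -
    have "(Dw \<longlongrightarrow> \<alpha> * 0 - c * 0) (at_right 0)" unfolding Dw_def by (intro tendsto_intros limw limY)
    then show ?thesis by simp
  qed
  \<comment> \<open>The constant solution, determined by \<open>c * L^(p-1) = Bc\<close>;
    \<open>L * t^(-\<alpha>)\<close> is the singular solution in the variable
    \<open>t\<close>.\<close>
  define L where "L = (Bc / c) powr \<alpha>"
  have L: "L > 0" using Bc c by (simp add: L_def)
  have Lp: "c * L powr (p - 1) = Bc"
    using Bc c by (simp add: L_def powr_powr \<alpha>)
  \<comment> \<open>Discriminant of \<open>k^2 - (\<kappa> - 2\<alpha>) k + (p - 1) Bc\<close>. Its
    roots \<open>k1\<close> and \<open>k2\<close> are real by \<open>stab\<close>, and positive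
    because their sum and their product are.\<close>
  define \<Delta> where "\<Delta> = (\<kappa> - 2 * \<alpha>)\<^sup>2 - 4 * (p - 1) * Bc"
  have \<Delta>: "\<Delta> \<ge> 0"
  proof -
    have "\<Delta> = \<kappa>\<^sup>2 - 4 * p * \<alpha> * (\<kappa> - \<alpha>)" unfolding \<Delta>_def Bc_def by (simp add: power2_eq_square algebra_simps)
    then show ?thesis using stab by simp
  qed
  define k1 where "k1 = (\<kappa> - 2 * \<alpha> + sqrt \<Delta>) / 2"
  define k2 where "k2 = (\<kappa> - 2 * \<alpha> - sqrt \<Delta>) / 2"
  have sum: "k1 + k2 = \<kappa> - 2 * \<alpha>" by (simp add: k1_def k2_def field_simps)
  have prod: "k1 * k2 = (p - 1) * Bc"
  proof -
    have "k1 * k2 = ((\<kappa> - 2 * \<alpha>)\<^sup>2 - (sqrt \<Delta>)\<^sup>2) / 4"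
      unfolding k1_def k2_def by (simp add: power2_eq_square algebra_simps)
    also have "\<dots> = ((\<kappa> - 2 * \<alpha>)\<^sup>2 - \<Delta>) / 4" using \<Delta> by simp
    also have "\<dots> = (p - 1) * Bc" unfolding \<Delta>_def by (simp add: mult.assoc)
    finally show ?thesis .
  qed
  have l1: "k1 > 0" using A \<Delta> by (simp add: k1_def add_pos_nonneg)
  have l2: "k2 > 0"
  proof -
    have "k1 * k2 > 0" unfolding prod using p Bc by simp
    then show ?thesis using l1 by (simp add: zero_less_mult_iff)
  qed
  \<comment> \<open>This is \<open>(D + k2) z\<close> for \<open>z = L - w\<close>. The integrating
    factor \<open>t powr k1\<close> turns \<open>(D + k1) (D + k2) z \<ge> 0\<close> into
    monotonicity, starting from the limit 0 at \<open>t = 0\<close>.\<close>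
  have y: "k2 * (L - w t) - Dw t \<ge> 0" if t: "t > 0" for t
  proof -
    have "t powr k1 * (k2 * (L - w t) - Dw t) \<ge> 0"
    proof (rule nonneg_of_DERIV_nonneg[where T="t+1" and F="\<lambda>t. t powr k1 * (k2 * (L - w t) - Dw t)"])
      fix r :: real assume r: "0 < r" "r < t + 1"
      define E where "E = k1 * (k2 * (L - w r) - Dw r) + (k2 * (- Dw r) - ((2 * \<alpha> - \<kappa>) * Dw r + Bc * w r - c * max 0 (w r) powr p))"
      have "((\<lambda>t. t powr k1 * (k2 * (L - w t) - Dw t)) has_real_derivative
         k1 * r powr (k1 - 1) * (k2 * (L - w r) - Dw r)
          + (k2 * (0 - Dw r / r) - ((2 * \<alpha> - \<kappa>) * Dw r + Bc * w r - c * max 0 (w r) powr p) / r) * r powr k1) (at r)"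
        by (intro DERIV_mult has_real_derivative_powr r DERIV_diff DERIV_cmult DERIV_const dw dDw)
      moreover have "k1 * r powr (k1 - 1) * (k2 * (L - w r) - Dw r)
          + (k2 * (0 - Dw r / r) - ((2 * \<alpha> - \<kappa>) * Dw r + Bc * w r - c * max 0 (w r) powr p) / r) * r powr k1
          = r powr k1 / r * E"
        using r by (simp add: E_def powr_diff field_simps)
      moreover have "E \<ge> 0"
      proof -
        have "E = k1 * k2 * (L - w r) - (k1 + k2 + 2 * \<alpha> - \<kappa>) * Dw r - Bc * w r + c * max 0 (w r) powr p"
          by (simp add: E_def algebra_simps)
        also have "\<dots> = (p - 1) * Bc * (L - w r) - Bc * w r + c * max 0 (w r) powr p"
          by (simp add: sum prod)
        finally have E: "E = (p - 1) * Bc * (L - w r) - Bc * w r + c * max 0 (w r) powr p" .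
        have "c * (L powr p + p * L powr (p - 1) * (w r - L)) \<le> c * max 0 (w r) powr p"
          using c by (intro mult_left_mono powr_tangent p L) auto
        moreover have "c * (L powr p + p * L powr (p - 1) * (w r - L)) = Bc * L + p * Bc * (w r - L)"
        proof -
          have "L powr p = L powr (p - 1) * L" using L by (simp add: powr_diff)
          then have "c * (L powr p + p * L powr (p - 1) * (w r - L)) = (c * L powr (p - 1)) * L + p * (c * L powr (p - 1)) * (w r - L)"
            by (simp add: algebra_simps)
          then show ?thesis by (simp only: Lp)
        qed
        moreover have "(p - 1) * Bc * (L - w r) - Bc * w r + (Bc * L + p * Bc * (w r - L)) = 0" by (simp add: algebra_simps)
        ultimately show ?thesis unfolding E by linarith
      qed
      ultimately show "\<exists>D. ((\<lambda>t. t powr k1 * (k2 * (L - w t) - Dw t)) has_real_derivative D) (at r) \<and> 0 \<le> D"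
        using r by (intro exI[of _ "r powr k1 / r * E"]) auto
    next
      have "((\<lambda>t. t powr k1 * (k2 * (L - w t) - Dw t)) \<longlongrightarrow> 0 * (k2 * (L - 0) - 0)) (at_right 0)"
        by (intro tendsto_intros powr_tendsto_0 l1 limw limDw)
      then show "((\<lambda>t. t powr k1 * (k2 * (L - w t) - Dw t)) \<longlongrightarrow> 0) (at_right 0)" by simp
    qed (use t in auto)
    then show ?thesis using t by (simp add: zero_le_mult_iff)
  qed
  have wL: "w t \<le> L" if t: "t > 0" for t
  proof -
    have "t powr k2 * (L - w t) \<ge> 0"
    proof (rule nonneg_of_DERIV_nonneg[where T="t+1" and F="\<lambda>t. t powr k2 * (L - w t)"])
      fix r :: real assume r: "0 < r" "r < t + 1"
      have "((\<lambda>t. t powr k2 * (L - w t)) has_real_derivative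
         k2 * r powr (k2 - 1) * (L - w r) + (0 - Dw r / r) * r powr k2) (at r)"
        by (intro DERIV_mult has_real_derivative_powr r DERIV_diff DERIV_const dw)
      moreover have "k2 * r powr (k2 - 1) * (L - w r) + (0 - Dw r / r) * r powr k2 = r powr k2 / r * (k2 * (L - w r) - Dw r)"
        using r by (simp add: powr_diff field_simps)
      ultimately show "\<exists>D. ((\<lambda>t. t powr k2 * (L - w t)) has_real_derivative D) (at r) \<and> 0 \<le> D"
        using r y[of r] by (intro exI[of _ "r powr k2 / r * (k2 * (L - w r) - Dw r)"]) auto
    next
      have "((\<lambda>t. t powr k2 * (L - w t)) \<longlongrightarrow> 0 * (L - 0)) (at_right 0)"
        by (intro tendsto_intros powr_tendsto_0 l2 limw)
      then show "((\<lambda>t. t powr k2 * (L - w t)) \<longlongrightarrow> 0) (at_right 0)" by simp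
    qed (use t in auto)
    then show ?thesis using t by (simp add: zero_le_mult_iff)
  qed
  have pos: "u t1 > 0" if t1: "t1 \<ge> 0" for t1
  proof (rule ccontr)
    assume "\<not> u t1 > 0"
    define Z where "Z = {0..t1} \<inter> {t. u t \<le> 0}"
    have "closed {t \<in> {0..t1}. u t \<le> 0}"
      by (intro continuous_on_closed_Collect_le continuous_on_subset[OF cu] continuous_intros) auto
    moreover have "{t \<in> {0..t1}. u t \<le> 0} = Z" by (auto simp: Z_def)
    ultimately have "compact Z" by (auto simp: Z_def intro!: compact_Int_closed[OF compact_Icc] simp: compact_eq_bounded_closed)
    moreover have "Z \<noteq> {}" using \<open>\<not> u t1 > 0\<close> t1 by (auto simp: Z_def)
    \<comment> \<open>The first point where \<open>u \<le> 0\<close>. On \<open>(0, T)\<close> the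
      function \<open>w\<close> is positive and, as shown next, nondecreasing, which contradicts
      \<open>w T \<le> 0\<close>.\<close>
    ultimately obtain T where T: "T \<in> Z" "\<And>t. t \<in> Z \<Longrightarrow> T \<le> t" using compact_attains_inf[of Z] by blast
    have "T \<noteq> 0" using T(1) s u0 by (auto simp: Z_def)
    then have T0: "T > 0" "T \<le> t1" "u T \<le> 0" using T(1) by (auto simp: Z_def)
    have upos: "u t > 0" if "0 < t" "t < T" for t
    proof (rule ccontr)
      assume "\<not> u t > 0"
      then have "t \<in> Z" using that T0 by (auto simp: Z_def)
      then show False using T(2) that by force
    qed
    have J: "Dw t \<ge> 0" if t: "0 < t" "t < T" for t
    proof -
      have "t powr (\<kappa> - 2 * \<alpha>) * Dw t \<ge> 0"
      proof (rule nonneg_of_DERIV_nonneg[where T=T and F="\<lambda>t. t powr (\<kappa> - 2 * \<alpha>) * Dw t"])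
        fix r :: real assume r: "0 < r" "r < T"
        have "((\<lambda>t. t powr (\<kappa> - 2 * \<alpha>) * Dw t) has_real_derivative
           (\<kappa> - 2 * \<alpha>) * r powr (\<kappa> - 2 * \<alpha> - 1) * Dw r
           + ((2 * \<alpha> - \<kappa>) * Dw r + Bc * w r - c * max 0 (w r) powr p) / r * r powr (\<kappa> - 2 * \<alpha>)) (at r)"
          by (intro DERIV_mult has_real_derivative_powr r dDw)
        moreover have "(\<kappa> - 2 * \<alpha>) * r powr (\<kappa> - 2 * \<alpha> - 1) * Dw r
           + ((2 * \<alpha> - \<kappa>) * Dw r + Bc * w r - c * max 0 (w r) powr p) / r * r powr (\<kappa> - 2 * \<alpha>)
           = r powr (\<kappa> - 2 * \<alpha>) / r * (Bc * w r - c * max 0 (w r) powr p)"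
        proof -
          have e: "r powr (\<kappa> - 2 * \<alpha> - 1) = r powr (\<kappa> - 2 * \<alpha>) / r" using r by (simp add: powr_diff[of r "\<kappa> - 2 * \<alpha>" 1])
          show ?thesis unfolding e using r by (simp add: field_simps)
        qed
        \<comment> \<open>For \<open>w > 0\<close> this says
          \<open>c * w^(p-1) \<le> Bc = c * L^(p-1)\<close>; here the comparison
          \<open>w \<le> L\<close> is used.\<close>
        moreover have "Bc * w r - c * max 0 (w r) powr p \<ge> 0"
        proof -
          have wr: "w r > 0" using upos[OF r] r by (simp add: w_def)
          have "w r powr (p - 1) \<le> L powr (p - 1)" using wL[OF r(1)] wr p by (intro powr_mono2) auto
          then have "c * w r powr (p - 1) \<le> Bc" using c Lp by (metis mult_left_mono less_imp_le)
          then have "c * w r powr (p - 1) * w r \<le> Bc * w r" using wr by (intro mult_right_mono) auto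
          then show ?thesis using wr by (simp add: powr_diff)
        qed
        ultimately show "\<exists>D. ((\<lambda>t. t powr (\<kappa> - 2 * \<alpha>) * Dw t) has_real_derivative D) (at r) \<and> 0 \<le> D"
          using r by (intro exI[of _ "r powr (\<kappa> - 2 * \<alpha>) / r * (Bc * w r - c * max 0 (w r) powr p)"]) auto
      next
        have "((\<lambda>t. t powr (\<kappa> - 2 * \<alpha>) * Dw t) \<longlongrightarrow> 0 * 0) (at_right 0)"
          by (intro tendsto_intros powr_tendsto_0 A limDw)
        then show "((\<lambda>t. t powr (\<kappa> - 2 * \<alpha>) * Dw t) \<longlongrightarrow> 0) (at_right 0)" by simp
      qed (use t in auto)
      then show ?thesis using t by (simp add: zero_le_mult_iff)
    qed
    have "w (T/2) \<le> w T"
    proof (rule DERIV_nonneg_imp_increasing_open[where f=w])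
      show "continuous_on {T/2..T} w"
        using T0 by (intro continuous_at_imp_continuous_on ballI DERIV_isCont[OF dw]) auto
      fix x assume x: "T / 2 < x" "x < T"
      then have "x > 0" using T0 by simp
      then show "\<exists>y. DERIV w x :> y \<and> 0 \<le> y" using dw J[of x] x by (intro exI[of _ "Dw x / x"]) auto
    qed (use T0 in auto)
    moreover have "w (T/2) > 0" using upos[of "T/2"] T0 by (simp add: w_def)
    moreover have "w T \<le> 0" using T0 by (simp add: w_def mult_le_0_iff)
    ultimately show False by linarith
  qed
  show ?thesis
  proof (rule that[of u P])
    fix t :: real assume t: "t > 0"
    have ut: "u t > 0" using pos t by simp
    show "(P has_real_derivative t powr \<kappa> * u t powr p) (at t)"
      using dP[OF t] tp[OF t] ut by simp
    \<comment> \<open>Since \<open>\<alpha> * (p - 1) = 1\<close>, the quantity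
      \<open>t * u^(p-1)\<close> equals \<open>w^(p-1)\<close>, and at \<open>w = L\<close> the
      desired bound is the condition \<open>stab\<close>.\<close>
    have "w t powr (p - 1) \<le> L powr (p - 1)" using wL[OF t] ut t p by (intro powr_mono2) (auto simp: w_def)
    moreover have "w t powr (p - 1) = t * u t powr (p - 1)"
      using ut t \<alpha> by (simp add: w_def powr_mult powr_powr)
    ultimately have "(p * c) * (t * u t powr (p - 1)) \<le> (p * c) * L powr (p - 1)"
      using p c by (intro mult_left_mono) auto
    also have "\<dots> = p * Bc" using Lp by simp
    also have "\<dots> \<le> \<kappa>\<^sup>2 / 4" using stab by (simp add: Bc_def)
    finally show "p * c * t * u t powr (p - 1) \<le> \<kappa>\<^sup>2 / 4" by (simp add: mult_ac)
  qed (use u0 cu us pos du P0 P1 in auto)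
qed

section \<open>Test functions built from a solution\<close>

text \<open>The punctured space is exhausted by compact annuli, and the value at the single point 0
  is added at the end.\<close>

lemma loc_integrable_borel_measurable:
  fixes w :: "'a::euclidean_space \<Rightarrow> 'b::euclidean_space"
  assumes "loc_integrable (UNIV - {0}) w"
  shows "w \<in> borel_measurable lebesgue"
proof -
  define K where "K = (\<lambda>n::nat. cball 0 (real (Suc n)) - ball (0::'a) (1 / real (Suc n)))"
  have "compact (K n)" "K n \<subseteq> UNIV - {0}" for n unfolding K_def by (auto intro: compact_diff)
  then have "integrable lebesgue (\<lambda>x. indicator (K n) x *\<^sub>R w x)" for n
    using assms by (auto simp: loc_integrable_def set_integrable_def)
  then have m: "(\<lambda>x. indicator (K n) x *\<^sub>R w x) \<in> borel_measurable lebesgue" for n by auto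
  have "(\<lambda>x. if x = 0 then 0 else w x) \<in> borel_measurable lebesgue"
  proof (rule borel_measurable_LIMSEQ_metric[OF m])
    fix x :: 'a
    show "(\<lambda>n. indicator (K n) x *\<^sub>R w x) \<longlonglongrightarrow> (if x = 0 then 0 else w x)"
    proof (cases "x = 0")
      case False
      obtain m :: nat where m: "real m > max (norm x) (1 / norm x)" using reals_Archimedean2 by blast
      have "x \<in> K n" if "n \<ge> m" for n
      proof -
        have n: "real (Suc n) > norm x" "real (Suc n) > 1 / norm x" using m that by auto
        then have "1 / real (Suc n) \<le> norm x" using False by (simp add: field_simps)
        then show ?thesis using n by (simp add: K_def)
      qed
      then show ?thesis using False by (intro tendsto_eventually eventually_sequentiallyI[of m]) simp
    qed (simp add: K_def)
  qed
  moreover have "(\<lambda>x. indicator {0} x *\<^sub>R w 0) \<in> borel_measurable lebesgue" by (intro borel_measurable_scaleR borel_measurable_indicator borel_measurable_const) auto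
  ultimately have "(\<lambda>x. (if x = 0 then 0 else w x) + indicator {0} x *\<^sub>R w 0) \<in> borel_measurable lebesgue"
    by (rule borel_measurable_add)
  moreover have "(\<lambda>x. (if x = 0 then 0 else w x) + indicator {0} x *\<^sub>R w 0) = w" by (auto simp: fun_eq_iff)
  ultimately show ?thesis by (simp only:)
qed

lemma borel_measurable_norm_powr: "(\<lambda>x::'a::euclidean_space. norm x powr a) \<in> borel_measurable lebesgue"
proof -
  have "(\<lambda>x::'a. norm x powr a) \<in> borel_measurable borel" by measurable
  then show ?thesis by (intro measurable_completion) simp
qed

lemma integrable_norm_powr_mult:
  fixes w :: "'a::euclidean_space \<Rightarrow> real"
  assumes "a > - real DIM('a)" "w \<in> borel_measurable lebesgue" "AE x in lebesgue. \<bar>w x\<bar> \<le> C"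
    and "\<And>x. x \<notin> cball 0 R \<Longrightarrow> w x = 0"
  shows "integrable lebesgue (\<lambda>x. norm x powr a * w x)"
proof -
  have "integrable lebesgue (\<lambda>x. w x *\<^sub>R (indicator (cball 0 R) x * norm x powr a))"
    by (rule integrable_scaleR_bounded[OF integrable_norm_powr_cball[OF assms(1)] assms(2,3)])
  moreover have "w x *\<^sub>R (indicator (cball 0 R) x * norm x powr a) = norm x powr a * w x" for x
    using assms(4)[of x] by (cases "x \<in> cball 0 R") auto
  ultimately show ?thesis by (simp only:)
qed

lemma set_borel_measurable_UNIV: "set_borel_measurable M UNIV f \<longleftrightarrow> f \<in> borel_measurable M"
  for f :: "'a \<Rightarrow> real"
  by (simp add: set_borel_measurable_def)

lemma set_integrable_UNIV: "set_integrable M UNIV f \<longleftrightarrow> integrable M f"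
  for f :: "'a \<Rightarrow> real"
  by (simp add: set_integrable_def)

lemma Linf_loc_UNIV:
  assumes "Linf_loc UNIV v"
  shows "v \<in> borel_measurable lebesgue" "compact K \<Longrightarrow> \<exists>C. AE x in lebesgue. x \<in> K \<longrightarrow> \<bar>v x\<bar> \<le> C"
  using assms by (auto simp: Linf_loc_def set_borel_measurable_UNIV)

lemma powr_half_square: "(x powr (a/2) * y)\<^sup>2 = x powr a * y\<^sup>2" for x y a :: real
  by (simp add: power_mult_distrib powr_power power2_eq_square[of "x powr (a/2)"] powr_add[symmetric])

lemma norm_add_square_le: "(norm (a + b))\<^sup>2 \<le> 2 * (norm a)\<^sup>2 + 2 * (norm b)\<^sup>2"
proof -
  have "(norm (a + b))\<^sup>2 \<le> (norm a + norm b)\<^sup>2" by (intro power_mono norm_triangle_ineq) auto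
  also have "\<dots> \<le> 2 * (norm a)\<^sup>2 + 2 * (norm b)\<^sup>2"
    using zero_le_power2[of "norm a - norm b"] by (simp add: power2_sum power2_diff)
  finally show ?thesis .
qed

text \<open>What a solution offers apart from its equation. The bound \<theta> > -N makes the weight
  locally integrable, so that bounded functions of \<open>v\<close> with compact support belong to
  the weighted L^2 space.\<close>

locale weighted_function =
  fixes \<theta> :: real and v :: "'a::euclidean_space \<Rightarrow> real" and Dv :: "'a \<Rightarrow> 'a"
  assumes Linf: "Linf_loc UNIV v" and H1: "H1w_loc \<theta> UNIV v Dv" and \<theta>: "\<theta> > - real DIM('a)"
begin

lemma weak_gradient_v: "weak_gradient (UNIV - {0}) v Dv" using H1 by (simp add: H1w_loc_def)

lemma measurable_v [measurable]: "v \<in> borel_measurable lebesgue" using Linf_loc_UNIV[OF Linf] by simp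

lemma measurable_Dv [measurable]: "Dv \<in> borel_measurable lebesgue"
  using weak_gradient_v by (intro loc_integrable_borel_measurable) (simp add: weak_gradient_def)

lemma bounded_comp:
  fixes f :: "real \<Rightarrow> real"
  assumes "continuous_on UNIV f"
  obtains C where "C \<ge> 0" "AE x in lebesgue. x \<in> cball 0 R \<longrightarrow> \<bar>f (v x)\<bar> \<le> C"
proof -
  obtain C where C: "AE x in lebesgue. x \<in> cball 0 R \<longrightarrow> \<bar>v x\<bar> \<le> C" using Linf_loc_UNIV(2)[OF Linf compact_cball] by blast
  have "bounded (f ` {-\<bar>C\<bar>..\<bar>C\<bar>})"
    using assms by (auto intro!: compact_imp_bounded compact_continuous_image intro: continuous_on_subset)
  then obtain M where M: "\<forall>t\<in>{-\<bar>C\<bar>..\<bar>C\<bar>}. norm (f t) \<le> M" unfolding bounded_iff by auto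
  show ?thesis
  proof (rule that[of "\<bar>M\<bar>"])
    show "AE x in lebesgue. x \<in> cball 0 R \<longrightarrow> \<bar>f (v x)\<bar> \<le> \<bar>M\<bar>"
      using C
    proof eventually_elim
      case (elim x)
      show ?case
      proof
        assume "x \<in> cball 0 R"
        then have "v x \<in> {-\<bar>C\<bar>..\<bar>C\<bar>}" using elim by (auto simp: abs_le_iff)
        then show "\<bar>f (v x)\<bar> \<le> \<bar>M\<bar>" using M by fastforce
      qed
    qed
  qed simp
qed

lemma bounded_comp_mult:
  fixes f :: "real \<Rightarrow> real" and g :: "'a \<Rightarrow> real"
  assumes "continuous_on UNIV f" "continuous_on UNIV g" "\<And>x. x \<notin> cball 0 R \<Longrightarrow> g x = 0"
  obtains C where "C \<ge> 0" "AE x in lebesgue. \<bar>g x * f (v x)\<bar> \<le> C"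
proof -
  obtain C where C: "C \<ge> 0" "AE x in lebesgue. x \<in> cball 0 R \<longrightarrow> \<bar>f (v x)\<bar> \<le> C" by (rule bounded_comp[OF assms(1)])
  have "bounded (g ` cball 0 R)"
    using assms(2) by (auto intro!: compact_imp_bounded compact_continuous_image intro: continuous_on_subset)
  then obtain M where M: "\<forall>x\<in>cball 0 R. norm (g x) \<le> M" unfolding bounded_iff by auto
  show ?thesis
  proof (rule that[of "\<bar>M\<bar> * C"])
    show "AE x in lebesgue. \<bar>g x * f (v x)\<bar> \<le> \<bar>M\<bar> * C"
      using C(2)
    proof eventually_elim
      case (elim x)
      show ?case
      proof (cases "x \<in> cball 0 R")
        case True
        then have "\<bar>g x\<bar> \<le> \<bar>M\<bar>" using M by fastforce
        then show ?thesis unfolding abs_mult using True elim C(1) by (intro mult_mono) auto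
      qed (use assms(3) C(1) in auto)
    qed
  qed (use C in auto)
qed

lemma measurable_comp: "continuous_on UNIV f \<Longrightarrow> (\<lambda>x. f (v x)) \<in> borel_measurable lebesgue" for f :: "real \<Rightarrow> real"
  using measurable_compose[OF measurable_v, of f borel] by (simp add: borel_measurable_continuous_onI)

lemma integrable_powr_comp:
  fixes f :: "real \<Rightarrow> real" and g :: "'a \<Rightarrow> real"
  assumes "a > - real DIM('a)" "continuous_on UNIV f" "continuous_on UNIV g" "\<And>x. x \<notin> cball 0 R \<Longrightarrow> g x = 0"
  shows "integrable lebesgue (\<lambda>x. norm x powr a * (g x * f (v x)))"
proof -
  obtain C where C: "AE x in lebesgue. \<bar>g x * f (v x)\<bar> \<le> C" by (rule bounded_comp_mult[OF assms(2,3,4)])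
  show ?thesis
    using integrable_norm_powr_mult[OF assms(1) borel_measurable_times[OF borel_measurable_lebesgue_continuous[OF assms(3)] measurable_comp[OF assms(2)]] C, of R] assms(4)
    by simp
qed

lemma integrable_gradient_square: "integrable lebesgue (\<lambda>x. indicator (cball 0 R) x * (norm x powr \<theta> * (norm (Dv x))\<^sup>2))"
proof -
  have "L2_on (cball 0 R) (\<lambda>x. norm x powr (\<theta>/2) * norm (Dv x))" using H1 by (simp add: H1w_loc_def)
  then show ?thesis by (simp add: L2_on_def set_integrable_def powr_half_square)
qed

lemma integrable_gradient_comp:
  fixes f :: "real \<Rightarrow> real" and g :: "'a \<Rightarrow> real"
  assumes "continuous_on UNIV f" "continuous_on UNIV g" "\<And>x. x \<notin> cball 0 R \<Longrightarrow> g x = 0"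
  shows "integrable lebesgue (\<lambda>x. norm x powr \<theta> * (norm (Dv x))\<^sup>2 * (g x * f (v x)))"
proof -
  obtain C where C: "AE x in lebesgue. \<bar>g x * f (v x)\<bar> \<le> C" by (rule bounded_comp_mult[OF assms])
  have "integrable lebesgue (\<lambda>x. (g x * f (v x)) *\<^sub>R (indicator (cball 0 R) x * (norm x powr \<theta> * (norm (Dv x))\<^sup>2)))"
    by (rule integrable_scaleR_bounded[OF integrable_gradient_square borel_measurable_times[OF borel_measurable_lebesgue_continuous[OF assms(2)] measurable_comp[OF assms(1)]] C])
  moreover have "(g x * f (v x)) *\<^sub>R (indicator (cball 0 R) x * (norm x powr \<theta> * (norm (Dv x))\<^sup>2)) = norm x powr \<theta> * (norm (Dv x))\<^sup>2 * (g x * f (v x))" for x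
    using assms(3)[of x] by (cases "x \<in> cball 0 R") auto
  ultimately show ?thesis by (simp only:)
qed

text \<open>Chain rule and product rule give the gradient. Its weighted square is dominated by two
  integrals: one with \<open>|Dv|^2\<close>, finite since \<open>v\<close> is locally in the
  weighted space, and one with \<open>|D\<eta>|^2\<close>, finite since \<open>f (v x)\<close> is
  essentially bounded on balls.\<close>

lemma test_function:
  assumes f: "\<And>t. (f has_real_derivative f' t) (at t)" "continuous_on UNIV f'"
    and \<eta>: "\<And>x. GDERIV \<eta> x :> D\<eta> x" "continuous_on UNIV D\<eta>" "\<And>x. x \<notin> cball 0 R \<Longrightarrow> \<eta> x = 0" "\<And>x. x \<notin> cball 0 R \<Longrightarrow> D\<eta> x = 0"
  shows "H1w_c \<theta> UNIV (\<lambda>x. \<eta> x * f (v x)) (\<lambda>x. \<eta> x *\<^sub>R (f' (v x) *\<^sub>R Dv x) + f (v x) *\<^sub>R D\<eta> x)"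
    and "Linf_loc UNIV (\<lambda>x. \<eta> x * f (v x))"
proof -
  have cf: "continuous_on UNIV f" by (intro continuous_at_imp_continuous_on ballI DERIV_isCont[OF f(1)])
  have c\<eta>: "continuous_on UNIV \<eta>"
    using \<eta>(1) unfolding gderiv_def by (intro continuous_at_imp_continuous_on ballI has_derivative_continuous) auto
  have [measurable]: "\<eta> \<in> borel_measurable lebesgue" "D\<eta> \<in> borel_measurable lebesgue"
    by (auto intro: borel_measurable_lebesgue_continuous c\<eta> \<eta>)
  have [measurable]: "(\<lambda>x. f (v x)) \<in> borel_measurable lebesgue" "(\<lambda>x. f' (v x)) \<in> borel_measurable lebesgue"
    by (auto intro: measurable_comp cf f)
  note [measurable] = borel_measurable_norm_powr
  have wg: "weak_gradient (UNIV - {0}) (\<lambda>x. \<eta> x * f (v x)) (\<lambda>x. \<eta> x *\<^sub>R (f' (v x) *\<^sub>R Dv x) + f (v x) *\<^sub>R D\<eta> x)"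
    by (rule weak_gradient_mult[OF _ weak_gradient_chain[OF weak_gradient_v _ f] \<eta>(1,2)]) (auto intro: Linf_loc_UNIV(2)[OF Linf])
  obtain C where C: "C \<ge> 0" "AE x in lebesgue. \<bar>\<eta> x * f (v x)\<bar> \<le> C" by (rule bounded_comp_mult[OF cf c\<eta> \<eta>(3)])
  show "Linf_loc UNIV (\<lambda>x. \<eta> x * f (v x))"
    unfolding Linf_loc_def set_borel_measurable_UNIV
  proof (intro conjI allI impI)
    show "(\<lambda>x. \<eta> x * f (v x)) \<in> borel_measurable lebesgue" by measurable
    show "\<exists>C. AE x in lebesgue. x \<in> K \<longrightarrow> \<bar>\<eta> x * f (v x)\<bar> \<le> C" for K
      using C(2) by (auto elim: eventually_mono)
  qed
  have i1: "integrable lebesgue (\<lambda>x. norm x powr \<theta> * ((\<eta> x)\<^sup>2 * (f (v x))\<^sup>2))"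
    by (rule integrable_powr_comp[OF \<theta>, where f="\<lambda>s. (f s)\<^sup>2" and g="\<lambda>x. (\<eta> x)\<^sup>2" and R=R]) (auto intro!: continuous_intros cf c\<eta> simp: \<eta>)
  have i2: "integrable lebesgue (\<lambda>x. norm x powr \<theta> * (norm (Dv x))\<^sup>2 * ((\<eta> x)\<^sup>2 * (f' (v x))\<^sup>2))"
    by (rule integrable_gradient_comp[where f="\<lambda>s. (f' s)\<^sup>2" and g="\<lambda>x. (\<eta> x)\<^sup>2" and R=R]) (auto intro!: continuous_intros f c\<eta> simp: \<eta>)
  have i3: "integrable lebesgue (\<lambda>x. norm x powr \<theta> * ((norm (D\<eta> x))\<^sup>2 * (f (v x))\<^sup>2))"
    by (rule integrable_powr_comp[OF \<theta>, where f="\<lambda>s. (f s)\<^sup>2" and g="\<lambda>x. (norm (D\<eta> x))\<^sup>2" and R=R]) (auto intro!: continuous_intros cf \<eta>(2) simp: \<eta>)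
  have "L2_on UNIV (\<lambda>x. norm x powr (\<theta>/2) * (\<eta> x * f (v x)))"
    unfolding L2_on_def set_borel_measurable_UNIV set_integrable_UNIV powr_half_square
    using i1 by (auto simp: power_mult_distrib)
  moreover have "L2_on UNIV (\<lambda>x. norm x powr (\<theta>/2) * norm (\<eta> x *\<^sub>R (f' (v x) *\<^sub>R Dv x) + f (v x) *\<^sub>R D\<eta> x))"
    unfolding L2_on_def set_borel_measurable_UNIV set_integrable_UNIV powr_half_square
  proof (intro conjI)
    show "(\<lambda>x. norm x powr (\<theta> / 2) * norm (\<eta> x *\<^sub>R f' (v x) *\<^sub>R Dv x + f (v x) *\<^sub>R D\<eta> x)) \<in> borel_measurable lebesgue" by measurable
    show "integrable lebesgue (\<lambda>x. norm x powr \<theta> * (norm (\<eta> x *\<^sub>R f' (v x) *\<^sub>R Dv x + f (v x) *\<^sub>R D\<eta> x))\<^sup>2)"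
    proof (rule Bochner_Integration.integrable_bound[OF Bochner_Integration.integrable_add[OF integrable_mult_right[OF i2, of 2] integrable_mult_right[OF i3, of 2]]])
      show "AE x in lebesgue. norm (norm x powr \<theta> * (norm (\<eta> x *\<^sub>R f' (v x) *\<^sub>R Dv x + f (v x) *\<^sub>R D\<eta> x))\<^sup>2)
         \<le> norm (2 * (norm x powr \<theta> * (norm (Dv x))\<^sup>2 * ((\<eta> x)\<^sup>2 * (f' (v x))\<^sup>2)) + 2 * (norm x powr \<theta> * ((norm (D\<eta> x))\<^sup>2 * (f (v x))\<^sup>2)))"
      proof (rule AE_I2)
        fix x
        have "norm x powr \<theta> * (norm (\<eta> x *\<^sub>R f' (v x) *\<^sub>R Dv x + f (v x) *\<^sub>R D\<eta> x))\<^sup>2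
          \<le> norm x powr \<theta> * (2 * (norm (\<eta> x *\<^sub>R f' (v x) *\<^sub>R Dv x))\<^sup>2 + 2 * (norm (f (v x) *\<^sub>R D\<eta> x))\<^sup>2)"
          by (intro mult_left_mono norm_add_square_le) auto
        also have "\<dots> = 2 * (norm x powr \<theta> * (norm (Dv x))\<^sup>2 * ((\<eta> x)\<^sup>2 * (f' (v x))\<^sup>2)) + 2 * (norm x powr \<theta> * ((norm (D\<eta> x))\<^sup>2 * (f (v x))\<^sup>2))"
          by (simp add: power_mult_distrib algebra_simps)
        finally show "norm (norm x powr \<theta> * (norm (\<eta> x *\<^sub>R f' (v x) *\<^sub>R Dv x + f (v x) *\<^sub>R D\<eta> x))\<^sup>2)
         \<le> norm (2 * (norm x powr \<theta> * (norm (Dv x))\<^sup>2 * ((\<eta> x)\<^sup>2 * (f' (v x))\<^sup>2)) + 2 * (norm x powr \<theta> * ((norm (D\<eta> x))\<^sup>2 * (f (v x))\<^sup>2)))" by simp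
      qed
      show "(\<lambda>x. norm x powr \<theta> * (norm (\<eta> x *\<^sub>R f' (v x) *\<^sub>R Dv x + f (v x) *\<^sub>R D\<eta> x))\<^sup>2) \<in> borel_measurable lebesgue" by measurable
    qed
  qed
  ultimately show "H1w_c \<theta> UNIV (\<lambda>x. \<eta> x * f (v x)) (\<lambda>x. \<eta> x *\<^sub>R (f' (v x) *\<^sub>R Dv x) + f (v x) *\<^sub>R D\<eta> x)"
    unfolding H1w_c_def H1w_def using wg \<eta>(3) by (auto intro!: exI[of _ "cball 0 R"])
qed

end

section \<open>The energy inequality for powers of a stable solution\<close>

lemma abs_le_of_square_le:
  fixes X A B e :: real
  assumes "X\<^sup>2 \<le> A * B" "A \<ge> 0" "B \<ge> 0" "e > 0"
  shows "\<bar>X\<bar> \<le> e * A + B / (4 * e)"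
proof -
  have "0 \<le> (e * A - B / (4 * e))\<^sup>2" by simp
  also have "\<dots> = (e * A + B / (4 * e))\<^sup>2 - A * B"
    using assms(4) by (simp add: power2_eq_square field_simps)
  finally have "\<bar>X\<bar>\<^sup>2 \<le> (e * A + B / (4 * e))\<^sup>2" using assms(1) by simp
  then show ?thesis by (rule power2_le_imp_le) (use assms in auto)
qed

text \<open>At \<open>u = 0\<close> all sides vanish because \<open>0 powr b = 0\<close> for every
  \<open>b\<close>; elsewhere these are the laws of exponents together with
  \<open>u^2 = |u|^2\<close>.\<close>

lemma abs_powr_identities:
  fixes u a p :: real
  assumes "a > 0"
  shows "\<bar>u\<bar> powr (p - 1) * u * (\<bar>u\<bar> powr a * u) = \<bar>u\<bar> powr (p + 1 + a)"
    and "(\<bar>u\<bar> powr (a/2) * u)\<^sup>2 = \<bar>u\<bar> powr (a + 2)"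
    and "\<bar>u\<bar> powr (a/2) * (\<bar>u\<bar> powr (a/2) * u) = \<bar>u\<bar> powr a * u"
    and "(\<bar>u\<bar> powr (a/2))\<^sup>2 = \<bar>u\<bar> powr a"
    and "\<bar>u\<bar> powr (p - 1) * \<bar>u\<bar> powr (a + 2) = \<bar>u\<bar> powr (p + 1 + a)"
    and "(\<bar>u\<bar> powr a * u)\<^sup>2 = \<bar>u\<bar> powr a * \<bar>u\<bar> powr (a + 2)"
proof -
  have u2: "u\<^sup>2 = \<bar>u\<bar> powr 2" if "u \<noteq> 0" using that by (simp add: powr_numeral)
  have h: "\<bar>u\<bar> powr (a/2) * \<bar>u\<bar> powr (a/2) = \<bar>u\<bar> powr a" unfolding powr_add[symmetric] by simp
  show 4: "(\<bar>u\<bar> powr (a/2))\<^sup>2 = \<bar>u\<bar> powr a" unfolding power2_eq_square by (rule h)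
  show 3: "\<bar>u\<bar> powr (a/2) * (\<bar>u\<bar> powr (a/2) * u) = \<bar>u\<bar> powr a * u" 
    unfolding mult.assoc[symmetric] h ..
  have e: "\<bar>u\<bar> powr b * u\<^sup>2 = \<bar>u\<bar> powr (b + 2)" for b
  proof (cases "u = 0")
    case False
    show ?thesis by (simp only: u2[OF False] powr_add)
  qed simp
  show "(\<bar>u\<bar> powr (a/2) * u)\<^sup>2 = \<bar>u\<bar> powr (a + 2)" unfolding power_mult_distrib 4 by (rule e)
  show "\<bar>u\<bar> powr (p - 1) * \<bar>u\<bar> powr (a + 2) = \<bar>u\<bar> powr (p + 1 + a)"
    unfolding powr_add[symmetric] by (simp add: algebra_simps)
  have "\<bar>u\<bar> powr (p - 1) * u * (\<bar>u\<bar> powr a * u) = (\<bar>u\<bar> powr (p - 1) * \<bar>u\<bar> powr a) * u\<^sup>2" by (simp add: power2_eq_square)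
  also have "\<dots> = \<bar>u\<bar> powr (p - 1 + a) * u\<^sup>2" by (simp add: powr_add)
  also have "\<dots> = \<bar>u\<bar> powr (p - 1 + a + 2)" by (rule e)
  finally show "\<bar>u\<bar> powr (p - 1) * u * (\<bar>u\<bar> powr a * u) = \<bar>u\<bar> powr (p + 1 + a)" by (simp add: algebra_simps)
  have "(\<bar>u\<bar> powr a * u)\<^sup>2 = \<bar>u\<bar> powr a * (\<bar>u\<bar> powr a * u\<^sup>2)" by (simp add: power2_eq_square)
  then show "(\<bar>u\<bar> powr a * u)\<^sup>2 = \<bar>u\<bar> powr a * \<bar>u\<bar> powr (a + 2)" unfolding e .
qed

text \<open>Here \<alpha>, \<xi>, \<beta> stand for the integrals of
  \<open>|x|^\<theta> \<eta>^2 |v|^a |Dv|^2\<close>, of the cross term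
  \<open>|x|^\<theta> \<eta> |v|^a v (Dv \<bullet> D\<eta>)\<close> and of
  \<open>|x|^\<theta> |v|^(a+2) |D\<eta>|^2\<close>, and \<iota> for the integral of
  \<open>|x|^l \<eta>^2 |v|^(p+1+a)\<close>. The first two premises are the tested equation and
  stability. Eliminating \<iota> leaves the positive multiple \<mu> of \<alpha> on the left, and the
  cross term is absorbed.\<close>

lemma caccioppoli_algebra:
  fixes \<alpha> \<beta> \<xi> \<iota> a p \<mu> :: real
  assumes "(a + 1) * \<alpha> + 2 * \<xi> - \<iota> = 0" "0 \<le> (a/2 + 1)\<^sup>2 * \<alpha> + (a + 2) * \<xi> + \<beta> - p * \<iota>"
    and \<xi>: "\<And>e. e > 0 \<Longrightarrow> \<bar>\<xi>\<bar> \<le> e * \<alpha> + \<beta> / (4 * e)" and "\<alpha> \<ge> 0" "\<beta> \<ge> 0" "a > 0"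
    and \<mu>: "\<mu> = p * (a + 1) - (a/2 + 1)\<^sup>2" "\<mu> > 0" and c: "c = \<bar>a + 2 - 2 * p\<bar> + 1"
  shows "\<iota> \<le> ((a + 2) * (2 / \<mu> * (c\<^sup>2 / (2 * \<mu>) + 1)) + 1) * \<beta>"
proof -
  have c0: "c > 0" using c by simp
  have \<iota>: "\<iota> = (a + 1) * \<alpha> + 2 * \<xi>" using assms(1) by simp
  have "\<mu> * \<alpha> \<le> (a + 2 - 2 * p) * \<xi> + \<beta>"
    using assms(2) unfolding \<iota> \<mu>(1) by (simp add: algebra_simps)
  \<comment> \<open>The parameter \<open>e = \<mu> / (2 * c)\<close> sends exactly half of
    \<open>\<mu> * \<alpha>\<close> back to the left; the summand 1 in \<open>c\<close> keeps
    \<open>c\<close> positive.\<close>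
  also have "(a + 2 - 2 * p) * \<xi> \<le> c * (\<mu> / (2 * c) * \<alpha> + \<beta> / (4 * (\<mu> / (2 * c))))"
  proof -
    have "(a + 2 - 2 * p) * \<xi> \<le> \<bar>a + 2 - 2 * p\<bar> * \<bar>\<xi>\<bar>" by (metis abs_ge_self abs_mult)
    also have "\<dots> \<le> c * (\<mu> / (2 * c) * \<alpha> + \<beta> / (4 * (\<mu> / (2 * c))))"
      using c c0 \<mu>(2) by (intro mult_mono \<xi>) auto
    finally show ?thesis .
  qed
  also have "c * (\<mu> / (2 * c) * \<alpha> + \<beta> / (4 * (\<mu> / (2 * c)))) = \<mu> * \<alpha> / 2 + c\<^sup>2 / (2 * \<mu>) * \<beta>"
    using c0 \<mu>(2) by (simp add: field_simps power2_eq_square)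
  finally have "\<mu> * \<alpha> / 2 \<le> (c\<^sup>2 / (2 * \<mu>) + 1) * \<beta>" by (simp add: algebra_simps)
  then have "2 / \<mu> * (\<mu> * \<alpha> / 2) \<le> 2 / \<mu> * ((c\<^sup>2 / (2 * \<mu>) + 1) * \<beta>)" using \<mu>(2) by (intro mult_left_mono) auto
  moreover have "2 / \<mu> * (\<mu> * \<alpha> / 2) = \<alpha>" using \<mu>(2) by simp
  ultimately have \<alpha>: "\<alpha> \<le> 2 / \<mu> * (c\<^sup>2 / (2 * \<mu>) + 1) * \<beta>" by (simp only: mult.assoc)
  have "2 * \<xi> \<le> \<alpha> + \<beta>" using \<xi>[of "1/2"] by simp
  then have "\<iota> \<le> (a + 2) * \<alpha> + \<beta>" unfolding \<iota> by (simp add: algebra_simps)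
  also have "\<dots> \<le> (a + 2) * (2 / \<mu> * (c\<^sup>2 / (2 * \<mu>) + 1) * \<beta>) + \<beta>"
    using \<alpha> assms(6) by (intro add_mono mult_left_mono) auto
  also have "\<dots> = ((a + 2) * (2 / \<mu> * (c\<^sup>2 / (2 * \<mu>) + 1)) + 1) * \<beta>"
    by (simp only: distrib_right mult.assoc mult_1)
  finally show ?thesis .
qed

text \<open>The convention \<open>0 powr 0 = 0\<close> makes \<open>\<bar>s\<bar> powr a * s\<close> with \<open>a = 0\<close> unsuitable as a test function.\<close>

lemma (in weighted_function) caccioppoli:
  fixes l p a :: real
  assumes l: "l > - real DIM('a)" and p: "p > 1" and a: "a > 0" and \<mu>: "(a/2 + 1)\<^sup>2 < p * (a + 1)"
    and eq: "\<And>\<phi> D\<phi>. H1w_c \<theta> UNIV \<phi> D\<phi> \<Longrightarrow> Linf_loc UNIV \<phi> \<Longrightarrow>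
         (LINT x:UNIV|lebesgue. norm x powr \<theta> * (Dv x \<bullet> D\<phi> x)
            - norm x powr l * \<bar>v x\<bar> powr (p - 1) * v x * \<phi> x) = 0"
    and stab: "is_stable \<theta> l p UNIV v"
  obtains C where "C > 0" "\<And>\<eta> D\<eta>. C1_test_function UNIV \<eta> D\<eta> \<Longrightarrow>
      integrable lebesgue (\<lambda>x. norm x powr l * ((\<eta> x)\<^sup>2 * \<bar>v x\<bar> powr (p + 1 + a)))"
    "\<And>\<eta> D\<eta>. C1_test_function UNIV \<eta> D\<eta> \<Longrightarrow>
      integrable lebesgue (\<lambda>x. norm x powr \<theta> * ((norm (D\<eta> x))\<^sup>2 * \<bar>v x\<bar> powr (a + 2)))"
    "\<And>\<eta> D\<eta>. C1_test_function UNIV \<eta> D\<eta> \<Longrightarrow>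
      (LINT x|lebesgue. norm x powr l * ((\<eta> x)\<^sup>2 * \<bar>v x\<bar> powr (p + 1 + a)))
       \<le> C * (LINT x|lebesgue. norm x powr \<theta> * ((norm (D\<eta> x))\<^sup>2 * \<bar>v x\<bar> powr (a + 2)))"
proof -
  define m where "m = p * (a + 1) - (a/2 + 1)\<^sup>2"
  define c where "c = \<bar>a + 2 - 2 * p\<bar> + 1"
  define C where "C = (a + 2) * (2 / m * (c\<^sup>2 / (2 * m) + 1)) + 1"
  have m: "m > 0" using \<mu> by (simp add: m_def)
  have "C > 0" unfolding C_def using m a by (intro add_nonneg_pos) (auto intro!: mult_nonneg_nonneg)
  have main: "integrable lebesgue (\<lambda>x. norm x powr l * ((\<eta> x)\<^sup>2 * \<bar>v x\<bar> powr (p + 1 + a)))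
    \<and> integrable lebesgue (\<lambda>x. norm x powr \<theta> * ((norm (D\<eta> x))\<^sup>2 * \<bar>v x\<bar> powr (a + 2)))
    \<and> (LINT x|lebesgue. norm x powr l * ((\<eta> x)\<^sup>2 * \<bar>v x\<bar> powr (p + 1 + a)))
       \<le> C * (LINT x|lebesgue. norm x powr \<theta> * ((norm (D\<eta> x))\<^sup>2 * \<bar>v x\<bar> powr (a + 2)))"
    if test: "C1_test_function UNIV \<eta> D\<eta>" for \<eta> D\<eta>
  proof -
    obtain K where K: "compact K" "\<And>x. x \<notin> K \<Longrightarrow> \<eta> x = 0" "\<And>x. x \<notin> K \<Longrightarrow> D\<eta> x = 0"
      using C1_test_support[OF test] by metis
    obtain R where R: "K \<subseteq> cball 0 R"
      using compact_imp_bounded[OF K(1)] by (meson bounded_subset_ballD ball_subset_cball subset_trans)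
    have \<eta>0: "\<eta> x = 0" "D\<eta> x = 0" if "x \<notin> cball 0 R" for x using K(2)[of x] K(3)[of x] R that by blast+
    have gd: "GDERIV \<eta> x :> D\<eta> x" for x using test by (simp add: C1_test_function_def)
    have cD: "continuous_on UNIV D\<eta>" using test by (simp add: C1_test_function_def)
    have c\<eta>: "continuous_on UNIV \<eta>" by (rule C1_test_continuous[OF test])
    define Af where "Af = (\<lambda>x. norm x powr \<theta> * (norm (Dv x))\<^sup>2 * ((\<eta> x)\<^sup>2 * \<bar>v x\<bar> powr a))"
    define Bf where "Bf = (\<lambda>x. norm x powr \<theta> * ((norm (D\<eta> x))\<^sup>2 * \<bar>v x\<bar> powr (a + 2)))"
    define Xf where "Xf = (\<lambda>x. norm x powr \<theta> * (\<eta> x * (\<bar>v x\<bar> powr a * v x) * (Dv x \<bullet> D\<eta> x)))"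
    define If where "If = (\<lambda>x. norm x powr l * ((\<eta> x)\<^sup>2 * \<bar>v x\<bar> powr (p + 1 + a)))"
    have iA: "integrable lebesgue Af" unfolding Af_def
      by (rule integrable_gradient_comp[where f="\<lambda>s. \<bar>s\<bar> powr a" and g="\<lambda>x. (\<eta> x)\<^sup>2" and R=R])
         (auto intro!: continuous_on_abs_powr a continuous_intros c\<eta> simp: \<eta>0)
    have iB: "integrable lebesgue Bf" unfolding Bf_def
      by (rule integrable_powr_comp[OF \<theta>, where f="\<lambda>s. \<bar>s\<bar> powr (a + 2)" and g="\<lambda>x. (norm (D\<eta> x))\<^sup>2" and R=R])
         (use a in \<open>auto intro!: continuous_on_abs_powr continuous_intros cD simp: \<eta>0\<close>)
    have iI: "integrable lebesgue If" unfolding If_def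
      by (rule integrable_powr_comp[OF l, where f="\<lambda>s. \<bar>s\<bar> powr (p + 1 + a)" and g="\<lambda>x. (\<eta> x)\<^sup>2" and R=R])
         (use a p in \<open>auto intro!: continuous_on_abs_powr continuous_intros c\<eta> simp: \<eta>0\<close>)
    have A0: "Af x \<ge> 0" for x by (simp add: Af_def)
    have B0: "Bf x \<ge> 0" for x by (simp add: Bf_def)
    \<comment> \<open>The power of \<open>v\<close> in the cross term is the geometric mean of the
      other two: \<open>(|v|^a v)^2 = |v|^a * |v|^(a+2)\<close>. The gradients are handled by the
      Cauchy-Schwarz inequality.\<close>
    have X2: "(Xf x)\<^sup>2 \<le> Af x * Bf x" for x
    proof -
      have "(Dv x \<bullet> D\<eta> x)\<^sup>2 \<le> (norm (Dv x))\<^sup>2 * (norm (D\<eta> x))\<^sup>2"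
        using Cauchy_Schwarz_ineq[of "Dv x" "D\<eta> x"] by (simp add: power2_norm_eq_inner)
      then have "(norm x powr \<theta>)\<^sup>2 * ((\<eta> x)\<^sup>2 * (\<bar>v x\<bar> powr a * \<bar>v x\<bar> powr (a + 2))) * (Dv x \<bullet> D\<eta> x)\<^sup>2
        \<le> (norm x powr \<theta>)\<^sup>2 * ((\<eta> x)\<^sup>2 * (\<bar>v x\<bar> powr a * \<bar>v x\<bar> powr (a + 2))) * ((norm (Dv x))\<^sup>2 * (norm (D\<eta> x))\<^sup>2)"
        by (intro mult_left_mono) auto
      moreover have "(Xf x)\<^sup>2 = (norm x powr \<theta>)\<^sup>2 * ((\<eta> x)\<^sup>2 * (\<bar>v x\<bar> powr a * v x)\<^sup>2) * (Dv x \<bullet> D\<eta> x)\<^sup>2"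
        by (simp only: Xf_def power_mult_distrib mult.assoc)
      moreover have "Af x * Bf x = (norm x powr \<theta>)\<^sup>2 * ((\<eta> x)\<^sup>2 * (\<bar>v x\<bar> powr a * \<bar>v x\<bar> powr (a + 2))) * ((norm (Dv x))\<^sup>2 * (norm (D\<eta> x))\<^sup>2)"
        by (simp only: Af_def Bf_def power2_eq_square[of "norm x powr \<theta>"] mult_ac)
      ultimately show ?thesis by (simp only: abs_powr_identities(6)[OF a])
    qed
    have Xe: "\<bar>Xf x\<bar> \<le> e * Af x + Bf x / (4 * e)" if "e > 0" for e x
      by (rule abs_le_of_square_le[OF X2 A0 B0 that])
    have mX: "Xf \<in> borel_measurable lebesgue"
    proof -
      have [measurable]: "\<eta> \<in> borel_measurable lebesgue" "D\<eta> \<in> borel_measurable lebesgue"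
        by (auto intro: borel_measurable_lebesgue_continuous c\<eta> cD)
      note [measurable] = borel_measurable_norm_powr
      show ?thesis unfolding Xf_def by measurable
    qed
    have iX: "integrable lebesgue Xf"
    proof (rule Bochner_Integration.integrable_bound[OF Bochner_Integration.integrable_add[OF iA iB] mX])
      show "AE x in lebesgue. norm (Xf x) \<le> norm (Af x + Bf x)"
      proof (rule AE_I2)
        fix x
        have "\<bar>Xf x\<bar> \<le> 1/2 * Af x + Bf x / (4 * (1/2))" by (rule Xe) simp
        then show "norm (Xf x) \<le> norm (Af x + Bf x)" using A0[of x] B0[of x] by simp
      qed
    qed
    \<comment> \<open>The equation tested with \<open>\<eta>^2 |v|^a v\<close>: the coefficient
      \<open>a + 1\<close> comes from differentiating \<open>|s|^a s\<close>, and 2 from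
      differentiating \<open>\<eta>^2\<close>.\<close>
    have E1: "(a + 1) * (LINT x|lebesgue. Af x) + 2 * (LINT x|lebesgue. Xf x) - (LINT x|lebesgue. If x) = 0"
    proof -
      have g2: "GDERIV (\<lambda>x. (\<eta> x)\<^sup>2) x :> (2 * \<eta> x) *\<^sub>R D\<eta> x" for x
      proof -
        have "((\<lambda>s. s\<^sup>2) has_real_derivative 2 * \<eta> x) (at (\<eta> x))" by (auto intro!: derivative_eq_intros)
        from GDERIV_DERIV_compose[OF gd this] show ?thesis .
      qed
      have c2: "continuous_on UNIV (\<lambda>x. (2 * \<eta> x) *\<^sub>R D\<eta> x)" by (intro continuous_intros c\<eta> cD)
      have cf': "continuous_on UNIV (\<lambda>s::real. (a + 1) * \<bar>s\<bar> powr a)" by (intro continuous_intros continuous_on_abs_powr a)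
      note t = test_function[OF DERIV_abs_powr_mult[OF a] cf' g2 c2, of R]
      have "(LINT x:UNIV|lebesgue. norm x powr \<theta> * (Dv x \<bullet> ((\<eta> x)\<^sup>2 *\<^sub>R (((a + 1) * \<bar>v x\<bar> powr a) *\<^sub>R Dv x) + (\<bar>v x\<bar> powr a * v x) *\<^sub>R ((2 * \<eta> x) *\<^sub>R D\<eta> x)))
            - norm x powr l * \<bar>v x\<bar> powr (p - 1) * v x * ((\<eta> x)\<^sup>2 * (\<bar>v x\<bar> powr a * v x))) = 0"
        by (intro eq t) (auto simp: \<eta>0)
      also have "(\<lambda>x. norm x powr \<theta> * (Dv x \<bullet> ((\<eta> x)\<^sup>2 *\<^sub>R (((a + 1) * \<bar>v x\<bar> powr a) *\<^sub>R Dv x) + (\<bar>v x\<bar> powr a * v x) *\<^sub>R ((2 * \<eta> x) *\<^sub>R D\<eta> x)))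
            - norm x powr l * \<bar>v x\<bar> powr (p - 1) * v x * ((\<eta> x)\<^sup>2 * (\<bar>v x\<bar> powr a * v x))) = (\<lambda>x. (a + 1) * Af x + 2 * Xf x - If x)"
      proof
        fix x
        have 1: "norm x powr \<theta> * (Dv x \<bullet> ((\<eta> x)\<^sup>2 *\<^sub>R (((a + 1) * \<bar>v x\<bar> powr a) *\<^sub>R Dv x) + (\<bar>v x\<bar> powr a * v x) *\<^sub>R ((2 * \<eta> x) *\<^sub>R D\<eta> x)))
          = (a + 1) * Af x + 2 * Xf x"
          unfolding inner_add_right inner_scaleR_right Af_def Xf_def power2_norm_eq_inner by (simp only: distrib_left mult_ac)
        have 2: "norm x powr l * \<bar>v x\<bar> powr (p - 1) * v x * ((\<eta> x)\<^sup>2 * (\<bar>v x\<bar> powr a * v x)) = If x"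
          unfolding If_def abs_powr_identities(1)[OF a, of "v x" p, symmetric] by (simp only: mult_ac)
        show "norm x powr \<theta> * (Dv x \<bullet> ((\<eta> x)\<^sup>2 *\<^sub>R (((a + 1) * \<bar>v x\<bar> powr a) *\<^sub>R Dv x) + (\<bar>v x\<bar> powr a * v x) *\<^sub>R ((2 * \<eta> x) *\<^sub>R D\<eta> x)))
            - norm x powr l * \<bar>v x\<bar> powr (p - 1) * v x * ((\<eta> x)\<^sup>2 * (\<bar>v x\<bar> powr a * v x)) = (a + 1) * Af x + 2 * Xf x - If x"
          by (simp only: 1 2)
      qed
      finally have "(LINT x|lebesgue. (a + 1) * Af x + 2 * Xf x - If x) = 0" by (simp add: set_lebesgue_integral_def)
      then show ?thesis
        by (simp only: Bochner_Integration.integral_diff Bochner_Integration.integral_add Bochner_Integration.integrable_add integrable_mult_right integral_mult_right_zero iA iX iI)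
    qed
    \<comment> \<open>Stability tested with \<open>\<eta> |v|^(a/2) v\<close>: the square of the
      gradient is expanded, and the cross coefficient is
      \<open>2 * (a/2 + 1) = a + 2\<close>.\<close>
    have E2: "0 \<le> (a/2 + 1)\<^sup>2 * (LINT x|lebesgue. Af x) + (a + 2) * (LINT x|lebesgue. Xf x) + (LINT x|lebesgue. Bf x) - p * (LINT x|lebesgue. If x)"
    proof -
      have a2: "a/2 > 0" using a by simp
      have cf': "continuous_on UNIV (\<lambda>s::real. (a/2 + 1) * \<bar>s\<bar> powr (a/2))" by (intro continuous_intros continuous_on_abs_powr a2)
      note t = test_function[OF DERIV_abs_powr_mult[OF a2] cf' gd cD, of R]
      have "0 \<le> (LINT x:UNIV|lebesgue. norm x powr \<theta> * (norm (\<eta> x *\<^sub>R (((a/2 + 1) * \<bar>v x\<bar> powr (a/2)) *\<^sub>R Dv x) + (\<bar>v x\<bar> powr (a/2) * v x) *\<^sub>R D\<eta> x))\<^sup>2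
            - p * norm x powr l * \<bar>v x\<bar> powr (p - 1) * (\<eta> x * (\<bar>v x\<bar> powr (a/2) * v x))\<^sup>2)"
        using stab[unfolded is_stable_def] t \<eta>0 by blast
      also have "(\<lambda>x. norm x powr \<theta> * (norm (\<eta> x *\<^sub>R (((a/2 + 1) * \<bar>v x\<bar> powr (a/2)) *\<^sub>R Dv x) + (\<bar>v x\<bar> powr (a/2) * v x) *\<^sub>R D\<eta> x))\<^sup>2
            - p * norm x powr l * \<bar>v x\<bar> powr (p - 1) * (\<eta> x * (\<bar>v x\<bar> powr (a/2) * v x))\<^sup>2)
          = (\<lambda>x. (a/2 + 1)\<^sup>2 * Af x + (a + 2) * Xf x + Bf x - p * If x)"
      proof
        fix x
        have n: "(norm (s *\<^sub>R (r *\<^sub>R y) + q *\<^sub>R z))\<^sup>2 = s\<^sup>2 * (r\<^sup>2 * (norm y)\<^sup>2) + 2 * (s * (r * q) * (y \<bullet> z)) + q\<^sup>2 * (norm z)\<^sup>2" for s r q and y z :: 'a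
          unfolding power2_norm_eq_inner by (simp add: inner_add_left inner_add_right inner_commute[of z y] power2_eq_square algebra_simps)
        have k1: "((a/2 + 1) * \<bar>v x\<bar> powr (a/2))\<^sup>2 = (a/2 + 1)\<^sup>2 * \<bar>v x\<bar> powr a"
          unfolding power_mult_distrib abs_powr_identities(4)[OF a] ..
        have k2: "((a/2 + 1) * \<bar>v x\<bar> powr (a/2)) * (\<bar>v x\<bar> powr (a/2) * v x) = (a/2 + 1) * (\<bar>v x\<bar> powr a * v x)"
          unfolding mult.assoc abs_powr_identities(3)[OF a] ..
        have k3: "(a/2 + 1) * 2 = a + 2" by simp
        have 1: "norm x powr \<theta> * (norm (\<eta> x *\<^sub>R (((a/2 + 1) * \<bar>v x\<bar> powr (a/2)) *\<^sub>R Dv x) + (\<bar>v x\<bar> powr (a/2) * v x) *\<^sub>R D\<eta> x))\<^sup>2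
          = (a/2 + 1)\<^sup>2 * Af x + (a + 2) * Xf x + Bf x"
          unfolding n k1 k2 abs_powr_identities(2)[OF a] Af_def Xf_def Bf_def k3[symmetric] distrib_left by (simp only: mult_ac)
        have 2: "p * norm x powr l * \<bar>v x\<bar> powr (p - 1) * (\<eta> x * (\<bar>v x\<bar> powr (a/2) * v x))\<^sup>2 = p * If x"
          unfolding If_def power_mult_distrib[of "\<eta> x"] abs_powr_identities(2)[OF a] abs_powr_identities(5)[OF a, of "v x" p, symmetric] by (simp only: mult_ac)
        show "norm x powr \<theta> * (norm (\<eta> x *\<^sub>R (((a/2 + 1) * \<bar>v x\<bar> powr (a/2)) *\<^sub>R Dv x) + (\<bar>v x\<bar> powr (a/2) * v x) *\<^sub>R D\<eta> x))\<^sup>2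
            - p * norm x powr l * \<bar>v x\<bar> powr (p - 1) * (\<eta> x * (\<bar>v x\<bar> powr (a/2) * v x))\<^sup>2
          = (a/2 + 1)\<^sup>2 * Af x + (a + 2) * Xf x + Bf x - p * If x" by (simp only: 1 2)
      qed
      finally have "0 \<le> (LINT x|lebesgue. (a/2 + 1)\<^sup>2 * Af x + (a + 2) * Xf x + Bf x - p * If x)" by (simp add: set_lebesgue_integral_def)
      then show ?thesis
        by (simp only: Bochner_Integration.integral_diff Bochner_Integration.integral_add Bochner_Integration.integrable_add integrable_mult_right integral_mult_right_zero iA iB iX iI)
    qed
    have E3: "\<bar>LINT x|lebesgue. Xf x\<bar> \<le> e * (LINT x|lebesgue. Af x) + (LINT x|lebesgue. Bf x) / (4 * e)" if e: "e > 0" for e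
    proof -
      have "\<bar>LINT x|lebesgue. Xf x\<bar> \<le> (LINT x|lebesgue. e * Af x + Bf x / (4 * e))"
        unfolding real_norm_def[symmetric] using iX iA iB Xe[OF e]
        by (intro norm_integral_le AE_I2) auto
      also have "\<dots> = e * (LINT x|lebesgue. Af x) + (LINT x|lebesgue. Bf x) / (4 * e)"
        using iA iB by simp
      finally show ?thesis .
    qed
    have "(LINT x|lebesgue. If x) \<le> C * (LINT x|lebesgue. Bf x)"
      unfolding C_def
      by (rule caccioppoli_algebra[OF E1 E2 E3 _ _ a m_def m c_def]) (auto intro!: Bochner_Integration.integral_nonneg A0 B0)
    then show ?thesis using iI iB unfolding If_def Bf_def by blast
  qed
  show ?thesis by (rule that[OF \<open>C > 0\<close>]) (use main in blast)+
qed

section \<open>Decay of the energy of a stable solution\<close>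

text \<open>Either the left side is at most \<open>\<delta> * h\<close>, or
  \<open>h^(1-\<sigma>) < m / \<delta>\<close>; raising the latter to the power
  \<open>\<sigma> / (1 - \<sigma>)\<close> bounds \<open>h^\<sigma>\<close> by a power of
  \<open>m\<close> alone.\<close>

lemma young_powr:
  fixes h m \<sigma> \<delta> :: real
  assumes "h \<ge> 0" "m \<ge> 0" "0 < \<sigma>" "\<sigma> < 1" "\<delta> > 0"
  shows "h powr \<sigma> * m \<le> \<delta> * h + \<delta> powr (- (\<sigma> / (1 - \<sigma>))) * m powr (1 / (1 - \<sigma>))"
proof (cases "h = 0 \<or> m = 0 \<or> h powr \<sigma> * m \<le> \<delta> * h")
  case True
  have n: "0 \<le> \<delta> powr (- (\<sigma> / (1 - \<sigma>))) * m powr (1 / (1 - \<sigma>))" "0 \<le> \<delta> * h" using assms by auto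
  from True consider "h = 0 \<or> m = 0" | "h powr \<sigma> * m \<le> \<delta> * h" by blast
  then show ?thesis
  proof cases
    case 1 then show ?thesis using n by auto
  next
    case 2 then show ?thesis using n(1) by linarith
  qed
next
  case False
  then have hm: "h > 0" "m > 0" "\<delta> * h < h powr \<sigma> * m" using assms by auto
  have "h = h powr \<sigma> * h powr (1 - \<sigma>)" using hm by (simp add: powr_add[symmetric])
  then have "\<delta> * (h powr \<sigma> * h powr (1 - \<sigma>)) < h powr \<sigma> * m" using hm(3) by simp
  then have "h powr \<sigma> * (\<delta> * h powr (1 - \<sigma>)) < h powr \<sigma> * m" by (simp only: mult.left_commute)
  then have "\<delta> * h powr (1 - \<sigma>) < m" using hm by simp
  then have "h powr (1 - \<sigma>) \<le> m / \<delta>" using assms by (simp add: field_simps)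
  then have "(h powr (1 - \<sigma>)) powr (\<sigma> / (1 - \<sigma>)) \<le> (m / \<delta>) powr (\<sigma> / (1 - \<sigma>))"
    using assms by (intro powr_mono2) auto
  moreover have "(h powr (1 - \<sigma>)) powr (\<sigma> / (1 - \<sigma>)) = h powr \<sigma>" using assms by (simp add: powr_powr)
  ultimately have "h powr \<sigma> * m \<le> (m / \<delta>) powr (\<sigma> / (1 - \<sigma>)) * m" using hm by (intro mult_right_mono) auto
  also have "\<dots> = \<delta> powr (- (\<sigma> / (1 - \<sigma>))) * (m powr (\<sigma> / (1 - \<sigma>)) * m)"
    using hm assms by (simp add: powr_divide powr_minus field_simps)
  also have "m powr (\<sigma> / (1 - \<sigma>)) * m = m powr (\<sigma> / (1 - \<sigma>) + 1)" using hm by (simp add: powr_add)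
  also have "\<sigma> / (1 - \<sigma>) + 1 = 1 / (1 - \<sigma>)" using assms by (simp add: field_simps)
  finally have "h powr \<sigma> * m \<le> \<delta> powr (- (\<sigma> / (1 - \<sigma>))) * m powr (1 / (1 - \<sigma>))" .
  moreover have "0 \<le> \<delta> * h" using assms by simp
  ultimately show ?thesis by linarith
qed

text \<open>The transition takes place where \<open>R^2 \<le> |x|^2 \<le> 2 * R^2\<close>, inside
  the annulus between \<open>R\<close> and \<open>2 * R\<close>, and costs a gradient of order
  \<open>1 / R\<close>.\<close>

lemma radial_step:
  fixes R :: real
  assumes R: "R > 0"
  defines "\<xi> \<equiv> \<lambda>x::'a::euclidean_space. smooth_step (2 - (norm x)\<^sup>2 / R\<^sup>2)"
    and "D\<xi> \<equiv> \<lambda>x::'a. (2 * (smooth_step_deriv (2 - (norm x)\<^sup>2 / R\<^sup>2) * (- 1 / R\<^sup>2))) *\<^sub>R x"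
  shows "GDERIV \<xi> x :> D\<xi> x" "continuous_on UNIV D\<xi>" "norm x \<le> R \<Longrightarrow> \<xi> x = 1" "norm x \<le> R \<Longrightarrow> D\<xi> x = 0"
    "norm x \<ge> 2 * R \<Longrightarrow> \<xi> x = 0" "norm x \<ge> 2 * R \<Longrightarrow> D\<xi> x = 0" "0 \<le> \<xi> x" "\<xi> x \<le> 1"
    "(\<And>t. \<bar>smooth_step_deriv t\<bar> \<le> M) \<Longrightarrow> (norm (D\<xi> x))\<^sup>2 \<le> 16 * M\<^sup>2 / R\<^sup>2"
proof -
  have "((\<lambda>s. smooth_step (2 - s / R\<^sup>2)) has_real_derivative smooth_step_deriv (2 - s / R\<^sup>2) * (- 1 / R\<^sup>2)) (at s)" for s
    by (rule DERIV_chain2[OF DERIV_step], rule DERIV_cong[OF DERIV_diff[OF DERIV_const DERIV_cdivide[OF DERIV_ident]]]) simp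
  from GDERIV_radial[OF this] show "GDERIV \<xi> x :> D\<xi> x" unfolding \<xi>_def D\<xi>_def .
  have "continuous_on UNIV (\<lambda>x::'a. 2 - (norm x)\<^sup>2 / R\<^sup>2)" unfolding divide_inverse by (intro continuous_intros)
  from continuous_on_compose2[OF continuous_on_dstep[of UNIV] this subset_UNIV]
  show "continuous_on UNIV D\<xi>" unfolding D\<xi>_def by (intro continuous_on_scaleR continuous_on_mult continuous_on_const continuous_on_id)
  have "2 - (norm x)\<^sup>2 / R\<^sup>2 \<ge> 1" if "norm x \<le> R"
  proof -
    have "(norm x)\<^sup>2 \<le> R\<^sup>2" using that by (intro power_mono) auto
    then show ?thesis using R by simp
  qed
  then show "norm x \<le> R \<Longrightarrow> \<xi> x = 1" "norm x \<le> R \<Longrightarrow> D\<xi> x = 0" by (auto simp: \<xi>_def D\<xi>_def step_eq dstep_eq)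
  have z: "2 - (norm x)\<^sup>2 / R\<^sup>2 \<le> 0" if "norm x \<ge> 2 * R"
  proof -
    have "(2 * R)\<^sup>2 \<le> (norm x)\<^sup>2" using that R by (intro power_mono) auto
    then have "2 * R\<^sup>2 \<le> (norm x)\<^sup>2" using zero_le_power2[of R] unfolding power_mult_distrib power2_eq_square[of 2] by linarith
    then show ?thesis using R by (simp add: field_simps)
  qed
  then show "norm x \<ge> 2 * R \<Longrightarrow> \<xi> x = 0" "norm x \<ge> 2 * R \<Longrightarrow> D\<xi> x = 0" by (auto simp: \<xi>_def D\<xi>_def step_eq dstep_eq)
  show "0 \<le> \<xi> x" "\<xi> x \<le> 1" by (auto simp: \<xi>_def step_bounds)
  assume M: "\<And>t. \<bar>smooth_step_deriv t\<bar> \<le> M"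
  then have M0: "M \<ge> 0" using abs_ge_zero order_trans by blast
  show "(norm (D\<xi> x))\<^sup>2 \<le> 16 * M\<^sup>2 / R\<^sup>2"
  proof (cases "norm x \<ge> 2 * R")
    case True
    then have "D\<xi> x = 0" using z by (simp add: D\<xi>_def dstep_eq)
    then show ?thesis by simp
  next
    case False
    have "norm (D\<xi> x) = (2 / R\<^sup>2) * (\<bar>smooth_step_deriv (2 - (norm x)\<^sup>2 / R\<^sup>2)\<bar> * norm x)"
      by (simp add: D\<xi>_def abs_mult)
    also have "\<dots> \<le> (2 / R\<^sup>2) * (M * (2 * R))" using False M M0 by (intro mult_left_mono mult_mono) auto
    also have "\<dots> = 4 * M / R" using R by (simp add: power2_eq_square)
    finally have "(norm (D\<xi> x))\<^sup>2 \<le> (4 * M / R)\<^sup>2" by (intro power_mono) auto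
    then show ?thesis by (simp add: power_divide power_mult_distrib)
  qed
qed

text \<open>The exponent may have either sign; the constant \<open>2 powr |b|\<close> covers
  both.\<close>

lemma powr_le_on_annulus:
  fixes r R b :: real
  assumes "0 < R" "R \<le> r" "r \<le> 2 * R"
  shows "r powr b \<le> 2 powr \<bar>b\<bar> * R powr b"
proof -
  have "r powr b = (r / R) powr b * R powr b" using assms by (simp add: powr_divide)
  also have "(r / R) powr b \<le> 2 powr \<bar>b\<bar>"
  proof -
    have "(r / R) powr b \<le> (r / R) powr \<bar>b\<bar>" using assms by (intro powr_mono) auto
    also have "\<dots> \<le> 2 powr \<bar>b\<bar>" using assms by (intro powr_mono2) (auto simp: field_simps)
    finally show ?thesis .
  qed
  finally show ?thesis by (simp add: mult_right_mono)
qed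

text \<open>By the choice of \<sigma>, \<open>|v|^(a+2)\<close> is the power \<sigma> of
  \<open>|v|^(p+1+a)\<close>. So the integrand on the right is at most
  \<open>h^\<sigma> * m\<close>, where \<open>m\<close> carries the remaining weight and the
  gradient on the annulus. Young's inequality absorbs \<open>h\<close>, and what remains is a power
  of \<open>R\<close> with exponent \<open>e < 0\<close>.\<close>

lemma (in weighted_function) energy_decay:
  fixes l p a C \<sigma> :: real
  assumes p: "p > 1" and a: "a > 0" and C: "C > 0" and \<sigma>: "\<sigma> = (a + 2) / (p + 1 + a)"
    and iI: "\<And>\<eta> D\<eta>. C1_test_function UNIV \<eta> D\<eta> \<Longrightarrow>
      integrable lebesgue (\<lambda>x. norm x powr l * ((\<eta> x)\<^sup>2 * \<bar>v x\<bar> powr (p + 1 + a)))"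
    and iB: "\<And>\<eta> D\<eta>. C1_test_function UNIV \<eta> D\<eta> \<Longrightarrow>
      integrable lebesgue (\<lambda>x. norm x powr \<theta> * ((norm (D\<eta> x))\<^sup>2 * \<bar>v x\<bar> powr (a + 2)))"
    and ineq: "\<And>\<eta> D\<eta>. C1_test_function UNIV \<eta> D\<eta> \<Longrightarrow>
      (LINT x|lebesgue. norm x powr l * ((\<eta> x)\<^sup>2 * \<bar>v x\<bar> powr (p + 1 + a)))
       \<le> C * (LINT x|lebesgue. norm x powr \<theta> * ((norm (D\<eta> x))\<^sup>2 * \<bar>v x\<bar> powr (a + 2)))"
    and ex: "real DIM('a) + (\<theta> - l * \<sigma> - 2) / (1 - \<sigma>) < 0"
  shows "AE x in lebesgue. v x = 0"
proof -
  have \<sigma>01: "0 < \<sigma>" "\<sigma> < 1" using a p by (auto simp: \<sigma>)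
  have \<sigma>p: "(p + 1 + a) * \<sigma> = a + 2" using a p by (simp add: \<sigma>)
  obtain M where M: "M > 0" "\<And>t. \<bar>smooth_step_deriv t\<bar> \<le> M" using dstep_bounded by blast
  \<comment> \<open>The cutoff is raised to a power \<open>k\<close> with
    \<open>k * \<sigma> \<le> k - 1\<close>. Then \<open>|D\<eta>|^2\<close>, which carries the
    factor \<open>\<xi>^(2 (k - 1))\<close>, is dominated by a multiple of
    \<open>(\<eta>^2)^\<sigma> |D\<xi>|^2\<close>, as the absorption requires.\<close>
  obtain k0 :: nat where k0: "1 / (1 - \<sigma>) < real k0" using reals_Archimedean2 by blast
  define k where "k = k0 + 2"
  have k2: "k \<ge> 2" by (simp add: k_def)
  have k: "real k * \<sigma> \<le> real k - 1"
  proof -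
    have "1 \<le> real k * (1 - \<sigma>)" using k0 \<sigma>01 by (simp add: k_def field_simps)
    then show ?thesis by (simp add: algebra_simps)
  qed
  define b where "b = \<theta> - l * \<sigma>"
  \<comment> \<open>Half of the energy is then absorbed on the left, which is legitimate because
    \<open>h\<close> is integrable.\<close>
  define \<delta> where "\<delta> = 1 / (2 * C)"
  have \<delta>: "\<delta> > 0" "C * \<delta> = 1/2" using C by (auto simp: \<delta>_def)
  define Q where "Q = (real k)\<^sup>2 * (2 powr \<bar>b\<bar> * (16 * M\<^sup>2))"
  have Q: "Q \<ge> 0" by (simp add: Q_def)
  define q where "q = 1 / (1 - \<sigma>)"
  have q: "q > 0" using \<sigma>01 by (simp add: q_def)
  define E where "E = \<delta> powr (- (\<sigma> / (1 - \<sigma>))) * Q powr q"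
  have E: "E \<ge> 0" by (simp add: E_def)
  define F where "F = 2 * C * (E * (unit_ball_vol (real DIM('a)) * 2 ^ DIM('a)))"
  \<comment> \<open>\<open>R^N\<close> is the order of the volume of the ball, and
    \<open>R^(b-2)\<close> that of \<open>|x|^b |D\<xi>|^2\<close> on the annulus, raised to the
    power \<open>q\<close> by Young's inequality.\<close>
  define e where "e = real DIM('a) + (b - 2) * q"
  have e: "e < 0" using ex by (simp add: e_def b_def q_def)
  define g where "g = (\<lambda>R0 x. indicator (cball 0 R0) x * (norm x powr l * \<bar>v x\<bar> powr (p + 1 + a)))"
  \<comment> \<open>Two radii: \<open>R0\<close> stays fixed while \<open>R\<close> tends to
    infinity.\<close>
  have main: "(integrable lebesgue (g R)) \<and> (LINT x|lebesgue. g R0 x) \<le> F * R powr e" if R: "R \<ge> 1" "R \<ge> R0" for R R0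
  proof -
    have R0: "R > 0" using R by simp
    define \<xi> where "\<xi> = (\<lambda>x::'a. smooth_step (2 - (norm x)\<^sup>2 / R\<^sup>2))"
    define D\<xi> where "D\<xi> = (\<lambda>x::'a. (2 * (smooth_step_deriv (2 - (norm x)\<^sup>2 / R\<^sup>2) * (- 1 / R\<^sup>2))) *\<^sub>R x)"
    note rs = radial_step[OF R0, where 'a='a]
    have \<xi>: "GDERIV \<xi> x :> D\<xi> x" "continuous_on UNIV D\<xi>" "norm x \<le> R \<Longrightarrow> \<xi> x = 1" "norm x \<le> R \<Longrightarrow> D\<xi> x = 0"
      "norm x \<ge> 2 * R \<Longrightarrow> \<xi> x = 0" "norm x \<ge> 2 * R \<Longrightarrow> D\<xi> x = 0" "0 \<le> \<xi> x" "\<xi> x \<le> 1"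
      "(norm (D\<xi> x))\<^sup>2 \<le> 16 * M\<^sup>2 / R\<^sup>2" for x
      unfolding \<xi>_def D\<xi>_def by (rule rs | assumption | rule M(2))+
    define \<eta> where "\<eta> = (\<lambda>x. \<xi> x ^ k)"
    define D\<eta> where "D\<eta> = (\<lambda>x. (real k * \<xi> x ^ (k - 1)) *\<^sub>R D\<xi> x)"
    have c\<xi>: "continuous_on UNIV \<xi>"
      using \<xi>(1) unfolding gderiv_def by (intro continuous_at_imp_continuous_on ballI has_derivative_continuous) auto
    have test: "C1_test_function UNIV \<eta> D\<eta>"
      unfolding C1_test_function_def
    proof (intro conjI allI)
      show "GDERIV \<eta> x :> D\<eta> x" for x
      proof -
        have "((\<lambda>s. s ^ k) has_real_derivative real k * \<xi> x ^ (k - 1)) (at (\<xi> x))" by (auto intro!: derivative_eq_intros)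
        from GDERIV_DERIV_compose[OF \<xi>(1) this] show ?thesis unfolding \<eta>_def D\<eta>_def .
      qed
      show "continuous_on UNIV D\<eta>" unfolding D\<eta>_def by (intro continuous_intros c\<xi> \<xi>(2))
      show "\<exists>K. compact K \<and> K \<subseteq> UNIV \<and> (\<forall>x. x \<notin> K \<longrightarrow> \<eta> x = 0)"
        by (rule exI[of _ "cball 0 (2 * R)"]) (use \<xi>(5) k2 in \<open>auto simp: \<eta>_def\<close>)
    qed
    define h where "h = (\<lambda>x. norm x powr l * ((\<eta> x)\<^sup>2 * \<bar>v x\<bar> powr (p + 1 + a)))"
    define B where "B = (\<lambda>x. norm x powr \<theta> * ((norm (D\<eta> x))\<^sup>2 * \<bar>v x\<bar> powr (a + 2)))"
    have ih: "integrable lebesgue h" and iBB: "integrable lebesgue B" and hB: "(LINT x|lebesgue. h x) \<le> C * (LINT x|lebesgue. B x)"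
      unfolding h_def B_def using iI[OF test] iB[OF test] ineq[OF test] by auto
    have h0: "h x \<ge> 0" for x by (simp add: h_def)
    have pt: "B x \<le> \<delta> * h x + E * R powr ((b - 2) * q) * indicator (cball 0 (2 * R)) x" if x: "x \<noteq> 0" for x
    proof (cases "norm x \<le> R \<or> norm x \<ge> 2 * R")
      case True
      then have "D\<xi> x = 0" using \<xi>(4,6) by blast
      then have "B x = 0" by (simp add: B_def D\<eta>_def)
      moreover have "0 \<le> E * R powr ((b - 2) * q) * indicator (cball 0 (2 * R)) x" using E by simp
      moreover have "0 \<le> \<delta> * h x" using \<delta> h0 by simp
      ultimately show ?thesis by linarith
    next
      case False
      define m where "m = (real k)\<^sup>2 * (norm x powr b * (norm (D\<xi> x))\<^sup>2)"
      have m0: "m \<ge> 0" by (simp add: m_def)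
      have mQ: "m \<le> Q * R powr (b - 2)"
      proof -
        have "m \<le> (real k)\<^sup>2 * ((2 powr \<bar>b\<bar> * R powr b) * (16 * M\<^sup>2 / R\<^sup>2))"
          unfolding m_def using False R0 by (intro mult_left_mono mult_mono powr_le_on_annulus \<xi>(9)) auto
        also have "\<dots> = Q * R powr (b - 2)" using R0 by (simp add: Q_def powr_diff powr_numeral)
        finally show ?thesis .
      qed
      have kk: "(\<xi> x ^ (k - 1))\<^sup>2 \<le> ((\<eta> x)\<^sup>2) powr \<sigma>"
      proof (cases "\<xi> x = 0")
        case True
        then show ?thesis using k2 by (simp add: power_0_left)
      next
        case False
        then have x01: "0 < \<xi> x" "\<xi> x \<le> 1" using \<xi>(7,8)[of x] by auto
        have "(\<xi> x ^ (k - 1))\<^sup>2 = \<xi> x powr real ((k - 1) * 2)"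
          unfolding powr_realpow[OF x01(1)] power_mult ..
        also have "real ((k - 1) * 2) = 2 * (real k - 1)" using k2 by (simp add: of_nat_diff)
        also have "\<xi> x powr (2 * (real k - 1)) \<le> \<xi> x powr (2 * (real k * \<sigma>))" using x01 k by (intro powr_mono') auto
        also have "2 * (real k * \<sigma>) = real (k * 2) * \<sigma>" by simp
        also have "\<xi> x powr (real (k * 2) * \<sigma>) = ((\<eta> x)\<^sup>2) powr \<sigma>"
          unfolding powr_powr[symmetric] powr_realpow[OF x01(1)] power_mult \<eta>_def ..
        finally show ?thesis .
      qed
      have hs: "h x powr \<sigma> = norm x powr (l * \<sigma>) * (((\<eta> x)\<^sup>2) powr \<sigma> * \<bar>v x\<bar> powr (a + 2))"
        unfolding h_def by (simp add: powr_mult powr_powr \<sigma>p)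
      have "B x = norm x powr \<theta> * \<bar>v x\<bar> powr (a + 2) * ((real k)\<^sup>2 * (norm (D\<xi> x))\<^sup>2) * (\<xi> x ^ (k - 1))\<^sup>2"
      proof -
        have "(norm (D\<eta> x))\<^sup>2 = (real k)\<^sup>2 * (\<xi> x ^ (k - 1))\<^sup>2 * (norm (D\<xi> x))\<^sup>2"
          unfolding D\<eta>_def norm_scaleR power_mult_distrib power2_abs ..
        then show ?thesis by (simp only: B_def mult_ac)
      qed
      also have "\<dots> \<le> norm x powr \<theta> * \<bar>v x\<bar> powr (a + 2) * ((real k)\<^sup>2 * (norm (D\<xi> x))\<^sup>2) * ((\<eta> x)\<^sup>2) powr \<sigma>"
        by (intro mult_left_mono kk) auto
      also have "\<dots> = h x powr \<sigma> * m"
      proof -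
        have "norm x powr \<theta> = norm x powr (l * \<sigma>) * norm x powr b" by (simp add: b_def powr_add[symmetric])
        then show ?thesis unfolding hs m_def by (simp only: mult_ac)
      qed
      also have "\<dots> \<le> \<delta> * h x + \<delta> powr (- (\<sigma> / (1 - \<sigma>))) * m powr (1 / (1 - \<sigma>))"
        by (rule young_powr[OF h0 m0 \<sigma>01 \<delta>(1)])
      also have "\<dots> \<le> \<delta> * h x + \<delta> powr (- (\<sigma> / (1 - \<sigma>))) * (Q * R powr (b - 2)) powr q"
        unfolding q_def[symmetric] using m0 mQ q by (intro add_left_mono mult_left_mono powr_mono2) auto
      also have "\<dots> = \<delta> * h x + E * R powr ((b - 2) * q) * indicator (cball 0 (2 * R)) x"
        using False Q R0 by (simp add: E_def powr_mult powr_powr)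
      finally show ?thesis .
    qed
    have iC: "integrable lebesgue (\<lambda>x::'a. E * R powr ((b - 2) * q) * indicator (cball 0 (2 * R)) x)"
      by (intro integrable_mult_right integrable_indicator_cball)
    have "(LINT x|lebesgue. B x) \<le> (LINT x|lebesgue. \<delta> * h x + E * R powr ((b - 2) * q) * indicator (cball 0 (2 * R)) x)"
      using pt by (intro integral_mono_AE iBB Bochner_Integration.integrable_add integrable_mult_right ih iC eventually_mono[OF AE_nonzero])
    also have "\<dots> = \<delta> * (LINT x|lebesgue. h x) + (LINT x::'a|lebesgue. E * R powr ((b - 2) * q) * indicator (cball 0 (2 * R)) x)"
      by (simp only: Bochner_Integration.integral_add[OF integrable_mult_right[OF ih] iC] integral_mult_right_zero)
    also have "(LINT x::'a|lebesgue. E * R powr ((b - 2) * q) * indicator (cball 0 (2 * R)) x) = E * R powr ((b - 2) * q) * (unit_ball_vol (real DIM('a)) * (2 * R) ^ DIM('a))"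
      using content_cball[of "2 * R" "0::'a"] R0 by simp
    also have "\<dots> = E * (unit_ball_vol (real DIM('a)) * 2 ^ DIM('a)) * R powr e"
      using R0 by (simp add: e_def powr_add powr_realpow power_mult_distrib)
    finally have "C * (LINT x|lebesgue. B x) \<le> C * (\<delta> * (LINT x|lebesgue. h x) + E * (unit_ball_vol (real DIM('a)) * 2 ^ DIM('a)) * R powr e)"
      using C by (intro mult_left_mono) auto
    also have "\<dots> = (C * \<delta>) * (LINT x|lebesgue. h x) + F * R powr e / 2" by (simp add: F_def algebra_simps)
    finally have hF: "(LINT x|lebesgue. h x) \<le> F * R powr e" using hB unfolding \<delta>(2) by linarith
    have gh: "g R x \<le> h x" "g R0 x \<le> g R x" "0 \<le> g R0 x" "0 \<le> g R x" for x
    proof -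
      show "g R x \<le> h x"
      proof (cases "x \<in> cball 0 R")
        case True
        then have "\<eta> x = 1" using \<xi>(3)[of x] by (simp add: \<eta>_def)
        then show ?thesis using True by (simp add: g_def h_def)
      qed (use h0[of x] in \<open>simp add: g_def\<close>)
      show "0 \<le> g R0 x" "0 \<le> g R x" by (auto simp: g_def)
      show "g R0 x \<le> g R x" unfolding g_def using R by (intro mult_right_mono) (auto simp: indicator_def)
    qed
    have mg: "g R \<in> borel_measurable lebesgue" for R
      unfolding g_def using p a
      by (intro borel_measurable_times borel_measurable_norm_powr borel_measurable_indicator measurable_comp[of "\<lambda>s. \<bar>s\<bar> powr (p + 1 + a)"] continuous_on_abs_powr) auto
    have ig: "integrable lebesgue (g R)"
      by (rule Bochner_Integration.integrable_bound[OF ih mg]) (use gh h0 in \<open>auto intro!: AE_I2\<close>)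
    have "(LINT x|lebesgue. g R0 x) \<le> (LINT x|lebesgue. h x)"
    proof (rule integral_mono)
      show "integrable lebesgue (g R0)"
        by (rule Bochner_Integration.integrable_bound[OF ig mg]) (use gh in \<open>auto intro!: AE_I2\<close>)
      show "g R0 x \<le> h x" for x using gh[of x] by linarith
    qed (rule ih)
    with hF ig show ?thesis by linarith
  qed
  have z: "(LINT x|lebesgue. g (real n) x) \<le> 0" for n
  proof -
    have "((\<lambda>R. F * R powr e) \<longlongrightarrow> F * 0) at_top"
      using e by (intro tendsto_mult tendsto_const tendsto_neg_powr filterlim_ident)
    then have "((\<lambda>R. F * R powr e) \<longlongrightarrow> 0) at_top" by simp
    moreover have "\<forall>\<^sub>F R in at_top. (LINT x|lebesgue. g (real n) x) \<le> F * R powr e"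
      using eventually_ge_at_top[of 1] eventually_ge_at_top[of "real n"]
      by eventually_elim (use main in blast)
    ultimately show ?thesis by (intro tendsto_lowerbound) auto
  qed
  have "AE x in lebesgue. g (real n) x = 0" for n
  proof -
    \<comment> \<open>The estimate requires a radius of at least 1, hence \<open>Suc n\<close>; the
      claim for \<open>n\<close> follows because its ball is smaller.\<close>
    have i: "integrable lebesgue (g (real (Suc n)))" using main[of "real (Suc n)" 0] by simp
    have g0: "0 \<le> g (real (Suc n)) x" for x by (simp add: g_def)
    have "0 \<le> (LINT x|lebesgue. g (real (Suc n)) x)" by (rule Bochner_Integration.integral_nonneg) (rule g0)
    then have "(LINT x|lebesgue. g (real (Suc n)) x) = 0" using z[of "Suc n"] by linarith
    moreover have "AE x in lebesgue. 0 \<le> g (real (Suc n)) x" by (intro AE_I2 g0)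
    ultimately have "AE x in lebesgue. g (real (Suc n)) x = 0"
      using integral_nonneg_eq_0_iff_AE[OF i] by blast
    then show ?thesis
    proof eventually_elim
      case (elim x)
      show ?case
      proof (cases "x \<in> cball 0 (real n)")
        case True
        then have "x \<in> cball 0 (real (Suc n))" by simp
        then have "norm x powr l * \<bar>v x\<bar> powr (p + 1 + a) = 0"
          using elim unfolding g_def by (simp only: indicator_simps mult_1)
        then show ?thesis unfolding g_def by (simp only: mult_zero_right)
      qed (simp add: g_def)
    qed
  qed
  then have "AE x in lebesgue. \<forall>n. g (real n) x = 0" by (simp add: AE_all_countable)
  then show ?thesis
    using AE_nonzero
  proof eventually_elim
    case (elim x)
    obtain n :: nat where "norm x \<le> real n" using real_arch_simple by blast
    then have "x \<in> cball 0 (real n)" by simp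
    moreover have "g (real n) x = 0" using elim(1) by blast
    ultimately have "norm x powr l * \<bar>v x\<bar> powr (p + 1 + a) = 0"
      unfolding g_def by (simp only: indicator_simps mult_1)
    then show "v x = 0" using elim(2) by auto
  qed
qed

text \<open>Up to powers of \<open>2 + \<tau>\<close>, the denominator of the critical power is
  \<open>y\<^sup>2 - 4y = (y - 1 - r)(y - 1 + r)\<close>, and the second factor cancels.\<close>

lemma p_crit_eq:
  fixes N' \<tau> :: real
  assumes "\<tau> > -2" "N' > 10 + 4 * \<tau>"
  defines "y \<equiv> (N' - 2) / (2 + \<tau>)"
  defines "r \<equiv> sqrt (2 * y + 1)"
  shows "y > 4" "y - 1 - r > 0" "p_crit N' \<tau> = ereal (1 + 2 / (y - 1 - r))"
proof -
  define m where "m = 2 + \<tau>"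
  have m: "m > 0" using assms by (simp add: m_def)
  have N': "N' = y * m + 2" using m by (simp add: y_def m_def)
  have \<tau>: "\<tau> = m - 2" by (simp add: m_def)
  show y: "y > 4" using assms(2) m unfolding N' \<tau> by (simp add: algebra_simps)
  have r2: "r\<^sup>2 = 2 * y + 1" using y by (simp add: r_def)
  have r0: "r > 0" using y by (simp add: r_def)
  have prod: "(y - 1 - r) * (y - 1 + r) = y * (y - 4)"
  proof -
    have "(y - 1 - r) * (y - 1 + r) = (y - 1)\<^sup>2 - r\<^sup>2" by (simp add: power2_eq_square algebra_simps)
    then show ?thesis unfolding r2 by (simp add: power2_eq_square algebra_simps)
  qed
  have "(y - 1 - r) * (y - 1 + r) > 0" unfolding prod using y by simp
  then show d: "y - 1 - r > 0" using y r0 by (simp add: zero_less_mult_iff)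
  have s: "sqrt ((2 + \<tau>) * (2 * N' + \<tau> - 2)) = m * r"
  proof -
    have "(2 + \<tau>) * (2 * N' + \<tau> - 2) = m\<^sup>2 * (2 * y + 1)" unfolding N' \<tau> by (simp add: power2_eq_square algebra_simps)
    then show ?thesis using m by (simp add: r_def real_sqrt_mult)
  qed
  have num: "(N' - 2)\<^sup>2 - 2 * (2 + \<tau>) * (N' + \<tau>) + 2 * (2 + \<tau>) * (m * r) = m\<^sup>2 * (y * (y - 4) + 2 * (y - 1 + r))"
    unfolding N' \<tau> by (simp add: power2_eq_square algebra_simps)
  have den: "(N' - 2) * (N' - 4 * \<tau> - 10) = m\<^sup>2 * (y * (y - 4))"
    unfolding N' \<tau> by (simp add: power2_eq_square algebra_simps)
  have ne: "y * (y - 4) \<noteq> 0" "y - 1 + r \<noteq> 0" "y - 1 - r \<noteq> 0" using y r0 d by auto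
  have "m\<^sup>2 * (y * (y - 4) + 2 * (y - 1 + r)) / (m\<^sup>2 * (y * (y - 4))) = (y * (y - 4) + 2 * (y - 1 + r)) / (y * (y - 4))"
    using m by simp
  also have "\<dots> = 1 + 2 * (y - 1 + r) / (y * (y - 4))" using ne by (simp add: add_divide_distrib)
  also have "\<dots> = 1 + 2 / (y - 1 - r)"
  proof -
    have "2 * b / (a * b) = 2 / a" if "b \<noteq> 0" for a b :: real using that by simp
    from this[OF ne(2)] show ?thesis unfolding prod[symmetric] by (simp only:)
  qed
  finally have val: "m\<^sup>2 * (y * (y - 4) + 2 * (y - 1 + r)) / (m\<^sup>2 * (y * (y - 4))) = 1 + 2 / (y - 1 - r)" .
  have "\<not> N' \<le> 10 + 4 * \<tau>" using assms(2) by simp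
  then show "p_crit N' \<tau> = ereal (1 + 2 / (y - 1 - r))"
    unfolding p_crit_def by (simp only: if_False s num den val)
qed

text \<open>\<open>2 * (p + sqrt (p^2 - p))\<close> is the supremum of \<open>a + 2\<close> over the
  exponents with \<open>(a/2 + 1)^2 < p * (a + 1)\<close>. So the conclusion says that the decay
  exponent is negative for admissible \<open>a\<close> close to the upper end.\<close>

lemma subcritical_exponent:
  fixes N' \<tau> p :: real
  assumes "\<tau> > -2" "N' > 2"
    and "(N' \<le> 10 + 4 * \<tau> \<and> p > 1) \<or> (N' > 10 + 4 * \<tau> \<and> 1 < p \<and> ereal p < p_crit N' \<tau>)"
  shows "p > 1" "(N' - 2) * (p - 1) < (2 + \<tau>) * (2 * (p + sqrt (p\<^sup>2 - p)))"
proof -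
  show p: "p > 1" using assms(3) by auto
  define m where "m = 2 + \<tau>"
  have m: "m > 0" using assms by (simp add: m_def)
  define y where "y = (N' - 2) / (2 + \<tau>)"
  have N': "N' - 2 = y * m" using m by (simp add: y_def m_def)
  define S where "S = sqrt (p\<^sup>2 - p)"
  have pp: "p\<^sup>2 - p = p * (p - 1)" by (simp add: power2_eq_square algebra_simps)
  have S0: "S > 0" using p by (simp add: S_def pp)
  have S2: "S\<^sup>2 = p\<^sup>2 - p" using p by (simp add: S_def pp)
  have "y * (p - 1) < 2 * (p + S)"
  proof (cases "N' \<le> 10 + 4 * \<tau>")
    case True
    have "y * m \<le> 4 * m" using True N' by (simp add: m_def)
    then have "y \<le> 4" using m by simp
    then have "y * (p - 1) \<le> 4 * (p - 1)" using p by (intro mult_right_mono) auto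
    \<comment> \<open>As \<open>4 * (p - 1) = 2 * (p + (p - 2))\<close>, this comparison settles the
      case \<open>y \<le> 4\<close> for all \<open>p > 1\<close>.\<close>
    moreover have "p - 2 < S"
    proof (cases "p \<ge> 2")
      case True
      have "(p - 2)\<^sup>2 < S\<^sup>2" unfolding S2 using True by (simp add: power2_eq_square algebra_simps)
      then show ?thesis using S0 by (intro power2_less_imp_less[of "p - 2" S]) auto
    qed (use S0 in auto)
    ultimately show ?thesis by simp
  next
    case False
    then have N10: "N' > 10 + 4 * \<tau>" by simp
    define r where "r = sqrt (2 * y + 1)"
    have P: "y > 4" "y - 1 - r > 0" "p_crit N' \<tau> = ereal (1 + 2 / (y - 1 - r))"
      using p_crit_eq[OF assms(1) N10] unfolding r_def y_def by blast+
    have "p < 1 + 2 / (y - 1 - r)" using assms(3) N10 P(3) by auto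
    then have q: "(p - 1) * (y - 1 - r) < 2" using P(2) by (simp add: field_simps)
    have r2: "r\<^sup>2 = 2 * y + 1" using P(1) by (simp add: r_def)
    have r1: "r > 1" using P(1) by (simp add: r_def)
    have "((p - 1) * (r - 1))\<^sup>2 \<le> (2 * S)\<^sup>2"
    proof -
      \<comment> \<open>A rewriting of \<open>r^2 = 2 * y + 1\<close>. It converts the bound on
        \<open>(p - 1) * (y - 1 - r)\<close> into one on \<open>(p - 1) * (r - 1)\<close>, and
        together they bound \<open>y * (p - 1)\<close>.\<close>
      have "(r - 1)\<^sup>2 = 4 + 2 * (y - 1 - r)" using r2 by (simp add: power2_eq_square algebra_simps)
      then have "((p - 1) * (r - 1))\<^sup>2 = (p - 1) * (4 * (p - 1) + 2 * ((p - 1) * (y - 1 - r)))"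
        by (simp add: power_mult_distrib power2_eq_square algebra_simps)
      also have "\<dots> \<le> (p - 1) * (4 * (p - 1) + 2 * 2)" using p q by (intro mult_left_mono) auto
      also have "\<dots> = (2 * S)\<^sup>2" unfolding power_mult_distrib S2 by (simp add: power2_eq_square algebra_simps)
      finally show ?thesis .
    qed
    then have "(p - 1) * (r - 1) \<le> 2 * S" by (rule power2_le_imp_le) (use S0 in auto)
    moreover have "y * (p - 1) = (p - 1) * (y - 1 - r) + (p - 1) * (r - 1) + 2 * (p - 1)" by (simp add: algebra_simps)
    ultimately show ?thesis using q by simp
  qed
  then have "m * (y * (p - 1)) < m * (2 * (p + S))" using m by (intro mult_strict_left_mono) auto
  then show "(N' - 2) * (p - 1) < (2 + \<tau>) * (2 * (p + sqrt (p\<^sup>2 - p)))"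
    unfolding N' S_def[symmetric] m_def[symmetric] by (simp add: mult_ac)
qed

section \<open>Nonexistence below the critical power\<close>

lemma stable_solution_zero:
  fixes v :: "'a::euclidean_space \<Rightarrow> real"
  assumes N': "N' = real DIM('a) + \<theta>" and \<tau>: "\<tau> = l - \<theta>" and "N' > 2" "\<tau> > -2"
    and sub: "(N' \<le> 10 + 4 * \<tau> \<and> p > 1) \<or> (N' > 10 + 4 * \<tau> \<and> 1 < p \<and> ereal p < p_crit N' \<tau>)"
    and sol: "solution \<theta> l p UNIV v" and stab: "is_stable \<theta> l p UNIV v"
  shows "AE x in lebesgue. v x = 0"
proof -
  obtain Dv where L: "Linf_loc UNIV v" and H: "H1w_loc \<theta> UNIV v Dv" and
    eq: "\<And>\<phi> D\<phi>. H1w_c \<theta> UNIV \<phi> D\<phi> \<Longrightarrow> Linf_loc UNIV \<phi> \<Longrightarrow>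
         (LINT x:UNIV|lebesgue. norm x powr \<theta> * (Dv x \<bullet> D\<phi> x)
            - norm x powr l * \<bar>v x\<bar> powr (p - 1) * v x * \<phi> x) = 0"
    using sol unfolding solution_def by blast
  interpret weighted_function \<theta> v Dv
    by unfold_locales (use L H assms in auto)
  have l: "l > - real DIM('a)" using assms by auto
  note S = subcritical_exponent[OF \<open>\<tau> > -2\<close> \<open>N' > 2\<close> sub]
  have p: "p > 1" by (rule S(1))
  define s where "s = sqrt (p\<^sup>2 - p)"
  have pp: "p\<^sup>2 - p = p * (p - 1)" by (simp add: power2_eq_square algebra_simps)
  have s: "s > 0" "s\<^sup>2 = p\<^sup>2 - p" using p by (auto simp: s_def pp)
  have m: "2 + \<tau> > 0" using assms by simp
    \<comment> \<open>In terms of \<open>A = a + 2\<close>, decay of the energy requires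
      \<open>A > X\<close>, and admissibility of \<open>a\<close> requires
      \<open>|A / 2 - p| < s\<close>.\<close>
    define X where "X = (N' - 2) * (p - 1) / (2 + \<tau>)"
  have lt: "X < 2 * (p + s)" unfolding X_def using S(2) m by (simp add: s_def field_simps)
  \<comment> \<open>The midpoint between \<open>X\<close> and the upper end
    \<open>2 * (p + s)\<close> of the admissible interval, moved up to the centre
    \<open>2 * p\<close> of that interval if it lies below. So \<open>A\<close> meets both
    conditions, and \<open>a = A - 2\<close> is positive.\<close>
  define A where "A = max (2 * p) ((X + 2 * (p + s)) / 2)"
  have A1: "A \<ge> 2 * p" by (simp add: A_def)
  have A2: "A < 2 * (p + s)" unfolding A_def using lt s(1) by auto
  have "X < (X + 2 * (p + s)) / 2" using lt by simp
  also have "\<dots> \<le> A" by (simp add: A_def)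
  finally have A3: "(N' - 2) * (p - 1) < (2 + \<tau>) * A" using m by (simp add: X_def field_simps)
  define a where "a = A - 2"
  have a: "a > 0" using A1 p by (simp add: a_def)
  have \<mu>: "(a / 2 + 1)\<^sup>2 < p * (a + 1)"
  proof -
    have "(A / 2 - p)\<^sup>2 < s\<^sup>2" using A1 A2 by (intro power_strict_mono) auto
    moreover have "(A / 2 - p)\<^sup>2 = (A / 2)\<^sup>2 - p * A + p\<^sup>2" by (simp add: power2_eq_square algebra_simps)
    ultimately have "(A / 2)\<^sup>2 < p * A - p" unfolding s(2) by linarith
    moreover have "a / 2 + 1 = A / 2" "p * (a + 1) = p * A - p" by (simp_all add: a_def field_simps)
    ultimately show ?thesis by (simp only:)
  qed
  show ?thesis
  proof (rule caccioppoli[OF l p a \<mu> _ stab], goal_cases)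
    case (1 \<phi> D\<phi>)
    then show ?case by (rule eq)
  next
    case (2 C)
    note C = 2
    show ?case
    proof (rule energy_decay[OF p a C(1) refl])
      show "integrable lebesgue (\<lambda>x. norm x powr l * ((\<eta> x)\<^sup>2 * \<bar>v x\<bar> powr (p + 1 + a)))"
        "integrable lebesgue (\<lambda>x. norm x powr \<theta> * ((norm (D\<eta> x))\<^sup>2 * \<bar>v x\<bar> powr (a + 2)))"
        "(LINT x|lebesgue. norm x powr l * ((\<eta> x)\<^sup>2 * \<bar>v x\<bar> powr (p + 1 + a)))
          \<le> C * (LINT x|lebesgue. norm x powr \<theta> * ((norm (D\<eta> x))\<^sup>2 * \<bar>v x\<bar> powr (a + 2)))"
        if "C1_test_function UNIV \<eta> D\<eta>" for \<eta> D\<eta>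
        by (rule C(2)[OF that] C(3)[OF that] C(4)[OF that])+
    define \<sigma> where "\<sigma> = (a + 2) / (p + 1 + a)"
    define D where "D = p + 1 + a"
    have D: "D > 0" using p a by (simp add: D_def)
    have \<sigma>D: "\<sigma> = (a + 2) / D" by (simp add: \<sigma>_def D_def)
    have "1 - \<sigma> = (D - (a + 2)) / D" unfolding \<sigma>D using D by (simp add: diff_divide_distrib)
    then have 1: "1 - \<sigma> = (p - 1) / D" by (simp add: D_def)
    have 2: "\<theta> - l * \<sigma> - 2 = (\<theta> * D - l * (a + 2) - 2 * D) / D" unfolding \<sigma>D using D by (simp add: diff_divide_distrib)
    have "(\<theta> - l * \<sigma> - 2) / (1 - \<sigma>) = (\<theta> * D - l * (a + 2) - 2 * D) / (p - 1)"
      unfolding 1 2 using D p by simp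
    \<comment> \<open>Here the two weights combine into
      \<open>2 + \<tau> = 2 + l - \<theta>\<close>; adding the dimension gives the decay
      exponent.\<close>
    also have "\<dots> = \<theta> - 2 - (2 + \<tau>) * A / (p - 1)"
      unfolding \<tau> a_def D_def using p by (simp add: field_simps)
    finally have "(\<theta> - l * \<sigma> - 2) / (1 - \<sigma>) = \<theta> - 2 - (2 + \<tau>) * A / (p - 1)" .
    moreover have "N' - 2 < (2 + \<tau>) * A / (p - 1)" using A3 p by (simp add: field_simps)
    ultimately show "real DIM('a) + (\<theta> - l * ((a + 2) / (p + 1 + a)) - 2) / (1 - (a + 2) / (p + 1 + a)) < 0"
      using N' by (simp add: \<sigma>_def)
    qed
  qed
qed

section \<open>Hardy inequality and radial stable solutions\<close>

lemma square_powr: "((norm x)\<^sup>2) powr b = norm x powr (2 * b)"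
proof (cases "norm x = 0")
  case False
  have "(norm x)\<^sup>2 = norm x powr 2" using False by (simp add: powr_numeral)
  then show ?thesis by (simp only: powr_powr)
qed simp

lemma H1w_c_bounded:
  fixes \<phi> :: "'a::euclidean_space \<Rightarrow> real"
  assumes "H1w_c \<theta> UNIV \<phi> D\<phi>" "Linf_loc UNIV \<phi>"
  obtains C R where "AE x in lebesgue. \<bar>\<phi> x\<bar> \<le> C" "AE x in lebesgue. x \<notin> cball 0 R \<longrightarrow> \<phi> x = 0" "\<phi> \<in> borel_measurable lebesgue"
proof -
  obtain K where K: "compact K" "AE x in lebesgue. x \<in> UNIV - K \<longrightarrow> \<phi> x = 0" using assms(1) unfolding H1w_c_def by blast
  obtain C where C: "AE x in lebesgue. x \<in> K \<longrightarrow> \<bar>\<phi> x\<bar> \<le> C" using Linf_loc_UNIV(2)[OF assms(2) K(1)] by blast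
  obtain R where R: "K \<subseteq> cball 0 R"
    using compact_imp_bounded[OF K(1)] by (meson bounded_subset_ballD ball_subset_cball subset_trans)
  show ?thesis
  proof (rule that[of "\<bar>C\<bar>" R])
    show "AE x in lebesgue. \<bar>\<phi> x\<bar> \<le> \<bar>C\<bar>"
      using K(2) C
    proof eventually_elim
      case (elim x) then show ?case by (cases "x \<in> K") auto
    qed
    show "AE x in lebesgue. x \<notin> cball 0 R \<longrightarrow> \<phi> x = 0"
      using K(2)
    proof eventually_elim
      case (elim x) then show ?case using R by blast
    qed
  qed (rule Linf_loc_UNIV(1)[OF assms(2)])
qed

lemma integrable_norm_powr_mult_AE:
  fixes w :: "'a::euclidean_space \<Rightarrow> real"
  assumes "a > - real DIM('a)" "w \<in> borel_measurable lebesgue" "AE x in lebesgue. \<bar>w x\<bar> \<le> C"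
    and "AE x in lebesgue. x \<notin> cball 0 R \<longrightarrow> w x = 0"
  shows "integrable lebesgue (\<lambda>x. norm x powr a * w x)"
proof (rule Bochner_Integration.integrable_bound[OF integrable_mult_right[OF integrable_norm_powr_cball[OF assms(1), of R], of C]])
  show "(\<lambda>x. norm x powr a * w x) \<in> borel_measurable lebesgue"
    by (intro borel_measurable_times borel_measurable_norm_powr assms)
  show "AE x in lebesgue. norm (norm x powr a * w x) \<le> norm (C * (indicator (cball 0 R) x * norm x powr a))"
    using assms(3,4)
  proof eventually_elim
    case (elim x)
    show ?case
    proof (cases "x \<in> cball 0 R")
      case True
      have "\<bar>w x\<bar> * norm x powr a \<le> \<bar>C\<bar> * norm x powr a" using elim(1) by (intro mult_right_mono) auto
      then show ?thesis using True by (simp add: abs_mult mult.commute)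
    qed (use elim(2) in auto)
  qed
qed

text \<open>Off the origin the field \<open>|x|^(\<theta>-2) x\<close> has divergence
  \<open>K |x|^(\<theta>-2)\<close>. Integrating it by parts against \<open>\<psi>^2\<close> and
  completing the square gives the constant \<open>K^2 / 4\<close>. Since \<open>K > 0\<close>, the
  weight \<open>|x|^(\<theta>-2)\<close> is locally integrable, so boundedness and compact support
  of \<psi> make the left side finite.\<close>

lemma hardy_inequality:
  fixes \<psi> :: "'a::euclidean_space \<Rightarrow> real"
  assumes K: "K = real DIM('a) + \<theta> - 2" "K > 0" and H: "H1w_c \<theta> UNIV \<psi> D\<psi>" and L: "Linf_loc UNIV \<psi>"
  shows "integrable lebesgue (\<lambda>x. norm x powr \<theta> * (norm (D\<psi> x))\<^sup>2)"
    "integrable lebesgue (\<lambda>x. norm x powr (\<theta> - 2) * (\<psi> x)\<^sup>2)"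
    "K\<^sup>2 / 4 * (LINT x|lebesgue. norm x powr (\<theta> - 2) * (\<psi> x)\<^sup>2) \<le> (LINT x|lebesgue. norm x powr \<theta> * (norm (D\<psi> x))\<^sup>2)"
proof -
  have wg: "weak_gradient (UNIV - {0}) \<psi> D\<psi>" using H by (simp add: H1w_c_def H1w_def)
  obtain C R where C: "AE x in lebesgue. \<bar>\<psi> x\<bar> \<le> C" and R: "AE x in lebesgue. x \<notin> cball 0 R \<longrightarrow> \<psi> x = 0"
    and m\<psi> [measurable]: "\<psi> \<in> borel_measurable lebesgue" by (rule H1w_c_bounded[OF H L])
  have mD [measurable]: "D\<psi> \<in> borel_measurable lebesgue"
    using wg by (intro loc_integrable_borel_measurable) (simp add: weak_gradient_def)
  show iD: "integrable lebesgue (\<lambda>x. norm x powr \<theta> * (norm (D\<psi> x))\<^sup>2)"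
    using H by (simp add: H1w_c_def H1w_def L2_on_def set_integrable_UNIV powr_half_square)
  show i\<psi>: "integrable lebesgue (\<lambda>x. norm x powr (\<theta> - 2) * (\<psi> x)\<^sup>2)"
  proof (rule integrable_norm_powr_mult_AE)
    show "AE x in lebesgue. \<bar>(\<psi> x)\<^sup>2\<bar> \<le> C\<^sup>2"
      using C
    proof eventually_elim
      case (elim x)
      have "\<bar>\<psi> x\<bar>\<^sup>2 \<le> C\<^sup>2" using elim by (intro power_mono) auto
      then show ?case by simp
    qed
    show "AE x in lebesgue. x \<notin> cball 0 R \<longrightarrow> (\<psi> x)\<^sup>2 = 0" using R by (auto elim: eventually_mono)
  qed (use K in auto)
  have wg2: "weak_gradient (UNIV - {0}) (\<lambda>x. (\<psi> x)\<^sup>2) (\<lambda>x. (2 * \<psi> x) *\<^sub>R D\<psi> x)"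
  proof (rule weak_gradient_chain[OF wg, where f="\<lambda>s. s\<^sup>2" and f'="\<lambda>s. 2 * s"])
    show "\<exists>C. AE x in lebesgue. x \<in> K \<longrightarrow> \<bar>\<psi> x\<bar> \<le> C" for K using C by (auto elim: eventually_mono)
  qed (auto intro!: derivative_eq_intros continuous_intros)
  define b where "b = (\<theta> - 2) / 2"
  have G: "((\<lambda>s. s powr b) has_real_derivative b * s powr (b - 1)) (at s)" if "s > 0" for s
    by (rule has_real_derivative_powr[OF that])
  have cG: "continuous_on {0<..} (\<lambda>s. b * s powr (b - 1))" by (intro continuous_intros) auto
  have Gx: "((norm x)\<^sup>2) powr b = norm x powr (\<theta> - 2)" for x :: 'a
  proof -
    have "2 * b = \<theta> - 2" by (simp add: b_def)
    then show ?thesis by (simp only: square_powr)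
  qed
  have div: "real DIM('a) * ((norm x)\<^sup>2) powr b + 2 * (norm x)\<^sup>2 * (b * ((norm x)\<^sup>2) powr (b - 1)) = K * norm x powr (\<theta> - 2)" for x :: 'a
  proof -
    have "(norm x)\<^sup>2 * ((norm x)\<^sup>2) powr (b - 1) = ((norm x)\<^sup>2) powr b"
      by (cases "x = 0") (auto simp: powr_diff)
    then have "real DIM('a) * ((norm x)\<^sup>2) powr b + 2 * (norm x)\<^sup>2 * (b * ((norm x)\<^sup>2) powr (b - 1)) = real DIM('a) * ((norm x)\<^sup>2) powr b + 2 * b * ((norm x)\<^sup>2) powr b"
      by (simp only: mult_ac)
    also have "\<dots> = K * ((norm x)\<^sup>2) powr b"
    proof -
      have "K = real DIM('a) + 2 * b" by (simp add: K(1) b_def)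
      then show ?thesis by (simp only: distrib_right)
    qed
    finally show ?thesis unfolding Gx .
  qed
  define X where "X = (\<lambda>x. norm x powr (\<theta> - 2) * (x \<bullet> ((2 * \<psi> x) *\<^sub>R D\<psi> x)))"
  have key: "\<bar>c * X x\<bar> \<le> norm x powr \<theta> * (norm (D\<psi> x))\<^sup>2 + c\<^sup>2 * (norm x powr (\<theta> - 2) * (\<psi> x)\<^sup>2)" for c x
  proof (cases "x = 0")
    case False
    have "norm x powr \<theta> = norm x powr (\<theta> - 2) * (norm x)\<^sup>2" using False by (simp add: powr_diff powr_numeral)
    moreover have "\<bar>c * (x \<bullet> ((2 * \<psi> x) *\<^sub>R D\<psi> x))\<bar> \<le> (norm x)\<^sup>2 * (norm (D\<psi> x))\<^sup>2 + c\<^sup>2 * (\<psi> x)\<^sup>2"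
    proof -
      have "\<bar>c * (x \<bullet> ((2 * \<psi> x) *\<^sub>R D\<psi> x))\<bar> = 2 * (\<bar>c * \<psi> x\<bar> * \<bar>x \<bullet> D\<psi> x\<bar>)" by (simp add: abs_mult)
      also have "\<dots> \<le> 2 * (\<bar>c * \<psi> x\<bar> * (norm x * norm (D\<psi> x)))"
        by (intro mult_left_mono Cauchy_Schwarz_ineq2) auto
      also have "\<dots> \<le> (norm x * norm (D\<psi> x))\<^sup>2 + \<bar>c * \<psi> x\<bar>\<^sup>2"
        using zero_le_power2[of "\<bar>c * \<psi> x\<bar> - norm x * norm (D\<psi> x)"] by (simp only: power2_diff)
      finally show ?thesis by (simp add: power_mult_distrib)
    qed
    then have "norm x powr (\<theta> - 2) * \<bar>c * (x \<bullet> ((2 * \<psi> x) *\<^sub>R D\<psi> x))\<bar> \<le> norm x powr (\<theta> - 2) * ((norm x)\<^sup>2 * (norm (D\<psi> x))\<^sup>2 + c\<^sup>2 * (\<psi> x)\<^sup>2)"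
      by (intro mult_left_mono) auto
    moreover have "\<bar>c * X x\<bar> = norm x powr (\<theta> - 2) * \<bar>c * (x \<bullet> ((2 * \<psi> x) *\<^sub>R D\<psi> x))\<bar>" by (simp add: X_def abs_mult)
    ultimately show ?thesis by (simp add: distrib_left mult_ac)
  qed (simp add: X_def)
  have iX: "integrable lebesgue X"
  proof (rule Bochner_Integration.integrable_bound[OF Bochner_Integration.integrable_add[OF iD i\<psi>]])
    have "(\<lambda>x::'a. x) \<in> borel_measurable lebesgue" by (rule borel_measurable_lebesgue_continuous[OF continuous_on_id])
    moreover have "(\<lambda>x. (2 * \<psi> x) *\<^sub>R D\<psi> x) \<in> borel_measurable lebesgue" by measurable
    ultimately show "X \<in> borel_measurable lebesgue"
      unfolding X_def by (intro borel_measurable_times borel_measurable_norm_powr borel_measurable_inner)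
    show "AE x in lebesgue. norm (X x) \<le> norm (norm x powr \<theta> * (norm (D\<psi> x))\<^sup>2 + norm x powr (\<theta> - 2) * (\<psi> x)\<^sup>2)"
    proof (rule AE_I2)
      fix x
      have "\<bar>1 * X x\<bar> \<le> norm x powr \<theta> * (norm (D\<psi> x))\<^sup>2 + 1\<^sup>2 * (norm x powr (\<theta> - 2) * (\<psi> x)\<^sup>2)" by (rule key)
      then show "norm (X x) \<le> norm (norm x powr \<theta> * (norm (D\<psi> x))\<^sup>2 + norm x powr (\<theta> - 2) * (\<psi> x)\<^sup>2)" by simp
    qed
  qed
  have "(LINT x|lebesgue. (\<psi> x)\<^sup>2 * (K * norm x powr (\<theta> - 2))) = - (LINT x|lebesgue. X x)"
  proof -
    have "(LINT x|lebesgue. (\<psi> x)\<^sup>2 * (real DIM('a) * ((norm x)\<^sup>2) powr b + 2 * (norm x)\<^sup>2 * (b * ((norm x)\<^sup>2) powr (b - 1))))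
      = - (LINT x|lebesgue. ((norm x)\<^sup>2) powr b * (x \<bullet> ((2 * \<psi> x) *\<^sub>R D\<psi> x)))"
    proof (rule radial_integration_by_parts[OF wg2 G cG])
      show "integrable lebesgue (\<lambda>x. (\<psi> x)\<^sup>2 * ((norm x)\<^sup>2) powr b)" using i\<psi> unfolding Gx by (simp only: mult.commute)
      have "integrable lebesgue (\<lambda>x. K * (norm x powr (\<theta> - 2) * (\<psi> x)\<^sup>2))" using i\<psi> by (rule integrable_mult_right)
      then show "integrable lebesgue (\<lambda>x. (\<psi> x)\<^sup>2 * (real DIM('a) * ((norm x)\<^sup>2) powr b + 2 * (norm x)\<^sup>2 * (b * ((norm x)\<^sup>2) powr (b - 1))))"
        unfolding div by (simp only: mult_ac)
      show "integrable lebesgue (\<lambda>x. ((norm x)\<^sup>2) powr b * (x \<bullet> ((2 * \<psi> x) *\<^sub>R D\<psi> x)))" using iX unfolding Gx X_def .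
    qed auto
    then show ?thesis unfolding div unfolding Gx X_def .
  qed
  moreover have "(LINT x|lebesgue. (\<psi> x)\<^sup>2 * (K * norm x powr (\<theta> - 2))) = K * (LINT x|lebesgue. norm x powr (\<theta> - 2) * (\<psi> x)\<^sup>2)"
    by (subst integral_mult_right_zero[symmetric]) (simp only: mult_ac)
  ultimately have e: "K * (LINT x|lebesgue. norm x powr (\<theta> - 2) * (\<psi> x)\<^sup>2) = - (LINT x|lebesgue. X x)" by simp
  \<comment> \<open>The factor \<open>c = - K / 2\<close> is the best choice: the left side becomes
    \<open>K^2 / 2\<close> times the Hardy integral, of which the square term takes back one
    half.\<close>
  have "(LINT x|lebesgue. (- (K/2)) * X x) \<le> (LINT x|lebesgue. norm x powr \<theta> * (norm (D\<psi> x))\<^sup>2 + (K/2)\<^sup>2 * (norm x powr (\<theta> - 2) * (\<psi> x)\<^sup>2))"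
  proof (rule integral_mono)
    show "(- (K/2)) * X x \<le> norm x powr \<theta> * (norm (D\<psi> x))\<^sup>2 + (K/2)\<^sup>2 * (norm x powr (\<theta> - 2) * (\<psi> x)\<^sup>2)" for x
      using key[of "- (K/2)" x] by simp
  qed (intro integrable_mult_right iX Bochner_Integration.integrable_add iD i\<psi>)+
  also have "\<dots> = (LINT x|lebesgue. norm x powr \<theta> * (norm (D\<psi> x))\<^sup>2) + (K/2)\<^sup>2 * (LINT x|lebesgue. norm x powr (\<theta> - 2) * (\<psi> x)\<^sup>2)"
    by (simp only: Bochner_Integration.integral_add[OF iD integrable_mult_right[OF i\<psi>]] integral_mult_right_zero)
  also have "(LINT x|lebesgue. (- (K/2)) * X x) = (K/2) * (- (LINT x|lebesgue. X x))"
    by (simp only: integral_mult_right_zero)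
  also have "\<dots> = K\<^sup>2 / 2 * (LINT x|lebesgue. norm x powr (\<theta> - 2) * (\<psi> x)\<^sup>2)"
    unfolding e[symmetric] by (simp add: power2_eq_square)
  finally show "K\<^sup>2 / 4 * (LINT x|lebesgue. norm x powr (\<theta> - 2) * (\<psi> x)\<^sup>2) \<le> (LINT x|lebesgue. norm x powr \<theta> * (norm (D\<psi> x))\<^sup>2)"
    by (simp add: power_divide field_simps)
qed

section \<open>From the one-dimensional profile to radial stable solutions\<close>

lemma continuous_on_powr_norm:
  fixes S :: "'a::euclidean_space set" and m :: real
  shows "m > 0 \<Longrightarrow> continuous_on S (\<lambda>x. norm x powr m)"
  by (intro continuous_on_powr' continuous_intros) auto

text \<open>In the variable \<open>t = |x|^m\<close> the equation for a radial function is
  \<open>(t^(\<kappa>+1) u')' = - c t^\<kappa> u^p\<close> with \<open>\<kappa> = K / m\<close> and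
  \<open>c = 1 / m^2\<close>: the dimension and both weights disappear into \<kappa> and
  \<open>c\<close>. Stability is then a pointwise comparison with the Hardy potential.\<close>

lemma radial_stable_solution:
  fixes \<theta> l p \<kappa> \<alpha> s :: real
  defines "K \<equiv> real DIM('a::euclidean_space) + \<theta> - 2" and "m \<equiv> 2 + l - \<theta>"
  assumes K: "K > 0" and m: "m > 0" and p: "p > 1" and s: "s > 0" and \<kappa>: "\<kappa> * m = K"
    and \<alpha>: "\<alpha> * (p - 1) = 1" and A: "\<kappa> - 2 * \<alpha> > 0" and stab: "4 * p * \<alpha> * (\<kappa> - \<alpha>) \<le> \<kappa>\<^sup>2"
  obtains V :: "'a::euclidean_space \<Rightarrow> real" where "solution \<theta> l p UNIV V" "is_stable \<theta> l p UNIV V" "radial V"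
    "\<And>x. V x > 0" "continuous_on UNIV V" "V 0 = s"
proof -
  define N where "N = real DIM('a)"
  have KN: "K = N + \<theta> - 2" by (simp add: K_def N_def)
  have lm: "l = \<theta> - 2 + m" by (simp add: m_def)
  have \<kappa>0: "\<kappa> > 0" using \<kappa> K m by (metis zero_less_mult_pos2)
  define c where "c = 1 / m\<^sup>2"
  have c: "c > 0" using m by (simp add: c_def)
  obtain u P where u0: "u 0 = s" and cu: "continuous_on {0..} u"
    and upos: "\<And>t. t \<ge> 0 \<Longrightarrow> 0 < u t" and us: "\<And>t. t \<ge> 0 \<Longrightarrow> u t \<le> s"
    and du: "\<And>t. t > 0 \<Longrightarrow> (u has_real_derivative - c * t powr (-\<kappa>-1) * P t) (at t)"
    and dP: "\<And>t. t > 0 \<Longrightarrow> (P has_real_derivative t powr \<kappa> * u t powr p) (at t)"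
    and P0: "\<And>t. t > 0 \<Longrightarrow> 0 \<le> P t" and P1: "\<And>t. t > 0 \<Longrightarrow> P t \<le> t powr (\<kappa> + 1) * s powr p"
    and st: "\<And>t. t > 0 \<Longrightarrow> p * c * t * u t powr (p - 1) \<le> \<kappa>\<^sup>2 / 4"
  proof (rule radial_profile[OF s p \<kappa>0 c \<alpha> A stab], goal_cases)
    case (1 u P)
    show ?case by (rule that[of u P]; fact 1)
  qed
  have cP: "continuous_on {0<..} P" by (intro continuous_at_imp_continuous_on ballI DERIV_isCont[OF dP]) auto
  define V where "V = (\<lambda>x::'a. u (norm x powr m))"
  have Vpos: "V x > 0" and Vs: "V x \<le> s" for x by (auto simp: V_def upos us)
  have cV: "continuous_on UNIV V" unfolding V_def by (rule continuous_on_compose2[OF cu continuous_on_powr_norm[OF m]]) auto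
  have mV [measurable]: "V \<in> borel_measurable lebesgue" by (rule borel_measurable_lebesgue_continuous[OF cV])
  have rad: "radial V" unfolding radial_def V_def by (rule exI[of _ "\<lambda>r. u (r powr m)"]) simp
  have V0: "V 0 = s" by (simp add: V_def u0)
  have LV: "Linf_loc UNIV V"
    unfolding Linf_loc_def set_borel_measurable_UNIV
  proof (intro conjI allI impI)
    show "\<exists>C. AE x in lebesgue. x \<in> K \<longrightarrow> \<bar>V x\<bar> \<le> C" for K
      by (rule exI[of _ s], rule AE_I2) (use Vpos Vs in \<open>simp add: abs_of_pos\<close>)
  qed (rule mV)
  \<comment> \<open>The gradient is expressed by the flux \<open>P\<close> instead of
    \<open>u'\<close>. Multiplying by \<open>|x|^\<theta>\<close> and taking the divergence then
    needs only the derivative of \<open>P\<close>.\<close>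
  define DV where "DV = (\<lambda>x::'a. (- (1 / m) * (norm x powr (- K - 2) * P (norm x powr m))) *\<^sub>R x)"
  have gV: "GDERIV V x :> DV x" if x: "x \<noteq> 0" for x
  proof -
    define q where "q = (norm x)\<^sup>2"
    have q: "q > 0" using x by (simp add: q_def)
    have t: "q powr (m/2) > 0" using q by simp
    have "((\<lambda>s. u (s powr (m/2))) has_real_derivative (- c * (q powr (m/2)) powr (-\<kappa>-1) * P (q powr (m/2))) * ((m/2) * q powr (m/2 - 1))) (at q)"
      by (rule DERIV_chain2[OF du[OF t] has_real_derivative_powr[OF q]])
    then have "GDERIV (\<lambda>x. u (((norm x)\<^sup>2) powr (m/2))) x :> (2 * ((- c * (q powr (m/2)) powr (-\<kappa>-1) * P (q powr (m/2))) * ((m/2) * q powr (m/2 - 1)))) *\<^sub>R x"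
      unfolding q_def by (rule GDERIV_radial)
    moreover have "(\<lambda>x. u (((norm x)\<^sup>2) powr (m/2))) = V"
    proof
      fix x :: 'a
      have "2 * (m/2) = m" by simp
      then show "u (((norm x)\<^sup>2) powr (m/2)) = V x" by (simp only: square_powr V_def)
    qed
    moreover have "2 * ((- c * (q powr (m/2)) powr (-\<kappa>-1) * P (q powr (m/2))) * ((m/2) * q powr (m/2 - 1))) = - (1 / m) * (norm x powr (- K - 2) * P (norm x powr m))"
    proof -
      have q1: "q powr (m/2) = norm x powr m" unfolding q_def square_powr by simp
      have q2: "q powr (m/2 - 1) = norm x powr (m - 2)" unfolding q_def square_powr by (simp add: right_diff_distrib)
      have q3: "(norm x powr m) powr (-\<kappa>-1) = norm x powr (- K - m)" unfolding powr_powr \<kappa>[symmetric] by (simp add: algebra_simps)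
      have q4: "norm x powr (- K - m) * norm x powr (m - 2) = norm x powr (- K - 2)" unfolding powr_add[symmetric] by simp
      have cm: "2 * (c * (m / 2)) = 1 / m" using m by (simp add: c_def power2_eq_square)
      have "2 * ((- c * (q powr (m/2)) powr (-\<kappa>-1) * P (q powr (m/2))) * ((m/2) * q powr (m/2 - 1)))
        = - (2 * (c * (m/2))) * ((norm x powr (- K - m) * norm x powr (m - 2)) * P (norm x powr m))"
        unfolding q1 q2 q3 by (simp add: mult_ac)
      then show ?thesis unfolding q4 cm by simp
    qed
    ultimately show ?thesis by (simp only: DV_def)
  qed
  have cpow: "continuous_on (UNIV - {0::'a}) (\<lambda>x. norm x powr b)" for b by (intro continuous_intros) auto
  have cDV: "continuous_on (UNIV - {0}) DV"
    unfolding DV_def by (intro continuous_intros cpow continuous_on_compose2[OF cP cpow]) auto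
  have wgV: "weak_gradient (UNIV - {0}) V DV"
    by (rule weak_gradient_classical) (use gV cDV in auto)
  have mDV [measurable]: "DV \<in> borel_measurable lebesgue"
    using wgV by (intro loc_integrable_borel_measurable) (simp add: weak_gradient_def)
  have Pb: "P (norm x powr m) \<le> norm x powr (K + m) * s powr p" "0 \<le> P (norm x powr m)" if "x \<noteq> 0" for x :: 'a
  proof -
    have t: "norm x powr m > 0" using that by simp
    have "(norm x powr m) powr (\<kappa> + 1) = norm x powr (K + m)" unfolding powr_powr \<kappa>[symmetric] by (simp add: algebra_simps)
    then show "P (norm x powr m) \<le> norm x powr (K + m) * s powr p" using P1[OF t] by simp
    show "0 \<le> P (norm x powr m)" by (rule P0[OF t])
  qed
  \<comment> \<open>For \<open>m < 1\<close> this bound is unbounded at 0, but the weighted square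
    of \<open>|x|^(m-1)\<close> is locally integrable, because
    \<open>\<theta> + 2 * m - 2 > -N\<close>.\<close>
  have nDV: "norm (DV x) \<le> (1 / m) * s powr p * norm x powr (m - 1)" for x
  proof (cases "x = 0")
    case False
    have "norm (DV x) = (1 / m) * (norm x powr (- K - 2) * P (norm x powr m)) * norm x"
      using m Pb(2)[OF False] by (simp add: DV_def abs_mult)
    also have "\<dots> \<le> (1 / m) * (norm x powr (- K - 2) * (norm x powr (K + m) * s powr p)) * norm x"
      using m by (intro mult_right_mono mult_left_mono Pb False) auto
    also have "\<dots> = (1 / m) * s powr p * (norm x powr (- K - 2) * norm x powr (K + m) * norm x powr 1)"
      using False by simp
    also have "norm x powr (- K - 2) * norm x powr (K + m) * norm x powr 1 = norm x powr (m - 1)"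
      unfolding powr_add[symmetric] by simp
    finally show ?thesis .
  qed (simp add: DV_def)
  have HV: "H1w_loc \<theta> UNIV V DV"
    unfolding H1w_loc_def
  proof (intro conjI allI impI)
    show "weak_gradient (UNIV - {0}) V DV" by (rule wgV)
    fix Q :: "'a set" assume Q: "compact Q"
    obtain R where R: "Q \<subseteq> cball 0 R"
      using compact_imp_bounded[OF Q] by (meson bounded_subset_ballD ball_subset_cball subset_trans)
    have mQ: "(indicator Q :: 'a \<Rightarrow> real) \<in> borel_measurable lebesgue"
      by (intro borel_measurable_indicator compact_in_sets_lebesgue Q)
    note [measurable] = borel_measurable_norm_powr mQ
    have "integrable lebesgue (\<lambda>x. norm x powr \<theta> * (indicator Q x * (V x)\<^sup>2))"
    proof (rule integrable_norm_powr_mult[where R=R and C="s\<^sup>2"])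
      show "AE x in lebesgue. \<bar>indicator Q x * (V x)\<^sup>2\<bar> \<le> s\<^sup>2"
      proof (rule AE_I2)
        fix x
        have "(V x)\<^sup>2 \<le> s\<^sup>2" using Vpos[of x] Vs[of x] by (intro power_mono) auto
        then show "\<bar>indicator Q x * (V x)\<^sup>2\<bar> \<le> s\<^sup>2" by (cases "x \<in> Q") auto
      qed
      show "(\<lambda>x. indicator Q x * (V x)\<^sup>2) \<in> borel_measurable lebesgue" by measurable
      show "indicator Q x * (V x)\<^sup>2 = 0" if "x \<notin> cball 0 R" for x
      proof -
        have "x \<notin> Q" using that R by blast
        then show ?thesis by simp
      qed
    qed (use K in \<open>simp add: K_def\<close>)
    then show "L2_on Q (\<lambda>x. norm x powr (\<theta> / 2) * V x)"
      unfolding L2_on_def set_borel_measurable_def set_integrable_def powr_half_square by (auto simp: mult_ac)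
    have "integrable lebesgue (\<lambda>x. indicator Q x * (norm x powr \<theta> * (norm (DV x))\<^sup>2))"
    proof (rule Bochner_Integration.integrable_bound[OF integrable_mult_right[OF integrable_norm_powr_cball[of "\<theta> + 2 * m - 2" R], of "((1 / m) * s powr p)\<^sup>2"]])
      show "- real DIM('a) < \<theta> + 2 * m - 2" using K m by (simp add: K_def)
      show "(\<lambda>x. indicator Q x * (norm x powr \<theta> * (norm (DV x))\<^sup>2)) \<in> borel_measurable lebesgue" by measurable
      show "AE x in lebesgue. norm (indicator Q x * (norm x powr \<theta> * (norm (DV x))\<^sup>2)) \<le> norm (((1 / m) * s powr p)\<^sup>2 * (indicator (cball 0 R) x * norm x powr (\<theta> + 2 * m - 2)))"
      proof (rule AE_I2)
        fix x
        show "norm (indicator Q x * (norm x powr \<theta> * (norm (DV x))\<^sup>2)) \<le> norm (((1 / m) * s powr p)\<^sup>2 * (indicator (cball 0 R) x * norm x powr (\<theta> + 2 * m - 2)))"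
        proof (cases "x \<in> Q")
          case True
          have "(norm (DV x))\<^sup>2 \<le> ((1 / m) * s powr p * norm x powr (m - 1))\<^sup>2" by (intro power_mono nDV) auto
          then have "norm x powr \<theta> * (norm (DV x))\<^sup>2 \<le> norm x powr \<theta> * ((1 / m) * s powr p * norm x powr (m - 1))\<^sup>2" by (intro mult_left_mono) auto
          also have "\<dots> = ((1 / m) * s powr p)\<^sup>2 * (norm x powr \<theta> * (norm x powr (m - 1) * norm x powr (m - 1)))"
            by (simp only: power_mult_distrib power2_eq_square[of "norm x powr (m - 1)"] mult_ac)
          also have "norm x powr \<theta> * (norm x powr (m - 1) * norm x powr (m - 1)) = norm x powr (\<theta> + 2 * m - 2)"
            unfolding powr_add[symmetric] by (simp add: algebra_simps)
          finally show ?thesis using True R by (auto simp: subset_iff)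
        qed simp
      qed
    qed
    then show "L2_on Q (\<lambda>x. norm x powr (\<theta> / 2) * norm (DV x))"
      unfolding L2_on_def set_borel_measurable_def set_integrable_def powr_half_square by auto
  qed
  have weak: "(LINT x:UNIV|lebesgue. norm x powr \<theta> * (DV x \<bullet> D\<phi> x) - norm x powr l * \<bar>V x\<bar> powr (p - 1) * V x * \<phi> x) = 0"
    if H: "H1w_c \<theta> UNIV \<phi> D\<phi>" and L: "Linf_loc UNIV \<phi>" for \<phi> D\<phi>
  proof -
    have wg: "weak_gradient (UNIV - {0}) \<phi> D\<phi>" using H by (simp add: H1w_c_def H1w_def)
    obtain C R where C: "AE x in lebesgue. \<bar>\<phi> x\<bar> \<le> C" and R: "AE x in lebesgue. x \<notin> cball 0 R \<longrightarrow> \<phi> x = 0"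
      and m\<phi> [measurable]: "\<phi> \<in> borel_measurable lebesgue" by (rule H1w_c_bounded[OF H L])
    have l: "l > - real DIM('a)" using K m by (simp add: K_def m_def)
    have il: "integrable lebesgue (\<lambda>x. norm x powr l * \<phi> x)" by (rule integrable_norm_powr_mult_AE[OF l m\<phi> C R])
    have Vp: "\<bar>V x\<bar> powr (p - 1) * V x = V x powr p" for x
      using abs_powr_mult_eq[of "V x" p] Vpos[of x] by simp
    define f1 where "f1 = (\<lambda>x. norm x powr \<theta> * (DV x \<bullet> D\<phi> x))"
    define f2 where "f2 = (\<lambda>x. norm x powr l * V x powr p * \<phi> x)"
    have i2: "integrable lebesgue f2"
    proof -
      have "AE x in lebesgue. \<bar>V x powr p\<bar> \<le> s powr p"
        by (rule AE_I2) (use Vpos Vs p in \<open>auto intro!: powr_mono2 simp: less_imp_le\<close>)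
      from integrable_scaleR_bounded[OF il _ this] show ?thesis unfolding f2_def by (simp add: mult_ac)
    qed
    have eq: "(LINT x:UNIV|lebesgue. norm x powr \<theta> * (DV x \<bullet> D\<phi> x) - norm x powr l * \<bar>V x\<bar> powr (p - 1) * V x * \<phi> x)
      = (LINT x|lebesgue. f1 x - f2 x)"
      unfolding set_lebesgue_integral_def f1_def f2_def Vp[symmetric] by (simp add: mult.assoc)
    show ?thesis
    proof (cases "integrable lebesgue f1")
      case False
      \<comment> \<open>A divergent integral has the value 0, and \<open>f2\<close> is integrable;
        so in this case the identity holds by the default value.\<close>
      have "\<not> integrable lebesgue (\<lambda>x. f1 x - f2 x)"
      proof
        assume "integrable lebesgue (\<lambda>x. f1 x - f2 x)"
        from Bochner_Integration.integrable_add[OF this i2] False show False by simp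
      qed
      then show ?thesis unfolding eq by (rule not_integrable_integral_eq)
    next
      case True
      \<comment> \<open>The flux field \<open>|x|^\<theta> DV\<close> is \<open>G (|x|^2) x\<close>;
        this identity underlies \<open>f1G\<close>.\<close>
      define G where "G = (\<lambda>q. - (1 / m) * (q powr (- N / 2) * P (q powr (m / 2))))"
      define G' where "G' = (\<lambda>q. - (1 / m) * (((- N / 2) * q powr (- N / 2 - 1)) * P (q powr (m / 2))
         + (((q powr (m / 2)) powr \<kappa> * u (q powr (m / 2)) powr p) * ((m / 2) * q powr (m / 2 - 1))) * q powr (- N / 2)))"
      have dG: "(G has_real_derivative G' q) (at q)" if q: "q > 0" for q
      proof -
        have t: "q powr (m/2) > 0" using q by simp
        have "((\<lambda>q. P (q powr (m/2))) has_real_derivative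
            ((q powr (m / 2)) powr \<kappa> * u (q powr (m / 2)) powr p) * ((m / 2) * q powr (m / 2 - 1))) (at q)"
          by (rule DERIV_chain2[where f=P and g="\<lambda>q. q powr (m/2)", OF dP[OF t] has_real_derivative_powr[OF q]])
        then show ?thesis unfolding G_def G'_def
          by (intro DERIV_cmult DERIV_mult has_real_derivative_powr q)
      qed
      have cp: "continuous_on {0<..} (\<lambda>q::real. q powr b)" for b by (intro continuous_intros) auto
      have cup: "continuous_on {0<..} (\<lambda>q. u (q powr (m/2)) powr p)"
      proof (intro continuous_on_powr continuous_on_const continuous_on_compose2[OF cu cp])
        show "\<forall>q\<in>{0<..}. u (q powr (m/2)) \<noteq> 0" using upos by (metis less_irrefl powr_ge_zero)
      qed auto
      have cP2: "continuous_on {0<..} (\<lambda>q. P (q powr (m/2)))" by (rule continuous_on_compose2[OF cP cp]) auto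
      have cpk: "continuous_on {0<..} (\<lambda>q. (q powr (m/2)) powr \<kappa>)" unfolding powr_powr by (rule cp)
      have cG: "continuous_on {0<..} G'"
        unfolding G'_def by (intro continuous_on_mult continuous_on_add continuous_on_const cp cup cP2 cpk)
      have n2: "((norm x)\<^sup>2) powr (m/2) = norm x powr m" for x :: 'a unfolding square_powr by simp
      have nN: "((norm x)\<^sup>2) powr (- N / 2) = norm x powr (- N)" for x :: 'a unfolding square_powr by simp
      have Gx: "G ((norm x)\<^sup>2) = - (1 / m) * (norm x powr (- N) * P (norm x powr m))" for x :: 'a
        unfolding G_def n2 nN ..
      have Gb: "\<bar>G ((norm x)\<^sup>2)\<bar> \<le> (1 / m) * s powr p * norm x powr l" for x :: 'a
      proof (cases "x = 0")
        case False
        have "\<bar>G ((norm x)\<^sup>2)\<bar> = (1 / m) * (norm x powr (- N) * P (norm x powr m))"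
          unfolding Gx using m Pb(2)[OF False] by (simp add: abs_mult)
        also have "\<dots> \<le> (1 / m) * (norm x powr (- N) * (norm x powr (K + m) * s powr p))"
          using m by (intro mult_left_mono Pb False) auto
        also have "\<dots> = (1 / m) * s powr p * (norm x powr (- N) * norm x powr (K + m))" by (simp only: mult_ac)
        also have "norm x powr (- N) * norm x powr (K + m) = norm x powr l"
          unfolding powr_add[symmetric] by (rule arg_cong[where f="\<lambda>b. norm x powr b"]) (simp add: KN lm)
        finally show ?thesis .
      qed (unfold Gx, simp)
      \<comment> \<open>The equation in divergence form: the terms with \<open>P\<close> cancel
        because of the power \<open>- N / 2\<close> in \<open>G\<close>, and the derivative of
        \<open>P\<close> gives the nonlinearity.\<close>
      have div: "real DIM('a) * G ((norm x)\<^sup>2) + 2 * (norm x)\<^sup>2 * G' ((norm x)\<^sup>2) = - (norm x powr l * V x powr p)" for x :: 'a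
      proof (cases "x = 0")
        case False
        define q where "q = (norm x)\<^sup>2"
        have q: "q > 0" using False by (simp add: q_def)
        have e1: "q powr (- N / 2 - 1) = q powr (- N / 2) / q" using q powr_diff[of q "- N / 2" 1] by simp
        have e2: "q powr (m / 2 - 1) = q powr (m / 2) / q" using q powr_diff[of q "m / 2" 1] by simp
        have "N * G q + 2 * q * G' q = - ((q powr (m / 2)) powr \<kappa> * q powr (m / 2) * q powr (- N / 2) * u (q powr (m / 2)) powr p)"
          unfolding G_def G'_def e1 e2 using q m by (simp add: field_simps)
        also have "(q powr (m / 2)) powr \<kappa> * q powr (m / 2) * q powr (- N / 2) = norm x powr l"
        proof -
          have "(q powr (m / 2)) powr \<kappa> = norm x powr K" unfolding q_def n2 powr_powr \<kappa>[symmetric] by (simp add: mult.commute)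
          then have "(q powr (m / 2)) powr \<kappa> * q powr (m / 2) * q powr (- N / 2) = norm x powr K * norm x powr m * norm x powr (- N)"
            unfolding q_def n2 nN by simp
          also have "\<dots> = norm x powr l" unfolding powr_add[symmetric] by (rule arg_cong[where f="\<lambda>b. norm x powr b"]) (simp add: KN lm)
          finally show ?thesis .
        qed
        finally show ?thesis unfolding q_def N_def n2 V_def .
      qed (unfold Gx, simp)
      have f1G: "f1 x = G ((norm x)\<^sup>2) * (x \<bullet> D\<phi> x)" for x
      proof -
        have "norm x powr \<theta> * norm x powr (- K - 2) = norm x powr (- N)" unfolding powr_add[symmetric] by (simp add: KN)
        moreover have "f1 x = - (1 / m) * ((norm x powr \<theta> * norm x powr (- K - 2)) * P (norm x powr m)) * (x \<bullet> D\<phi> x)"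
          unfolding f1_def DV_def inner_scaleR_left by (simp only: mult_ac)
        ultimately show ?thesis unfolding Gx by (simp only:)
      qed
      have "(LINT x|lebesgue. \<phi> x * (real DIM('a) * G ((norm x)\<^sup>2) + 2 * (norm x)\<^sup>2 * G' ((norm x)\<^sup>2))) = - (LINT x|lebesgue. G ((norm x)\<^sup>2) * (x \<bullet> D\<phi> x))"
      proof (rule radial_integration_by_parts[OF wg dG cG])
        show "integrable lebesgue (\<lambda>x. G ((norm x)\<^sup>2) * (x \<bullet> D\<phi> x))" using True unfolding f1G[abs_def] .
        have "integrable lebesgue (\<lambda>x. - f2 x)" using i2 by simp
        then show "integrable lebesgue (\<lambda>x. \<phi> x * (real DIM('a) * G ((norm x)\<^sup>2) + 2 * (norm x)\<^sup>2 * G' ((norm x)\<^sup>2)))"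
          unfolding div f2_def by (simp add: mult_ac)
        show "integrable lebesgue (\<lambda>x. \<phi> x * G ((norm x)\<^sup>2))"
        proof (rule Bochner_Integration.integrable_bound[OF integrable_mult_right[OF il, of "(1 / m) * s powr p"]])
          have "(\<lambda>x::'a. if x = 0 then 0 else G ((norm x)\<^sup>2)) \<in> borel_measurable lebesgue"
          proof -
            have "continuous_on {0<..} G" by (intro continuous_at_imp_continuous_on ballI DERIV_isCont[OF dG]) auto
            then have "continuous_on (UNIV - {0::'a}) (\<lambda>x. G ((norm x)\<^sup>2))"
              by (rule continuous_on_compose2) (auto intro!: continuous_intros)
            then have "(\<lambda>x::'a. G ((norm x)\<^sup>2)) \<in> borel_measurable lebesgue"
              by (intro loc_integrable_borel_measurable loc_integrable_continuous)
            then have "(\<lambda>x::'a. indicator (UNIV - {0}) x * G ((norm x)\<^sup>2)) \<in> borel_measurable lebesgue"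
              by (intro borel_measurable_times borel_measurable_indicator) auto
            moreover have "(\<lambda>x::'a. indicator (UNIV - {0}) x * G ((norm x)\<^sup>2)) = (\<lambda>x. if x = 0 then 0 else G ((norm x)\<^sup>2))" by (auto simp: fun_eq_iff)
            ultimately show ?thesis by (simp only:)
          qed
          moreover have "(\<lambda>x::'a. if x = 0 then 0 else G ((norm x)\<^sup>2)) = (\<lambda>x. G ((norm x)\<^sup>2))" unfolding Gx by (auto simp: fun_eq_iff)
          ultimately have [measurable]: "(\<lambda>x::'a. G ((norm x)\<^sup>2)) \<in> borel_measurable lebesgue" by (simp only:)
          show "(\<lambda>x. \<phi> x * G ((norm x)\<^sup>2)) \<in> borel_measurable lebesgue" by measurable
          show "AE x in lebesgue. norm (\<phi> x * G ((norm x)\<^sup>2)) \<le> norm ((1 / m) * s powr p * (norm x powr l * \<phi> x))"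
          proof (rule AE_I2)
            fix x
            have "\<bar>\<phi> x\<bar> * \<bar>G ((norm x)\<^sup>2)\<bar> \<le> \<bar>\<phi> x\<bar> * ((1 / m) * s powr p * norm x powr l)" by (intro mult_left_mono Gb) auto
            then show "norm (\<phi> x * G ((norm x)\<^sup>2)) \<le> norm ((1 / m) * s powr p * (norm x powr l * \<phi> x))" using m by (simp add: abs_mult mult_ac)
          qed
        qed
      qed auto
      then have "(LINT x|lebesgue. f1 x) = (LINT x|lebesgue. - (\<phi> x * (- (norm x powr l * V x powr p))))"
        unfolding div f1G[abs_def] by simp
      also have "\<dots> = (LINT x|lebesgue. f2 x)" unfolding f2_def by (simp add: mult_ac)
      finally show ?thesis unfolding eq by (simp only: Bochner_Integration.integral_diff[OF True i2] diff_self)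
    qed
  qed
  have sol: "solution \<theta> l p UNIV V"
    unfolding solution_def using LV HV weak by blast
  have stable: "is_stable \<theta> l p UNIV V"
    unfolding is_stable_def
  proof (intro allI impI)
    fix \<psi> :: "'a \<Rightarrow> real" and D\<psi> :: "'a \<Rightarrow> 'a"
    assume "H1w_c \<theta> UNIV \<psi> D\<psi> \<and> Linf_loc UNIV \<psi>"
    then have H: "H1w_c \<theta> UNIV \<psi> D\<psi>" and L: "Linf_loc UNIV \<psi>" by auto
    note hd = hardy_inequality[OF K_def[THEN meta_eq_to_obj_eq] K H L]
    have m\<psi> [measurable]: "\<psi> \<in> borel_measurable lebesgue" by (rule Linf_loc_UNIV(1)[OF L])
    define f where "f = (\<lambda>x. p * norm x powr l * \<bar>V x\<bar> powr (p - 1) * (\<psi> x)\<^sup>2)"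
    have f0: "0 \<le> f x" for x using p by (simp add: f_def)
    \<comment> \<open>Multiplied by \<open>m^2\<close>, the profile bound
      \<open>p * c * t * u^(p-1) \<le> \<kappa>^2 / 4\<close> becomes the Hardy bound, since
      \<open>\<kappa> * m = K\<close> and \<open>|x|^l = |x|^(\<theta>-2) * |x|^m\<close>.\<close>
    have fb: "f x \<le> K\<^sup>2 / 4 * (norm x powr (\<theta> - 2) * (\<psi> x)\<^sup>2)" for x
    proof (cases "x = 0")
      case False
      then have t: "norm x powr m > 0" by simp
      have "m\<^sup>2 * (p * c * norm x powr m * u (norm x powr m) powr (p - 1)) \<le> m\<^sup>2 * (\<kappa>\<^sup>2 / 4)"
        by (intro mult_left_mono st[OF t]) auto
      moreover have "m\<^sup>2 * (p * c * norm x powr m * u (norm x powr m) powr (p - 1)) = p * norm x powr m * V x powr (p - 1)"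
        using m by (simp add: c_def V_def)
      moreover have "m\<^sup>2 * (\<kappa>\<^sup>2 / 4) = K\<^sup>2 / 4" unfolding \<kappa>[symmetric] by (simp add: power_mult_distrib)
      ultimately have "p * norm x powr m * V x powr (p - 1) \<le> K\<^sup>2 / 4" by simp
      then have "(norm x powr (\<theta> - 2) * (\<psi> x)\<^sup>2) * (p * norm x powr m * V x powr (p - 1)) \<le> (norm x powr (\<theta> - 2) * (\<psi> x)\<^sup>2) * (K\<^sup>2 / 4)"
        by (intro mult_left_mono) auto
      moreover have "f x = (norm x powr (\<theta> - 2) * (\<psi> x)\<^sup>2) * (p * norm x powr m * V x powr (p - 1))"
        unfolding f_def lm powr_add using Vpos[of x] by (simp add: mult_ac)
      ultimately show ?thesis by (simp only: mult.commute)
    qed (simp add: f_def)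
    have ib: "integrable lebesgue (\<lambda>x. K\<^sup>2 / 4 * (norm x powr (\<theta> - 2) * (\<psi> x)\<^sup>2))" by (intro integrable_mult_right hd)
    have "integrable lebesgue f"
    proof (rule Bochner_Integration.integrable_bound[OF ib])
      note [measurable] = borel_measurable_norm_powr
      show "f \<in> borel_measurable lebesgue" unfolding f_def by measurable
      show "AE x in lebesgue. norm (f x) \<le> norm (K\<^sup>2 / 4 * (norm x powr (\<theta> - 2) * (\<psi> x)\<^sup>2))"
      proof (rule AE_I2)
        fix x show "norm (f x) \<le> norm (K\<^sup>2 / 4 * (norm x powr (\<theta> - 2) * (\<psi> x)\<^sup>2))" using f0[of x] fb[of x] by simp
      qed
    qed
    note i = this
    have "(LINT x|lebesgue. f x) \<le> (LINT x|lebesgue. K\<^sup>2 / 4 * (norm x powr (\<theta> - 2) * (\<psi> x)\<^sup>2))"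
      by (rule integral_mono[OF i ib fb])
    also have "\<dots> = K\<^sup>2 / 4 * (LINT x|lebesgue. norm x powr (\<theta> - 2) * (\<psi> x)\<^sup>2)" by (rule integral_mult_right_zero)
    also have "\<dots> \<le> (LINT x|lebesgue. norm x powr \<theta> * (norm (D\<psi> x))\<^sup>2)" by (rule hd(3))
    finally have "0 \<le> (LINT x|lebesgue. norm x powr \<theta> * (norm (D\<psi> x))\<^sup>2 - f x)"
      by (simp only: Bochner_Integration.integral_diff[OF hd(1) i])
    then show "0 \<le> (LINT x:UNIV|lebesgue. norm x powr \<theta> * (norm (D\<psi> x))\<^sup>2 - p * norm x powr l * \<bar>V x\<bar> powr (p - 1) * (\<psi> x)\<^sup>2)"
      by (simp add: set_lebesgue_integral_def f_def)
  qed
  show ?thesis by (rule that[OF sol stable rad Vpos cV V0])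
qed

text \<open>A nonempty open set is not negligible. With it, the values at the origin distinguish the
  members of the family even modulo null sets.\<close>

lemma continuous_AE_eq_imp_eq:
  fixes f g :: "'a::euclidean_space \<Rightarrow> real"
  assumes "continuous_on UNIV f" "continuous_on UNIV g" "AE x in lebesgue. f x = g x"
  shows "f = g"
proof -
  have o: "open {x. f x \<noteq> g x}" by (rule open_Collect_neq[OF assms(1,2)])
  have "{x. f x \<noteq> g x} \<in> null_sets lebesgue"
    using assms(3) o by (subst (asm) AE_iff_null) auto
  then have "negligible {x. f x \<noteq> g x}" by (simp add: negligible_iff_null_sets)
  then have "{x. f x \<noteq> g x} = {}" using open_not_negligible[OF o] by blast
  then show ?thesis by auto
qed

theorem theorem1p9:
  fixes \<theta> l N' \<tau> p :: real
  assumes "DIM('a::euclidean_space) \<ge> 2"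
    and "N' = real DIM('a) + \<theta>" and "\<tau> = l - \<theta>"
    and "N' > 2" and "\<tau> > -2"
  shows "((2 < N' \<and> N' \<le> 10 + 4 * \<tau> \<and> p > 1) \<or>
          (N' > 10 + 4 * \<tau> \<and> 1 < p \<and> ereal p < p_crit N' \<tau>) \<longrightarrow>
            (\<forall>v :: 'a \<Rightarrow> real. solution \<theta> l p UNIV v \<and> is_stable \<theta> l p UNIV v \<longrightarrow>
               (AE x in lebesgue. v x = 0))) \<and>
         (ereal p \<ge> p_crit N' \<tau> \<longrightarrow>
            p_crit N' \<tau> < \<infinity> \<and>
            (\<exists>V :: real \<Rightarrow> 'a \<Rightarrow> real.
               (\<forall>s>0. solution \<theta> l p UNIV (V s) \<and> is_stable \<theta> l p UNIV (V s) \<and>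
                      radial (V s) \<and> (\<forall>x. V s x > 0)) \<and>
               (\<forall>s>0. \<forall>t>0. s \<noteq> t \<longrightarrow> \<not> (AE x in lebesgue. V s x = V t x))))"
proof (intro conjI impI allI)
  fix v :: "'a \<Rightarrow> real"
  assume sub: "(2 < N' \<and> N' \<le> 10 + 4 * \<tau> \<and> p > 1) \<or> (N' > 10 + 4 * \<tau> \<and> 1 < p \<and> ereal p < p_crit N' \<tau>)"
    and v: "solution \<theta> l p UNIV v \<and> is_stable \<theta> l p UNIV v"
  have sub': "(N' \<le> 10 + 4 * \<tau> \<and> p > 1) \<or> (N' > 10 + 4 * \<tau> \<and> 1 < p \<and> ereal p < p_crit N' \<tau>)" using sub by blast
  show "AE x in lebesgue. v x = 0"
    by (rule stable_solution_zero[OF assms(2-5) sub']) (use v in auto)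
next
  assume pc: "p_crit N' \<tau> \<le> ereal p"
  \<comment> \<open>A real \<open>p\<close> can reach the critical power only if that power is
    finite.\<close>
  have N10: "N' > 10 + 4 * \<tau>"
  proof (rule ccontr)
    assume "\<not> N' > 10 + 4 * \<tau>"
    then have "p_crit N' \<tau> = \<infinity>" by (simp add: p_crit_def)
    then show False using pc by simp
  qed
  define m where "m = 2 + l - \<theta>"
  have m: "m > 0" "2 + \<tau> = m" using assms by (auto simp: m_def)
  define y where "y = (N' - 2) / (2 + \<tau>)"
  define r where "r = sqrt (2 * y + 1)"
  have P: "y > 4" "y - 1 - r > 0" "p_crit N' \<tau> = ereal (1 + 2 / (y - 1 - r))"
    using p_crit_eq[OF assms(5) N10] unfolding r_def y_def by blast+
  show "p_crit N' \<tau> < \<infinity>" by (simp add: P(3))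
  have pge: "1 + 2 / (y - 1 - r) \<le> p" using pc by (simp add: P(3))
  moreover have "0 < 2 / (y - 1 - r)" using P(2) by simp
  ultimately have p: "p > 1" by linarith
  have q: "2 \<le> (p - 1) * (y - 1 - r)" using pge P(2) by (simp add: field_simps)
  have r0: "r > 0" using P(1) by (simp add: r_def)
  have r2: "r\<^sup>2 = 2 * y + 1" using P(1) by (simp add: r_def)
  define \<alpha> where "\<alpha> = 1 / (p - 1)"
  have \<alpha>: "\<alpha> * (p - 1) = 1" "\<alpha> > 0" using p by (auto simp: \<alpha>_def)
  have yp: "(p - 1) * y > 2"
  proof -
    have "(p - 1) * (y - 1 - r) < (p - 1) * y" using p r0 by (intro mult_strict_left_mono) auto
    then show ?thesis using q by linarith
  qed
  have A: "y - 2 * \<alpha> > 0" using yp p by (simp add: \<alpha>_def field_simps)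
  \<comment> \<open>As a quadratic inequality in \<open>z = p - 1\<close> the condition factors by
    means of \<open>r^2 = 2 * y + 1\<close>. The larger root is \<open>2 / (y - 1 - r)\<close>, so
    \<open>z\<close> is at least both roots and both factors are nonnegative.\<close>
  have stab: "4 * p * \<alpha> * (y - \<alpha>) \<le> y\<^sup>2"
  proof -
    define z where "z = p - 1"
    have z: "z > 0" "p = z + 1" using p by (auto simp: z_def)
    have "2 \<le> z * (y - 1 + r)"
    proof -
      have "z * (y - 1 - r) \<le> z * (y - 1 + r)" using z r0 by (intro mult_left_mono) auto
      then show ?thesis using q by (simp add: z_def)
    qed
    then have "0 \<le> (z * (y - 1 - r) - 2) * (z * (y - 1 + r) - 2)" using q by (intro mult_nonneg_nonneg) (auto simp: z_def)
    also have "\<dots> = z\<^sup>2 * ((y - 1)\<^sup>2 - r\<^sup>2) - 4 * z * (y - 1) + 4" by (simp add: power2_eq_square algebra_simps)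
    also have "\<dots> = z\<^sup>2 * y\<^sup>2 - 4 * (z + 1) * (z * y - 1)" unfolding r2 by (simp add: power2_eq_square algebra_simps)
    finally have "4 * (z + 1) * (z * y - 1) \<le> z\<^sup>2 * y\<^sup>2" by simp
    then have "\<alpha>\<^sup>2 * (4 * (z + 1) * (z * y - 1)) \<le> \<alpha>\<^sup>2 * (z\<^sup>2 * y\<^sup>2)" by (intro mult_left_mono) auto
    moreover have "\<alpha>\<^sup>2 * (4 * (z + 1) * (z * y - 1)) = 4 * p * \<alpha> * ((\<alpha> * z) * y - \<alpha>)"
      unfolding z(2) by (simp add: power2_eq_square algebra_simps)
    moreover have "\<alpha>\<^sup>2 * (z\<^sup>2 * y\<^sup>2) = (\<alpha> * z)\<^sup>2 * y\<^sup>2" by (simp add: power_mult_distrib)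
    ultimately show ?thesis using \<alpha>(1) unfolding z_def[symmetric] by simp
  qed
  have ex: "\<exists>V :: 'a \<Rightarrow> real. solution \<theta> l p UNIV V \<and> is_stable \<theta> l p UNIV V \<and> radial V \<and> (\<forall>x. V x > 0) \<and> continuous_on UNIV V \<and> V 0 = s"
    if s0: "s > 0" for s
  proof -
    have K: "real DIM('a) + \<theta> - 2 > 0" using assms by simp
    have m': "2 + l - \<theta> > 0" using m by (simp add: m_def)
    have \<kappa>: "y * (2 + l - \<theta>) = real DIM('a) + \<theta> - 2" unfolding y_def m(2) m_def[symmetric] using m(1) assms(2) by simp
    show ?thesis
    proof (rule radial_stable_solution[OF K m' p s0 \<kappa> \<alpha>(1) A stab], goal_cases)
      case (1 V)
      then show ?case by blast
    qed
  qed
  \<comment> \<open>Continuity and the value at 0 are kept in the choice because they separate the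
    solutions for different \<open>s\<close>.\<close>
  define V where "V = (\<lambda>s. SOME V :: 'a \<Rightarrow> real. solution \<theta> l p UNIV V \<and> is_stable \<theta> l p UNIV V \<and> radial V \<and> (\<forall>x. V x > 0) \<and> continuous_on UNIV V \<and> V 0 = s)"
  have V: "solution \<theta> l p UNIV (V s) \<and> is_stable \<theta> l p UNIV (V s) \<and> radial (V s) \<and> (\<forall>x. V s x > 0) \<and> continuous_on UNIV (V s) \<and> V s 0 = s"
    if "s > 0" for s
    unfolding V_def by (rule someI_ex[OF ex[OF that]])
  have ne: "\<not> (AE x in lebesgue. V s x = V t x)" if "s > 0" "t > 0" "s \<noteq> t" for s t
  proof
    assume ae: "AE x in lebesgue. V s x = V t x"
    have "V s = V t" by (rule continuous_AE_eq_imp_eq[OF _ _ ae]) (use V that in auto)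
    then have "V s 0 = V t 0" by simp
    then show False using V[OF that(1)] V[OF that(2)] that(3) by simp
  qed
  show "\<exists>V :: real \<Rightarrow> 'a \<Rightarrow> real.
               (\<forall>s>0. solution \<theta> l p UNIV (V s) \<and> is_stable \<theta> l p UNIV (V s) \<and>
                      radial (V s) \<and> (\<forall>x. V s x > 0)) \<and>
               (\<forall>s>0. \<forall>t>0. s \<noteq> t \<longrightarrow> \<not> (AE x in lebesgue. V s x = V t x))"
    by (rule exI[of _ V]) (use V ne in blast)
qed

end
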